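(* Let $B=M_2(\mathbb{C})$ and $A=\mathbb{C}^2=\mathrm{C}^*(\mathbb{Z}_2)$ with its standard cocommutative comultiplication. Let $\mathscr{QS}(C)$ be the quantum space of all maps $\mathscr{QS}(B)\to\mathscr{QS}(A)$. Then $C$ does not admit a compact quantum group structure; that is, there is no unital $*$-homomorphism $\Delta\colon C\to C\otimes C$ for which $(C,\Delta)$ is a compact quantum group.
   Context: For a $\mathrm{C}^*$-algebra $A$, $\mathscr{QS}(A)$ denotes the corresponding quantum space (a formal object dual to $A$); $\otimes$ is the minimal tensor product. Quantum space of all maps: for $B$ a finite-dimensional $\mathrm{C}^*$-algebra and $A$ a unital finitely generated $\mathrm{C}^*$-algebra, there is a unital $\mathrm{C}^*$-algebra $C$ with a unital $*$-homomorphism $\Phi\colon A\to B\otimes C$, unique up to isomorphism, such that for every unital $\mathrm{C}^*$-algebra $D$ and every unital $*$-homomorphism $\Psi\colon A\to B\otimes D$ there is a unique unital $*$-homomorphism $\Lambda\colon C\to D$ with $(\mathrm{id}\otimes\Lambda)\circ\Phi=\Psi$. Then $\mathscr{QS}(C)$ is called the quantum space of all maps $\mathscr{QS}(B)\to\mathscr{QS}(A)$. A compact quantum group structure on a unital $\mathrm{C}^*$-algebra $C$ is a unital $*$-homomorphism $\Delta\colon C\to C\otimes C$ such that $(\Delta\otimes\mathrm{id})\circ\Delta=(\mathrm{id}\otimes\Delta)\circ\Delta$ and the linear spans of $\Delta(C)(\mathbb{1}\otimes C)$ and $\Delta(C)(C\otimes\mathbb{1})$ are dense in $C\otimes C$.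 *)

theory Defs
  imports "HOL-Analysis.Analysis" "HOL-Algebra.Ring"
begin

section \<open>Unital C*-algebras\<close>

record 'a cstar_alg = "'a ring" +
  cscale :: "complex \<Rightarrow> 'a \<Rightarrow> 'a"
  cstar :: "'a \<Rightarrow> 'a"
  cnorm :: "'a \<Rightarrow> real"

text \<open>As usual for unital algebras, the zero algebra is excluded. Consequently the carrier of a
  unital C*-algebra contains a copy of the complex numbers, so its type has at least the
  cardinality of the continuum.\<close>

locale unital_cstar_algebra = ring A for A :: "'a cstar_alg" (structure) +
  assumes one_not_zero: "\<one> \<noteq> \<zero>"
    and cscale_closed: "x \<in> carrier A \<Longrightarrow> cscale A z x \<in> carrier A"
    and cscale_add_right:
      "x \<in> carrier A \<Longrightarrow> y \<in> carrier A \<Longrightarrow> cscale A z (x \<oplus> y) = cscale A z x \<oplus> cscale A z y"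
    and cscale_add_left: "x \<in> carrier A \<Longrightarrow> cscale A (z + w) x = cscale A z x \<oplus> cscale A w x"
    and cscale_cscale: "x \<in> carrier A \<Longrightarrow> cscale A z (cscale A w x) = cscale A (z * w) x"
    and cscale_one: "x \<in> carrier A \<Longrightarrow> cscale A 1 x = x"
    and cscale_mult_left:
      "x \<in> carrier A \<Longrightarrow> y \<in> carrier A \<Longrightarrow> cscale A z x \<otimes> y = cscale A z (x \<otimes> y)"
    and cscale_mult_right:
      "x \<in> carrier A \<Longrightarrow> y \<in> carrier A \<Longrightarrow> x \<otimes> cscale A z y = cscale A z (x \<otimes> y)"
    and cstar_closed: "x \<in> carrier A \<Longrightarrow> cstar A x \<in> carrier A"
    and cstar_add:
      "x \<in> carrier A \<Longrightarrow> y \<in> carrier A \<Longrightarrow> cstar A (x \<oplus> y) = cstar A x \<oplus> cstar A y"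
    and cstar_cscale: "x \<in> carrier A \<Longrightarrow> cstar A (cscale A z x) = cscale A (cnj z) (cstar A x)"
    and cstar_mult:
      "x \<in> carrier A \<Longrightarrow> y \<in> carrier A \<Longrightarrow> cstar A (x \<otimes> y) = cstar A y \<otimes> cstar A x"
    and cstar_cstar: "x \<in> carrier A \<Longrightarrow> cstar A (cstar A x) = x"
    and cnorm_nonneg: "x \<in> carrier A \<Longrightarrow> 0 \<le> cnorm A x"
    and cnorm_eq_zero: "x \<in> carrier A \<Longrightarrow> cnorm A x = 0 \<longleftrightarrow> x = \<zero>"
    and cnorm_triangle:
      "x \<in> carrier A \<Longrightarrow> y \<in> carrier A \<Longrightarrow> cnorm A (x \<oplus> y) \<le> cnorm A x + cnorm A y"
    and cnorm_cscale: "x \<in> carrier A \<Longrightarrow> cnorm A (cscale A z x) = cmod z * cnorm A x"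
    and cnorm_mult:
      "x \<in> carrier A \<Longrightarrow> y \<in> carrier A \<Longrightarrow> cnorm A (x \<otimes> y) \<le> cnorm A x * cnorm A y"
    and cnorm_cstar_mult: "x \<in> carrier A \<Longrightarrow> cnorm A (cstar A x \<otimes> x) = (cnorm A x)\<^sup>2"
    and complete: "Metric_space.mcomplete (carrier A) (\<lambda>x y. cnorm A (x \<ominus> y))"

definition unital_star_hom :: "'a cstar_alg \<Rightarrow> 'b cstar_alg \<Rightarrow> ('a \<Rightarrow> 'b) \<Rightarrow> bool" where
  "unital_star_hom A B f \<longleftrightarrow>
     f \<in> ring_hom A B \<and>
     (\<forall>z. \<forall>x\<in>carrier A. f (cscale A z x) = cscale B z (f x)) \<and>
     (\<forall>x\<in>carrier A. f (cstar A x) = cstar B (f x))"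

inductive_set cspan :: "'a cstar_alg \<Rightarrow> 'a set \<Rightarrow> 'a set" for A S where
  zero: "\<zero>\<^bsub>A\<^esub> \<in> cspan A S"
| add_scaled: "x \<in> cspan A S \<Longrightarrow> s \<in> S \<Longrightarrow> x \<oplus>\<^bsub>A\<^esub> cscale A z s \<in> cspan A S"

definition cdense :: "'a cstar_alg \<Rightarrow> 'a set \<Rightarrow> bool" where
  "cdense A S \<longleftrightarrow> (\<forall>x\<in>carrier A. \<forall>e>0. \<exists>s\<in>S. cnorm A (x \<ominus>\<^bsub>A\<^esub> s) < e)"

definition M2 :: "(complex^2^2) cstar_alg" where
  "M2 = \<lparr>carrier = UNIV, mult = (**), one = mat 1, zero = 0, add = (+),
         cscale = (\<lambda>z m. \<chi> i j. z * m $ i $ j),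
         cstar = (\<lambda>m. \<chi> i j. cnj (m $ j $ i)),
         cnorm = (\<lambda>m. onorm (\<lambda>v. m *v v))\<rparr>"

definition C2 :: "(complex^2) cstar_alg" where
  "C2 = \<lparr>carrier = UNIV, mult = (*), one = 1, zero = 0, add = (+),
         cscale = (\<lambda>z x. \<chi> i. z * x $ i),
         cstar = (\<lambda>x. \<chi> i. cnj (x $ i)),
         cnorm = (\<lambda>x. Max (range (\<lambda>i. cmod (x $ i))))\<rparr>"


section \<open>Representations on Hilbert spaces\<close>

text \<open>A bounded operator \<open>T\<close> on the Hilbert space of square-summable families indexed by the type
  \<open>'i\<close> is given by its matrix \<open>m i j = \<langle>e\<^sub>i, T e\<^sub>j\<rangle>\<close>; conversely a matrix comes from a bounded
  operator iff its sesquilinear form is bounded on finitely supported vectors of norm at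
  most 1, and the supremum is then the operator norm.\<close>

type_synonym 'i op = "'i \<Rightarrow> 'i \<Rightarrow> complex"

definition op_form_values :: "'i op \<Rightarrow> real set" where
  "op_form_values m =
     {cmod (\<Sum>i\<in>I. \<Sum>j\<in>J. cnj (v i) * m i j * w j) | I J v w.
        finite I \<and> finite J \<and> (\<Sum>i\<in>I. (cmod (v i))\<^sup>2) \<le> 1 \<and> (\<Sum>j\<in>J. (cmod (w j))\<^sup>2) \<le> 1}"

definition bounded_op :: "'i op \<Rightarrow> bool" where
  "bounded_op m \<longleftrightarrow> bdd_above (op_form_values m)"

definition op_norm :: "'i op \<Rightarrow> real" where
  "op_norm m = Sup (op_form_values m)"

definition op_zero :: "'i op" where
  "op_zero = (\<lambda>i j. 0)"

definition op_add :: "'i op \<Rightarrow> 'i op \<Rightarrow> 'i op" where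
  "op_add m n = (\<lambda>i j. m i j + n i j)"

definition op_diff :: "'i op \<Rightarrow> 'i op \<Rightarrow> 'i op" where
  "op_diff m n = (\<lambda>i j. m i j - n i j)"

definition op_scale :: "complex \<Rightarrow> 'i op \<Rightarrow> 'i op" where
  "op_scale z m = (\<lambda>i j. z * m i j)"

definition op_mult :: "'i op \<Rightarrow> 'i op \<Rightarrow> 'i op" where
  "op_mult m n = (\<lambda>i k. \<Sum>\<^sub>\<infinity>j. m i j * n j k)"

definition op_adjoint :: "'i op \<Rightarrow> 'i op" where
  "op_adjoint m = (\<lambda>i j. cnj (m j i))"

definition op_tensor :: "'i op \<Rightarrow> 'j op \<Rightarrow> ('i \<times> 'j) op" where
  "op_tensor m n = (\<lambda>(i, j) (k, l). m i k * n j l)"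

text \<open>Representations need not be unital, so that one on a smaller Hilbert space can be extended
  by zero.\<close>

definition star_representation :: "'a cstar_alg \<Rightarrow> ('a \<Rightarrow> 'i op) \<Rightarrow> bool" where
  "star_representation A \<pi> \<longleftrightarrow>
     (\<forall>x\<in>carrier A. bounded_op (\<pi> x)) \<and>
     (\<forall>x\<in>carrier A. \<forall>y\<in>carrier A. \<pi> (x \<oplus>\<^bsub>A\<^esub> y) = op_add (\<pi> x) (\<pi> y)) \<and>
     (\<forall>x\<in>carrier A. \<forall>y\<in>carrier A. \<pi> (x \<otimes>\<^bsub>A\<^esub> y) = op_mult (\<pi> x) (\<pi> y)) \<and>
     (\<forall>z. \<forall>x\<in>carrier A. \<pi> (cscale A z x) = op_scale z (\<pi> x)) \<and>
     (\<forall>x\<in>carrier A. \<pi> (cstar A x) = op_adjoint (\<pi> x))"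


section \<open>The minimal tensor product\<close>

text \<open>The minimal (spatial) norm of \<open>\<Sum>\<^sub>k a\<^sub>k \<otimes> b\<^sub>k\<close> is the supremum of the operator norms of
  \<open>\<Sum>\<^sub>k \<pi>(a\<^sub>k) \<otimes> \<sigma>(b\<^sub>k)\<close> over all representations \<open>\<pi>\<close> of \<open>A\<close> and \<open>\<sigma>\<close> of \<open>B\<close>. Cyclic
  representations suffice for this supremum, and since a cyclic representation of \<open>A\<close> lives on a
  Hilbert space with a dense subset no larger than \<open>A\<close>, it is enough to let \<open>\<pi>\<close> act on the
  square-summable families indexed by the type of \<open>A\<close>, and likewise for \<open>\<sigma>\<close>.

  The completion is realised concretely: an element of the tensor product is the family of its
  images under all \<open>\<pi> \<otimes> \<sigma>\<close>, and the carrier is the closure of the finite sums of elementary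
  tensors for the supremum norm. Families are set to zero at pairs of functions
  that are not representations.\<close>

type_synonym ('a, 'b) tensor = "('a \<Rightarrow> 'a op) \<times> ('b \<Rightarrow> 'b op) \<Rightarrow> ('a \<times> 'b) op"

definition rep_pairs ::
    "'a cstar_alg \<Rightarrow> 'b cstar_alg \<Rightarrow> (('a \<Rightarrow> 'a op) \<times> ('b \<Rightarrow> 'b op)) set" where
  "rep_pairs A B = {\<pi>. star_representation A \<pi>} \<times> {\<sigma>. star_representation B \<sigma>}"

definition elem_tensor ::
    "'a cstar_alg \<Rightarrow> 'b cstar_alg \<Rightarrow> 'a \<Rightarrow> 'b \<Rightarrow> ('a, 'b) tensor" where
  "elem_tensor A B a b =
     (\<lambda>(\<pi>, \<sigma>). if (\<pi>, \<sigma>) \<in> rep_pairs A B then op_tensor (\<pi> a) (\<sigma> b) else op_zero)"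

inductive_set alg_tensor :: "'a cstar_alg \<Rightarrow> 'b cstar_alg \<Rightarrow> ('a, 'b) tensor set" for A B where
  zero: "(\<lambda>p. op_zero) \<in> alg_tensor A B"
| add_elem: "t \<in> alg_tensor A B \<Longrightarrow> a \<in> carrier A \<Longrightarrow> b \<in> carrier B \<Longrightarrow>
    (\<lambda>p. op_add (t p) (elem_tensor A B a b p)) \<in> alg_tensor A B"

definition min_tensor :: "'a cstar_alg \<Rightarrow> 'b cstar_alg \<Rightarrow> ('a, 'b) tensor cstar_alg" where
  "min_tensor A B =
     \<lparr>carrier = {x. (\<forall>p. p \<notin> rep_pairs A B \<longrightarrow> x p = op_zero) \<and>
        (\<forall>e>0. \<exists>t\<in>alg_tensor A B. \<forall>p\<in>rep_pairs A B.
           bounded_op (op_diff (x p) (t p)) \<and> op_norm (op_diff (x p) (t p)) \<le> e)},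
      mult = (\<lambda>x y p. op_mult (x p) (y p)),
      one = elem_tensor A B \<one>\<^bsub>A\<^esub> \<one>\<^bsub>B\<^esub>,
      zero = (\<lambda>p. op_zero),
      add = (\<lambda>x y p. op_add (x p) (y p)),
      cscale = (\<lambda>z x p. op_scale z (x p)),
      cstar = (\<lambda>x p. op_adjoint (x p)),
      cnorm = (\<lambda>x. SUP p\<in>rep_pairs A B. op_norm (x p))\<rparr>"

text \<open>\<open>F = f \<otimes> g\<close>: the extension by continuity of \<open>a \<otimes> b \<mapsto> f(a) \<otimes> g(b)\<close> to the completions. It
  is unique on the carrier, and exists for all unital *-homomorphisms \<open>f\<close> and \<open>g\<close>.\<close>

definition is_tensor_hom ::
    "'a cstar_alg \<Rightarrow> 'b cstar_alg \<Rightarrow> 'c cstar_alg \<Rightarrow> 'd cstar_alg \<Rightarrow>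
     ('a \<Rightarrow> 'c) \<Rightarrow> ('b \<Rightarrow> 'd) \<Rightarrow> (('a, 'b) tensor \<Rightarrow> ('c, 'd) tensor) \<Rightarrow> bool" where
  "is_tensor_hom A B C D f g F \<longleftrightarrow>
     unital_star_hom (min_tensor A B) (min_tensor C D) F \<and>
     (\<forall>x\<in>carrier (min_tensor A B). cnorm (min_tensor C D) (F x) \<le> cnorm (min_tensor A B) x) \<and>
     (\<forall>a\<in>carrier A. \<forall>b\<in>carrier B. F (elem_tensor A B a b) = elem_tensor C D (f a) (g b))"

text \<open>The canonical isomorphism \<open>(A \<otimes> B) \<otimes> C \<cong> A \<otimes> (B \<otimes> C)\<close>.\<close>

definition is_associator ::
    "'a cstar_alg \<Rightarrow> 'b cstar_alg \<Rightarrow> 'c cstar_alg \<Rightarrow>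
     ((('a, 'b) tensor, 'c) tensor \<Rightarrow> ('a, ('b, 'c) tensor) tensor) \<Rightarrow> bool" where
  "is_associator A B C \<alpha> \<longleftrightarrow>
     (let L = min_tensor (min_tensor A B) C; R = min_tensor A (min_tensor B C) in
      unital_star_hom L R \<alpha> \<and> bij_betw \<alpha> (carrier L) (carrier R) \<and>
      (\<forall>x\<in>carrier L. cnorm R (\<alpha> x) = cnorm L x) \<and>
      (\<forall>a\<in>carrier A. \<forall>b\<in>carrier B. \<forall>c\<in>carrier C.
         \<alpha> (elem_tensor (min_tensor A B) C (elem_tensor A B a b) c) =
         elem_tensor A (min_tensor B C) a (elem_tensor B C b c)))"


section \<open>Quantum spaces of all maps and compact quantum groups\<close>

text \<open>The universal property is tested on all unital C*-algebras \<open>D\<close> on the type of \<open>C\<close>. For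
  finite-dimensional \<open>B\<close> and finitely generated \<open>A\<close>, a given \<open>\<Psi>\<close> takes values in \<open>B \<otimes> D\<^sub>0\<close>
  for a separable unital subalgebra \<open>D\<^sub>0\<close> of \<open>D\<close>; it has the cardinality of the continuum, so
  it has an isomorphic copy on the type of \<open>C\<close>. Hence these \<open>D\<close> determine \<open>(C, \<Phi>)\<close> up to
  isomorphism, and the universal property then holds for arbitrary \<open>D\<close>.\<close>

definition quantum_space_of_all_maps ::
    "'b cstar_alg \<Rightarrow> 'a cstar_alg \<Rightarrow> 'c cstar_alg \<Rightarrow> ('a \<Rightarrow> ('b, 'c) tensor) \<Rightarrow> bool" where
  "quantum_space_of_all_maps B A C \<Phi> \<longleftrightarrow>
     unital_cstar_algebra C \<and>
     unital_star_hom A (min_tensor B C) \<Phi> \<and>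
     (\<forall>(D :: 'c cstar_alg) \<Psi>.
        unital_cstar_algebra D \<longrightarrow> unital_star_hom A (min_tensor B D) \<Psi> \<longrightarrow>
        (\<exists>!\<Lambda>. \<Lambda> \<in> extensional (carrier C) \<and> unital_star_hom C D \<Lambda> \<and>
           (\<exists>F. is_tensor_hom B C B D (\<lambda>b. b) \<Lambda> F \<and> (\<forall>a\<in>carrier A. F (\<Phi> a) = \<Psi> a))))"

text \<open>\<open>(\<Delta> \<otimes> id) \<circ> \<Delta> = (id \<otimes> \<Delta>) \<circ> \<Delta>\<close>, with the two threefold tensor products identified by
  the associator.\<close>

definition coassociative :: "'c cstar_alg \<Rightarrow> ('c \<Rightarrow> ('c, 'c) tensor) \<Rightarrow> bool" where
  "coassociative C \<Delta> \<longleftrightarrow>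
     (\<exists>F G \<alpha>.
        is_tensor_hom C C (min_tensor C C) C \<Delta> (\<lambda>c. c) F \<and>
        is_tensor_hom C C C (min_tensor C C) (\<lambda>c. c) \<Delta> G \<and>
        is_associator C C C \<alpha> \<and>
        (\<forall>c\<in>carrier C. \<alpha> (F (\<Delta> c)) = G (\<Delta> c)))"

definition compact_quantum_group :: "'c cstar_alg \<Rightarrow> ('c \<Rightarrow> ('c, 'c) tensor) \<Rightarrow> bool" where
  "compact_quantum_group C \<Delta> \<longleftrightarrow>
     unital_cstar_algebra C \<and>
     unital_star_hom C (min_tensor C C) \<Delta> \<and>
     coassociative C \<Delta> \<and>
     cdense (min_tensor C C) (cspan (min_tensor C C)
       {\<Delta> c \<otimes>\<^bsub>min_tensor C C\<^esub> elem_tensor C C \<one>\<^bsub>C\<^esub> d | c d. c \<in> carrier C \<and> d \<in> carrier C}) \<and>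
     cdense (min_tensor C C) (cspan (min_tensor C C)
       {\<Delta> c \<otimes>\<^bsub>min_tensor C C\<^esub> elem_tensor C C d \<one>\<^bsub>C\<^esub> | c d. c \<in> carrier C \<and> d \<in> carrier C})"

text \<open>Under \<open>C*(\<int>\<^sub>2) = \<complex>\<^sup>2\<close> the group elements are \<open>1\<close> and \<open>u = (1, -1)\<close>, and the standard
  comultiplication is the linear map with \<open>1 \<mapsto> 1 \<otimes> 1\<close> and \<open>u \<mapsto> u \<otimes> u\<close>.\<close>

definition Z2_generator :: "complex^2" where
  "Z2_generator = (\<chi> i. if i = 1 then 1 else - 1)"

definition Z2_comult :: "complex^2 \<Rightarrow> (complex^2, complex^2) tensor" where
  "Z2_comult x =
     cscale (min_tensor C2 C2) ((x $ 1 + x $ 2) / 2) (elem_tensor C2 C2 1 1)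
     \<oplus>\<^bsub>min_tensor C2 C2\<^esub>
     cscale (min_tensor C2 C2) ((x $ 1 - x $ 2) / 2) (elem_tensor C2 C2 Z2_generator Z2_generator)"

end

theory Submission
  imports Defs
begin

text \<open>
  A unital homomorphism from \<open>\<complex>\<^sup>2\<close> is the same as a projection, so \<open>C\<close> is generated by the entries of a
  universal projection in \<open>M\<^sub>2(C)\<close>, and its characters correspond to the projections in \<open>M\<^sub>2(\<complex>)\<close>. They
  form a compact space with three components: the points \<open>0\<close> and \<open>1\<close>, and the 2-sphere of
  rank-one projections. A compact quantum group structure \<open>\<Delta>\<close> on \<open>C\<close> yields a product
  \<open>\<psi> * \<kappa> = (\<psi> \<otimes> \<kappa>)\<Delta>\<close> on this space. It is continuous, and the two density
  conditions make it cancellative on both sides (\<open>convolve_left_cancel\<close>,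
  \<open>convolve_right_cancel\<close>). Such a product does not exist. By connectedness and injectivity every
  translation, left or right, maps the sphere into itself, and then onto itself, because an
  injective continuous self-map of the sphere is surjective (\<open>injective_projection_family\<close>). Let \<open>\<psi>\<close> be
  a point of the sphere and let \<open>\<eta>\<close> be the character that belongs to \<open>0\<close>. Right translation by \<open>\<eta>\<close>
  shows that \<open>\<psi> * \<eta>\<close> lies in the sphere. Left translation by \<open>\<psi>\<close> shows that
  \<open>\<psi> * \<eta> = \<psi> * \<kappa>\<close> for some \<open>\<kappa>\<close> in the sphere. Cancelling \<open>\<psi>\<close> gives \<open>\<eta> = \<kappa>\<close>, a contradiction.

  Two facts about characters of \<open>C\<close> are used. A character is determined by its projection
  (\<open>character_determined_by_slice\<close>); this is the uniqueness part of the universal property,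
  tested on \<open>C\<close> itself. And the characters can be chosen to depend continuously on the projection
  (\<open>continuous_character_family\<close>); this is the existence part, tested on the algebra \<open>D\<close> of continuous
  functions on the sphere and the point \<open>0\<close>, with its tautological projection. The type of \<open>C\<close> is large
  enough to hold a copy of \<open>D\<close>, since there are only continuum many such functions.

  An element of the minimal tensor product is a family of operators, indexed by pairs of
  representations, so product characters and slice maps are evaluations at suitable indices. They
  are continuous for the tensor norm provided that the supremum which defines this norm is finite,
  that is, provided that the representations of each factor are uniformly bounded on every
  element. For \<open>D\<close> this follows by solving \<open>a\<^sup>*a + b\<^sup>*b = 1\<close>. For \<open>C\<close> it is inferred from the contraction
  \<open>id \<otimes> \<Lambda>\<close> that the universal property supplies along with \<open>\<Lambda>\<close> from \<open>C\<close> to \<open>D\<close>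
  (\<open>tensor_factor_of_contraction\<close>).
\<close>

section \<open>Bounded operators as infinite matrices\<close>

text \<open>A bound for the operator norm, in terms of the action on finitely supported vectors instead of the
sesquilinear form. It composes well, and it stays meaningful when the supremum that defines the
norm is not yet known to be finite.\<close>

definition op_bound :: "'i op \<Rightarrow> real \<Rightarrow> bool" where
  "op_bound m K \<longleftrightarrow> 0 \<le> K \<and> (\<forall>I J w. finite I \<longrightarrow> finite J \<longrightarrow>
     L2_set (\<lambda>i. cmod (\<Sum>j\<in>J. m i j * w j)) I \<le> K * L2_set (\<lambda>j. cmod (w j)) J)"

lemma op_boundD:
  "op_bound m K \<Longrightarrow> finite I \<Longrightarrow> finite J \<Longrightarrow>
     L2_set (\<lambda>i. cmod (\<Sum>j\<in>J. m i j * w j)) I \<le> K * L2_set (\<lambda>j. cmod (w j)) J"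
  by (simp add: op_bound_def)

lemma op_bound_nonneg: "op_bound m K \<Longrightarrow> 0 \<le> K"
  by (simp add: op_bound_def)

lemma op_bound_mono: "op_bound m K \<Longrightarrow> K \<le> L \<Longrightarrow> op_bound m L"
  unfolding op_bound_def
  by (meson L2_set_nonneg mult_right_mono order_trans)

lemma cmod_form_le:
  fixes v :: "'i \<Rightarrow> complex"
  shows "cmod (\<Sum>i\<in>I. cnj (v i) * x i) \<le> L2_set (\<lambda>i. cmod (v i)) I * L2_set (\<lambda>i. cmod (x i)) I"
proof -
  have "cmod (\<Sum>i\<in>I. cnj (v i) * x i) \<le> (\<Sum>i\<in>I. cmod (cnj (v i) * x i))"
    by (rule norm_sum)
  also have "\<dots> = (\<Sum>i\<in>I. \<bar>cmod (v i)\<bar> * \<bar>cmod (x i)\<bar>)"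
    by (simp add: norm_mult)
  also have "\<dots> \<le> L2_set (\<lambda>i. cmod (v i)) I * L2_set (\<lambda>i. cmod (x i)) I"
    by (rule L2_set_mult_ineq)
  finally show ?thesis .
qed

lemma form_eq: "(\<Sum>i\<in>I. \<Sum>j\<in>J. cnj (v i) * m i j * w j) = (\<Sum>i\<in>I. cnj (v i) * (\<Sum>j\<in>J. m i j * w j))"
  for m :: "'i op"
  by (simp add: sum_distrib_left mult.assoc)

lemma form_le_op_bound:
  assumes "op_bound m K" "finite I" "finite J"
  shows "cmod (\<Sum>i\<in>I. \<Sum>j\<in>J. cnj (v i) * m i j * w j)
     \<le> K * L2_set (\<lambda>i. cmod (v i)) I * L2_set (\<lambda>j. cmod (w j)) J"
proof -
  have "cmod (\<Sum>i\<in>I. \<Sum>j\<in>J. cnj (v i) * m i j * w j)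
     \<le> L2_set (\<lambda>i. cmod (v i)) I * L2_set (\<lambda>i. cmod (\<Sum>j\<in>J. m i j * w j)) I"
    unfolding form_eq by (rule cmod_form_le)
  also have "\<dots> \<le> L2_set (\<lambda>i. cmod (v i)) I * (K * L2_set (\<lambda>j. cmod (w j)) J)"
    by (intro mult_left_mono op_boundD assms) simp
  finally show ?thesis by (simp add: mult_ac)
qed

text \<open>Testing the form on \<open>v = m w\<close> gives \<open>\<parallel>m w\<parallel>\<^sup>2 \<le> K \<parallel>m w\<parallel> \<parallel>w\<parallel>\<close>.\<close>

lemma op_boundI_form:
  assumes "0 \<le> K"
    and *: "\<And>I J v w. finite I \<Longrightarrow> finite J \<Longrightarrow>
      cmod (\<Sum>i\<in>I. \<Sum>j\<in>J. cnj (v i) * m i j * w j)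
        \<le> K * L2_set (\<lambda>i. cmod (v i)) I * L2_set (\<lambda>j. cmod (w j)) J"
  shows "op_bound m K"
  unfolding op_bound_def
proof (intro conjI allI impI assms(1))
  fix I J :: "'a set" and w :: "'a \<Rightarrow> complex"
  assume fin: "finite I" "finite J"
  let ?x = "\<lambda>i. \<Sum>j\<in>J. m i j * w j"
  let ?L = "L2_set (\<lambda>i. cmod (?x i)) I"
  have "?L\<^sup>2 = cmod (\<Sum>i\<in>I. cnj (?x i) * ?x i)"
  proof -
    have "(\<Sum>i\<in>I. cnj (?x i) * ?x i) = complex_of_real (\<Sum>i\<in>I. (cmod (?x i))\<^sup>2)"
      unfolding of_real_sum
      by (rule sum.cong) (auto simp: complex_norm_square mult.commute simp del: of_real_power)
    moreover have "0 \<le> (\<Sum>i\<in>I. (cmod (?x i))\<^sup>2)" by (simp add: sum_nonneg)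
    ultimately show ?thesis
      by (simp add: L2_set_def del: of_real_sum)
  qed
  also have "\<dots> \<le> K * ?L * L2_set (\<lambda>j. cmod (w j)) J"
    using *[OF fin, of ?x w] unfolding form_eq .
  finally have "?L * ?L \<le> ?L * (K * L2_set (\<lambda>j. cmod (w j)) J)"
    by (simp add: power2_eq_square mult_ac)
  moreover have "0 \<le> K * L2_set (\<lambda>j. cmod (w j)) J"
    using assms(1) by simp
  ultimately show "?L \<le> K * L2_set (\<lambda>j. cmod (w j)) J"
    by (cases "?L = 0") (auto simp: mult_le_cancel_left order_less_le)
qed

lemma L2_le_1: "(\<Sum>i\<in>I. (cmod (v i))\<^sup>2) \<le> 1 \<longleftrightarrow> L2_set (\<lambda>i. cmod (v i)) I \<le> 1"
  by (simp add: L2_set_def)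

lemma op_form_values_le:
  assumes "op_bound m K" "r \<in> op_form_values m"
  shows "r \<le> K"
proof -
  obtain I J v w where r: "r = cmod (\<Sum>i\<in>I. \<Sum>j\<in>J. cnj (v i) * m i j * w j)"
    and fin: "finite I" "finite J"
    and le: "L2_set (\<lambda>i. cmod (v i)) I \<le> 1" "L2_set (\<lambda>i. cmod (w i)) J \<le> 1"
    using assms(2) by (auto simp: op_form_values_def L2_le_1)
  have "r \<le> K * L2_set (\<lambda>i. cmod (v i)) I * L2_set (\<lambda>j. cmod (w j)) J"
    unfolding r by (rule form_le_op_bound[OF assms(1) fin])
  also have "\<dots> \<le> K * 1 * 1"
    using le op_bound_nonneg[OF assms(1)] by (intro mult_mono) auto
  finally show ?thesis by simp
qed

lemma zero_in_op_form_values: "0 \<in> op_form_values m"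
  unfolding op_form_values_def
  by (rule CollectI) (rule exI[of _ "{}"], rule exI[of _ "{}"], auto)

lemma op_norm_le: "op_bound m K \<Longrightarrow> op_norm m \<le> K"
  unfolding op_norm_def using zero_in_op_form_values op_form_values_le
  by (metis cSup_least empty_iff)

lemma op_bound_imp_bounded_op: "op_bound m K \<Longrightarrow> bounded_op m"
  unfolding bounded_op_def using op_form_values_le by (metis bdd_aboveI)

text \<open>The supremum runs over vectors of norm at most 1, so this is a rescaling argument.\<close>

lemma op_bound_op_norm:
  assumes "bounded_op m"
  shows "op_bound m (op_norm m)"
proof (rule op_boundI_form)
  have up: "r \<le> op_norm m" if "r \<in> op_form_values m" for r
    unfolding op_norm_def using assms that by (simp add: bounded_op_def cSup_upper)
  show nn: "0 \<le> op_norm m" using up zero_in_op_form_values .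
  fix I J :: "'a set" and v w :: "'a \<Rightarrow> complex"
  assume fin: "finite I" "finite J"
  let ?a = "L2_set (\<lambda>i. cmod (v i)) I" and ?b = "L2_set (\<lambda>i. cmod (w i)) J"
  let ?f = "\<lambda>v w. (\<Sum>i\<in>I. \<Sum>j\<in>J. cnj (v i) * m i j * w j)"
  show "cmod (?f v w) \<le> op_norm m * ?a * ?b"
  proof (cases "?a = 0 \<or> ?b = 0")
    case True
    then have "?f v w = 0"
      using fin by (auto simp: L2_set_eq_0_iff intro!: sum.neutral)
    then show ?thesis using nn by simp
  next
    case False
    then have pos: "?a > 0" "?b > 0" by (auto simp: order_less_le)
    define v' w' where "v' = (\<lambda>i. v i / of_real ?a)" and "w' = (\<lambda>i. w i / of_real ?b)"
    have "L2_set (\<lambda>i. cmod (v' i)) I = L2_set (\<lambda>i. cmod (v i) * inverse ?a) I"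
      unfolding v'_def norm_divide norm_of_real by (simp add: divide_inverse)
    also have "\<dots> = ?a * inverse ?a"
      using pos by (simp only: L2_set_left_distrib less_imp_le positive_imp_inverse_positive)
    finally have 1: "L2_set (\<lambda>i. cmod (v' i)) I \<le> 1" using pos by simp
    have "L2_set (\<lambda>i. cmod (w' i)) J = L2_set (\<lambda>i. cmod (w i) * inverse ?b) J"
      unfolding w'_def norm_divide norm_of_real by (simp add: divide_inverse)
    also have "\<dots> = ?b * inverse ?b"
      using pos by (simp only: L2_set_left_distrib less_imp_le positive_imp_inverse_positive)
    finally have 2: "L2_set (\<lambda>i. cmod (w' i)) J \<le> 1" using pos by simp
    have "cmod (?f v' w') \<in> op_form_values m"
      unfolding op_form_values_def using fin 1 2 by (auto simp: L2_le_1)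
    then have le: "cmod (?f v' w') \<le> op_norm m" by (rule up)
    have "?f v w = of_real (?a * ?b) * ?f v' w'"
      unfolding sum_distrib_left
      using pos by (intro sum.cong refl) (simp add: v'_def w'_def field_simps)
    then have "cmod (?f v w) = ?a * ?b * cmod (?f v' w')"
      using pos by (simp add: norm_mult)
    also have "\<dots> \<le> ?a * ?b * op_norm m"
      using le pos by (intro mult_left_mono) auto
    finally show ?thesis by (simp add: mult_ac)
  qed
qed

lemma bounded_op_iff: "bounded_op m \<longleftrightarrow> (\<exists>K. op_bound m K)"
  using op_bound_op_norm op_bound_imp_bounded_op by blast

lemma op_bound_iff: "op_bound m K \<longleftrightarrow> bounded_op m \<and> op_norm m \<le> K"
  by (metis op_bound_op_norm op_bound_imp_bounded_op op_bound_mono op_norm_le)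

lemma op_bound_zero [simp]: "0 \<le> K \<Longrightarrow> op_bound op_zero K"
  by (simp add: op_bound_def op_zero_def L2_set_0')

lemma op_bound_add:
  assumes "op_bound m K" "op_bound n L"
  shows "op_bound (op_add m n) (K + L)"
  unfolding op_bound_def
proof (intro conjI allI impI)
  show "0 \<le> K + L" using assms by (simp add: op_bound_nonneg)
  fix I J :: "'a set" and w :: "'a \<Rightarrow> complex"
  assume fin: "finite I" "finite J"
  have "L2_set (\<lambda>i. cmod (\<Sum>j\<in>J. op_add m n i j * w j)) I
    \<le> L2_set (\<lambda>i. cmod (\<Sum>j\<in>J. m i j * w j) + cmod (\<Sum>j\<in>J. n i j * w j)) I"
    by (intro L2_set_mono)
      (auto simp: op_add_def distrib_right sum.distrib intro: norm_triangle_ineq)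
  also have "\<dots> \<le> L2_set (\<lambda>i. cmod (\<Sum>j\<in>J. m i j * w j)) I + L2_set (\<lambda>i. cmod (\<Sum>j\<in>J. n i j * w j)) I"
    by (rule L2_set_triangle_ineq)
  also have "\<dots> \<le> K * L2_set (\<lambda>j. cmod (w j)) J + L * L2_set (\<lambda>j. cmod (w j)) J"
    by (intro add_mono op_boundD assms fin)
  finally show "L2_set (\<lambda>i. cmod (\<Sum>j\<in>J. op_add m n i j * w j)) I \<le> (K + L) * L2_set (\<lambda>j. cmod (w j)) J"
    by (simp add: distrib_right)
qed

lemma op_bound_scale:
  assumes "op_bound m K"
  shows "op_bound (op_scale z m) (cmod z * K)"
  unfolding op_bound_def
proof (intro conjI allI impI)
  show "0 \<le> cmod z * K" using assms by (simp add: op_bound_nonneg)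
  fix I J :: "'a set" and w :: "'a \<Rightarrow> complex"
  assume fin: "finite I" "finite J"
  have "L2_set (\<lambda>i. cmod (\<Sum>j\<in>J. op_scale z m i j * w j)) I
     = L2_set (\<lambda>i. cmod z * cmod (\<Sum>j\<in>J. m i j * w j)) I"
    by (simp add: op_scale_def mult.assoc norm_mult flip: sum_distrib_left)
  also have "\<dots> = cmod z * L2_set (\<lambda>i. cmod (\<Sum>j\<in>J. m i j * w j)) I"
    by (simp add: L2_set_right_distrib)
  also have "\<dots> \<le> cmod z * (K * L2_set (\<lambda>j. cmod (w j)) J)"
    by (intro mult_left_mono op_boundD assms fin) simp
  finally show "L2_set (\<lambda>i. cmod (\<Sum>j\<in>J. op_scale z m i j * w j)) I \<le> cmod z * K * L2_set (\<lambda>j. cmod (w j)) J"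
    by (simp add: mult.assoc)
qed

lemma op_diff_eq: "op_diff m n = op_add m (op_scale (-1) n)"
  by (simp add: op_diff_def op_add_def op_scale_def)

lemma op_bound_entry:
  assumes "op_bound m K"
  shows "cmod (m i j) \<le> K"
  using op_boundD[OF assms, of "{i}" "{j}" "\<lambda>_. 1"] by (simp add: L2_set_def)

lemma op_bound_adjoint:
  assumes "op_bound m K"
  shows "op_bound (op_adjoint m) K"
proof (rule op_boundI_form)
  show "0 \<le> K" using assms by (rule op_bound_nonneg)
  fix I J :: "'a set" and v w :: "'a \<Rightarrow> complex"
  assume fin: "finite I" "finite J"
  have "(\<Sum>i\<in>I. \<Sum>j\<in>J. cnj (v i) * op_adjoint m i j * w j)
     = cnj (\<Sum>j\<in>J. \<Sum>i\<in>I. cnj (w j) * m j i * v i)"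
    unfolding cnj_sum by (subst sum.swap) (simp add: op_adjoint_def mult_ac)
  then have "cmod (\<Sum>i\<in>I. \<Sum>j\<in>J. cnj (v i) * op_adjoint m i j * w j)
     = cmod (\<Sum>j\<in>J. \<Sum>i\<in>I. cnj (w j) * m j i * v i)"
    by (simp only: complex_mod_cnj)
  also have "\<dots> \<le> K * L2_set (\<lambda>i. cmod (w i)) J * L2_set (\<lambda>j. cmod (v j)) I"
    by (rule form_le_op_bound[OF assms fin(2,1)])
  finally show "cmod (\<Sum>i\<in>I. \<Sum>j\<in>J. cnj (v i) * op_adjoint m i j * w j)
     \<le> K * L2_set (\<lambda>i. cmod (v i)) I * L2_set (\<lambda>j. cmod (w j)) J"
    by (simp only: mult_ac)
qed

text \<open>The series that defines an operator product converges absolutely because of this and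
Cauchy--Schwarz.\<close>

lemma column_summable:
  assumes "op_bound m K"
  shows "(\<lambda>i. norm (m i j * m i j)) summable_on UNIV"
proof (rule nonneg_bdd_above_summable_on)
  show "bdd_above (sum (\<lambda>i. norm (m i j * m i j)) ` {F. F \<subseteq> UNIV \<and> finite F})"
  proof (rule bdd_aboveI2)
    fix F :: "'a set" assume F: "F \<in> {F. F \<subseteq> UNIV \<and> finite F}"
    have "L2_set (\<lambda>i. cmod (m i j)) F \<le> K"
      using op_boundD[OF assms, of F "{j}" "\<lambda>_. 1"] F by simp
    then have "(L2_set (\<lambda>i. cmod (m i j)) F)\<^sup>2 \<le> K\<^sup>2"
      by (intro power_mono) auto
    then show "(\<Sum>i\<in>F. norm (m i j * m i j)) \<le> K\<^sup>2"
      by (simp add: L2_set_def sum_nonneg norm_mult power2_eq_square)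
  qed
qed auto

lemma row_summable:
  assumes "op_bound m K"
  shows "(\<lambda>j. norm (m i j * m i j)) summable_on UNIV"
  using column_summable[OF op_bound_adjoint[OF assms], of i]
  by (simp add: op_adjoint_def norm_mult)

lemma op_mult_abs_summable:
  assumes "op_bound m K" "op_bound n L"
  shows "(\<lambda>j. norm (m i j * n j k)) summable_on UNIV"
  by (rule abs_summable_product[OF row_summable[OF assms(1)] column_summable[OF assms(2)]])

lemma op_mult_has_sum:
  assumes "op_bound m K" "op_bound n L"
  shows "((\<lambda>j. m i j * n j k) has_sum op_mult m n i k) UNIV"
  unfolding op_mult_def
  using has_sum_infsum[OF abs_summable_summable[OF op_mult_abs_summable[OF assms]]] .

lemma has_sum_finite_sum:
  fixes f :: "'k \<Rightarrow> 'i \<Rightarrow> complex"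
  assumes "\<And>k. k \<in> J \<Longrightarrow> (f k has_sum a k) A"
  shows "((\<lambda>i. \<Sum>k\<in>J. f k i) has_sum (\<Sum>k\<in>J. a k)) A"
  using assms
proof (induction J rule: infinite_finite_induct)
  case (insert k J)
  then show ?case using has_sum_add[of "f k" A "a k"] by simp
qed auto

lemma op_mult_apply_has_sum:
  assumes "op_bound m K" "op_bound n L" "finite J"
  shows "((\<lambda>j. m i j * (\<Sum>k\<in>J. n j k * w k)) has_sum (\<Sum>k\<in>J. op_mult m n i k * w k)) UNIV"
proof -
  have "((\<lambda>j. \<Sum>k\<in>J. w k * (m i j * n j k)) has_sum (\<Sum>k\<in>J. w k * op_mult m n i k)) UNIV"
    by (intro has_sum_finite_sum has_sum_cmult_right op_mult_has_sum[OF assms(1,2)])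
  then show ?thesis by (simp add: sum_distrib_left mult_ac)
qed

text \<open>Every finite section of the sum over the middle index satisfies the bound, and the bound passes
to the limit because it concerns only finitely many output coordinates.\<close>

lemma op_bound_mult:
  assumes "op_bound m K" "op_bound n L"
  shows "op_bound (op_mult m n) (K * L)"
  unfolding op_bound_def
proof (intro conjI allI impI)
  show KL: "0 \<le> K * L" using assms by (simp add: op_bound_nonneg)
  fix I J :: "'a set" and w :: "'a \<Rightarrow> complex"
  assume fin: "finite I" "finite J"
  let ?nw = "\<lambda>j. \<Sum>k\<in>J. n j k * w k"
  let ?W = "L2_set (\<lambda>j. cmod (w j)) J"
  have lim: "((\<lambda>F. sum (\<lambda>j. m i j * ?nw j) F) \<longlongrightarrow> (\<Sum>k\<in>J. op_mult m n i k * w k))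
      (finite_subsets_at_top UNIV)" for i
    using op_mult_apply_has_sum[OF assms fin(2), of i w] by (simp add: has_sum_def)
  have "((\<lambda>F. L2_set (\<lambda>i. cmod (sum (\<lambda>j. m i j * ?nw j) F)) I) \<longlongrightarrow>
      L2_set (\<lambda>i. cmod (\<Sum>k\<in>J. op_mult m n i k * w k)) I) (finite_subsets_at_top UNIV)"
    unfolding L2_set_def by (intro tendsto_intros lim)
  moreover have "\<forall>\<^sub>F F in finite_subsets_at_top UNIV.
      L2_set (\<lambda>i. cmod (sum (\<lambda>j. m i j * ?nw j) F)) I \<le> K * L * ?W"
  proof (rule eventually_finite_subsets_at_top_weakI)
    fix F :: "'a set" assume F: "finite F"
    have "L2_set (\<lambda>i. cmod (sum (\<lambda>j. m i j * ?nw j) F)) I \<le> K * L2_set (\<lambda>j. cmod (?nw j)) F"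
      by (rule op_boundD[OF assms(1) fin(1) F])
    also have "\<dots> \<le> K * (L * ?W)"
      by (intro mult_left_mono op_boundD[OF assms(2) F fin(2)] op_bound_nonneg[OF assms(1)])
    finally show "L2_set (\<lambda>i. cmod (sum (\<lambda>j. m i j * ?nw j) F)) I \<le> K * L * ?W"
      by (simp add: mult.assoc)
  qed
  ultimately show "L2_set (\<lambda>i. cmod (\<Sum>k\<in>J. op_mult m n i k * w k)) I \<le> K * L * ?W"
    by (rule tendsto_upperbound) simp
qed

lemma op_mult_add_left:
  assumes "bounded_op m" "bounded_op m'" "bounded_op n"
  shows "op_mult (op_add m m') n = op_add (op_mult m n) (op_mult m' n)"
proof (intro ext)
  fix i k
  obtain K K' L where b: "op_bound m K" "op_bound m' K'" "op_bound n L"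
    using assms bounded_op_iff by blast
  have "((\<lambda>j. m i j * n j k + m' i j * n j k) has_sum (op_mult m n i k + op_mult m' n i k)) UNIV"
    by (intro has_sum_add op_mult_has_sum[OF b(1,3)] op_mult_has_sum[OF b(2,3)])
  then show "op_mult (op_add m m') n i k = op_add (op_mult m n) (op_mult m' n) i k"
    unfolding op_mult_def op_add_def by (simp add: infsumI distrib_right)
qed

lemma op_mult_add_right:
  assumes "bounded_op m" "bounded_op m'" "bounded_op n"
  shows "op_mult n (op_add m m') = op_add (op_mult n m) (op_mult n m')"
proof (intro ext)
  fix i k
  obtain K K' L where b: "op_bound m K" "op_bound m' K'" "op_bound n L"
    using assms bounded_op_iff by blast
  have "((\<lambda>j. n i j * m j k + n i j * m' j k) has_sum (op_mult n m i k + op_mult n m' i k)) UNIV"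
    by (intro has_sum_add op_mult_has_sum[OF b(3,1)] op_mult_has_sum[OF b(3,2)])
  then show "op_mult n (op_add m m') i k = op_add (op_mult n m) (op_mult n m') i k"
    unfolding op_mult_def op_add_def by (simp add: infsumI distrib_left)
qed

lemma op_mult_scale_left: "op_mult (op_scale z m) n = op_scale z (op_mult m n)"
  by (simp add: op_mult_def op_scale_def mult.assoc infsum_cmult_right')

lemma op_mult_scale_right: "op_mult m (op_scale z n) = op_scale z (op_mult m n)"
  by (simp add: op_mult_def op_scale_def mult.left_commute infsum_cmult_right')

lemma op_mult_zero [simp]: "op_mult op_zero m = op_zero" "op_mult m op_zero = op_zero"
  by (simp_all add: op_mult_def op_zero_def)

lemma bounded_op_closed [simp, intro]:
  "bounded_op m \<Longrightarrow> bounded_op n \<Longrightarrow> bounded_op (op_add m n)"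
  "bounded_op m \<Longrightarrow> bounded_op n \<Longrightarrow> bounded_op (op_mult m n)"
  "bounded_op m \<Longrightarrow> bounded_op (op_scale z m)"
  "bounded_op m \<Longrightarrow> bounded_op (op_adjoint m)"
  "bounded_op op_zero"
  unfolding bounded_op_iff
  by (meson op_bound_add, meson op_bound_mult, meson op_bound_scale, meson op_bound_adjoint,
      meson op_bound_zero order_refl)

lemma sum_square_L2: "(\<Sum>i\<in>I. (f i)\<^sup>2) = (L2_set f I)\<^sup>2"
  by (simp add: L2_set_def sum_nonneg)

text \<open>Apply \<open>n\<close> in the second coordinate, with the first coordinate as a parameter, and then \<open>m\<close> in the
first coordinate; the squared norms are summed over the parameter each time. The vector is
extended by zero to a rectangle \<open>A1 \<times> A2\<close> so that the two sums separate.\<close>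

lemma op_bound_tensor:
  fixes m :: "'i op" and n :: "'j op"
  assumes "op_bound m K" "op_bound n L"
  shows "op_bound (op_tensor m n) (K * L)"
  unfolding op_bound_def
proof (intro conjI allI impI)
  show KL: "0 \<le> K * L" using assms by (simp add: op_bound_nonneg)
  fix I J :: "('i \<times> 'j) set" and w :: "'i \<times> 'j \<Rightarrow> complex"
  assume fin: "finite I" "finite J"
  define A1 A2 where "A1 = fst ` J" and "A2 = snd ` J"
  define B1 B2 where "B1 = fst ` I" and "B2 = snd ` I"
  define w' where "w' = (\<lambda>p. if p \<in> J then w p else 0)"
  have finA: "finite A1" "finite A2" "finite B1" "finite B2"
    using fin by (auto simp: A1_def A2_def B1_def B2_def)
  have JA: "J \<subseteq> A1 \<times> A2" and IB: "I \<subseteq> B1 \<times> B2"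
    by (force simp: A1_def A2_def B1_def B2_def)+
  have ext: "(\<Sum>p\<in>J. op_tensor m n q p * w p) = (\<Sum>p\<in>A1\<times>A2. op_tensor m n q p * w' p)" for q
    using JA finA by (intro sum.mono_neutral_cong_left) (auto simp: w'_def)
  have ext2: "(\<Sum>p\<in>J. (cmod (w p))\<^sup>2) = (\<Sum>p\<in>A1\<times>A2. (cmod (w' p))\<^sup>2)"
    using JA finA by (intro sum.mono_neutral_cong_left) (auto simp: w'_def)
  let ?z = "\<lambda>k j. \<Sum>l\<in>A2. n j l * w' (k, l)"
  have app: "(\<Sum>p\<in>A1\<times>A2. op_tensor m n (i, j) p * w' p) = (\<Sum>k\<in>A1. m i k * ?z k j)" for i j
    by (simp add: sum.cartesian_product' op_tensor_def sum_distrib_left mult.assoc)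
  have sq: "(\<Sum>x\<in>X. (f x)\<^sup>2) \<le> C\<^sup>2 * (\<Sum>y\<in>Y. (g y)\<^sup>2)" if "L2_set f X \<le> C * L2_set g Y" 
    for f :: "'x \<Rightarrow> real" and g :: "'y \<Rightarrow> real" and X Y C
    using power_mono[OF that L2_set_nonneg, of 2] by (simp add: power_mult_distrib sum_square_L2)
  have "(\<Sum>q\<in>I. (cmod (\<Sum>p\<in>J. op_tensor m n q p * w p))\<^sup>2)
      \<le> (\<Sum>q\<in>B1\<times>B2. (cmod (\<Sum>p\<in>A1\<times>A2. op_tensor m n q p * w' p))\<^sup>2)"
    unfolding ext using IB finA by (intro sum_mono2) auto
  also have "\<dots> = (\<Sum>j\<in>B2. \<Sum>i\<in>B1. (cmod (\<Sum>k\<in>A1. m i k * ?z k j))\<^sup>2)"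
    by (subst sum.swap) (simp only: sum.cartesian_product'[of _ B1 B2] app)
  also have "\<dots> \<le> (\<Sum>j\<in>B2. K\<^sup>2 * (\<Sum>k\<in>A1. (cmod (?z k j))\<^sup>2))"
    by (intro sum_mono sq op_boundD assms finA)
  also have "\<dots> = K\<^sup>2 * (\<Sum>k\<in>A1. \<Sum>j\<in>B2. (cmod (?z k j))\<^sup>2)"
    by (subst sum.swap) (simp add: sum_distrib_left)
  also have "\<dots> \<le> K\<^sup>2 * (\<Sum>k\<in>A1. L\<^sup>2 * (\<Sum>l\<in>A2. (cmod (w' (k, l)))\<^sup>2))"
    by (intro mult_left_mono sum_mono sq op_boundD assms finA) auto
  also have "\<dots> = (K * L)\<^sup>2 * (\<Sum>p\<in>J. (cmod (w p))\<^sup>2)"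
    unfolding ext2 by (simp add: sum.cartesian_product' sum_distrib_left power_mult_distrib mult_ac)
  finally have "(L2_set (\<lambda>q. cmod (\<Sum>p\<in>J. op_tensor m n q p * w p)) I)\<^sup>2
     \<le> (K * L * L2_set (\<lambda>j. cmod (w j)) J)\<^sup>2"
    unfolding sum_square_L2 by (simp add: power_mult_distrib)
  then show "L2_set (\<lambda>q. cmod (\<Sum>p\<in>J. op_tensor m n q p * w p)) I \<le> K * L * L2_set (\<lambda>j. cmod (w j)) J"
    by (rule power2_le_imp_le) (use KL in simp)
qed

lemma bounded_op_tensor [simp, intro]:
  "bounded_op m \<Longrightarrow> bounded_op n \<Longrightarrow> bounded_op (op_tensor m n)"
  using op_bound_tensor unfolding bounded_op_iff by blast

lemma op_mult_tensor:
  fixes m m' :: "'i op" and n n' :: "'j op"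
  assumes "bounded_op m" "bounded_op n" "bounded_op m'" "bounded_op n'"
  shows "op_mult (op_tensor m n) (op_tensor m' n') = op_tensor (op_mult m m') (op_mult n n')"
proof (intro ext)
  fix p q :: "'i \<times> 'j"
  obtain i j where p: "p = (i, j)" by (cases p)
  obtain i' j' where q: "q = (i', j')" by (cases q)
  obtain K L K' L' where b: "op_bound m K" "op_bound n L" "op_bound m' K'" "op_bound n' L'"
    using assms unfolding bounded_op_iff by blast
  let ?f = "\<lambda>k. m i k * m' k i'" and ?g = "\<lambda>l. n j l * n' l j'"
  have f: "(\<lambda>k. norm (?f k)) summable_on UNIV" and g: "(\<lambda>l. norm (?g l)) summable_on UNIV"
    by (rule op_mult_abs_summable[OF b(1,3)], rule op_mult_abs_summable[OF b(2,4)])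
  have "(\<lambda>x. norm ((\<lambda>(k, l). ?f k * ?g l) x)) summable_on (UNIV \<times> UNIV)"
    unfolding Infinite_Sum.abs_summable_on_Sigma_iff
    using g summable_on_cmult_left[OF f, of "\<Sum>\<^sub>\<infinity>l. norm (?g l)"]
    by (auto simp: norm_mult infsum_cmult_right' abs_mult infsum_nonneg intro!: summable_on_cmult_right)
  then have s: "(\<lambda>(k, l). ?f k * ?g l) summable_on (UNIV \<times> UNIV)"
    by (rule abs_summable_summable)
  have "op_mult (op_tensor m n) (op_tensor m' n') p q = (\<Sum>\<^sub>\<infinity>(k, l)\<in>UNIV \<times> UNIV. ?f k * ?g l)"
    by (simp add: op_mult_def op_tensor_def p q case_prod_unfold mult_ac)
  also have "\<dots> = (\<Sum>\<^sub>\<infinity>k. \<Sum>\<^sub>\<infinity>l. ?f k * ?g l)"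
    by (rule infsum_Sigma'_banach[OF s, symmetric])
  also have "\<dots> = (\<Sum>\<^sub>\<infinity>k. ?f k) * (\<Sum>\<^sub>\<infinity>l. ?g l)"
    by (simp add: infsum_cmult_right' infsum_cmult_left')
  finally show "op_mult (op_tensor m n) (op_tensor m' n') p q
     = op_tensor (op_mult m m') (op_mult n n') p q"
    by (simp add: op_tensor_def op_mult_def p q)
qed

lemma le_mult_sqrt_imp:
  fixes s W :: real
  assumes "s \<le> W * sqrt s" "0 \<le> s" "0 \<le> W"
  shows "s \<le> W\<^sup>2"
proof (cases "s = 0")
  case False
  then have "0 < sqrt s" using assms by simp
  moreover have "sqrt s * sqrt s \<le> W * sqrt s" using assms by simp
  ultimately have "sqrt s \<le> W" by (simp only: mult_le_cancel_right_pos)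
  then show ?thesis using assms by (simp add: real_le_lsqrt sqrt_le_D)
qed simp

text \<open>This is \<open>\<parallel>m w\<parallel>\<^sup>2 = \<langle>w, m\<^sup>*m w\<rangle>\<close>.\<close>

lemma quadratic_form_has_sum:
  assumes "op_bound m K" "finite J"
  shows "((\<lambda>i. (cmod (\<Sum>j\<in>J. m i j * w j))\<^sup>2) has_sum
     Re (\<Sum>j\<in>J. cnj (w j) * (\<Sum>k\<in>J. op_mult (op_adjoint m) m j k * w k))) UNIV"
proof -
  have "((\<lambda>i. \<Sum>j\<in>J. cnj (w j) * (op_adjoint m j i * (\<Sum>k\<in>J. m i k * w k))) has_sum
     (\<Sum>j\<in>J. cnj (w j) * (\<Sum>k\<in>J. op_mult (op_adjoint m) m j k * w k))) UNIV"
    by (intro has_sum_finite_sum has_sum_cmult_right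
        op_mult_apply_has_sum[OF op_bound_adjoint[OF assms(1)] assms])
  moreover have "(\<Sum>j\<in>J. cnj (w j) * (op_adjoint m j i * (\<Sum>k\<in>J. m i k * w k)))
     = complex_of_real ((cmod (\<Sum>k\<in>J. m i k * w k))\<^sup>2)" for i
  proof -
    define X where "X = (\<Sum>k\<in>J. m i k * w k)"
    have "(\<Sum>j\<in>J. cnj (w j) * (op_adjoint m j i * X)) = cnj X * X"
      unfolding X_def[THEN arg_cong[where f = cnj]] cnj_sum
      by (simp add: op_adjoint_def sum_distrib_left mult_ac)
    then show ?thesis
      unfolding X_def[symmetric] complex_norm_square by (simp add: mult.commute)
  qed
  ultimately show ?thesis
    using has_sum_Re by fastforce
qed

text \<open>Here \<open>\<parallel>a w\<parallel>\<^sup>2 \<le> \<parallel>a w\<parallel>\<^sup>2 + \<parallel>b w\<parallel>\<^sup>2 = \<langle>w, e w\<rangle> = \<parallel>e w\<parallel>\<^sup>2\<close>, because \<open>e\<close> is a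
  projection, and Cauchy--Schwarz for the middle term gives \<open>\<parallel>e w\<parallel> \<le> \<parallel>w\<parallel>\<close>.\<close>

lemma op_bound_sum_of_squares:
  assumes a: "bounded_op a" and b: "bounded_op b" and e: "bounded_op e"
    and proj: "op_mult (op_adjoint e) e = e"
    and sum: "op_add (op_mult (op_adjoint a) a) (op_mult (op_adjoint b) b) = e"
  shows "op_bound a 1"
  unfolding op_bound_def
proof (intro conjI allI impI)
  show "0 \<le> (1::real)" by simp
  obtain Ka Kb Ke where bd: "op_bound a Ka" "op_bound b Kb" "op_bound e Ke"
    using a b e bounded_op_iff by blast
  fix I J :: "'a set" and w :: "'a \<Rightarrow> complex"
  assume fin: "finite I" "finite J"
  let ?W = "L2_set (\<lambda>j. cmod (w j)) J"
  let ?q = "\<lambda>m. Re (\<Sum>j\<in>J. cnj (w j) * (\<Sum>k\<in>J. m j k * w k))"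
  have part: "(L2_set (\<lambda>i. cmod (\<Sum>j\<in>J. m i j * w j)) F)\<^sup>2 \<le> ?q (op_mult (op_adjoint m) m)"
    if "op_bound m K" "finite F" for m K F
  proof -
    have "(\<Sum>i\<in>F. (cmod (\<Sum>j\<in>J. m i j * w j))\<^sup>2) \<le> ?q (op_mult (op_adjoint m) m)"
      by (rule finite_sum_le_has_sum[OF quadratic_form_has_sum[OF that(1) fin(2)]]) (use that in auto)
    then show ?thesis by (simp add: sum_square_L2)
  qed
  have "?q e = ?q (op_mult (op_adjoint a) a) + ?q (op_mult (op_adjoint b) b)"
    unfolding sum[symmetric] op_add_def by (simp add: distrib_right distrib_left sum.distrib)
  moreover have "0 \<le> ?q (op_mult (op_adjoint b) b)"
    using part[OF bd(2), of "{}"] by simp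
  ultimately have "(L2_set (\<lambda>i. cmod (\<Sum>j\<in>J. a i j * w j)) I)\<^sup>2 \<le> ?q e"
    using part[OF bd(1) fin(1)] by simp
  also have qe: "?q e \<le> ?W\<^sup>2"
  proof -
    have "?q e \<le> cmod (\<Sum>j\<in>J. cnj (w j) * (\<Sum>k\<in>J. e j k * w k))"
      by (rule complex_Re_le_cmod)
    also have "\<dots> \<le> ?W * L2_set (\<lambda>i. cmod (\<Sum>j\<in>J. e i j * w j)) J"
      by (rule cmod_form_le)
    also have "\<dots> \<le> ?W * sqrt (?q e)"
      using part[OF bd(3) fin(2)] unfolding proj
      by (intro mult_left_mono real_le_rsqrt) auto
    finally have le: "?q e \<le> ?W * sqrt (?q e)" .
    have nn: "0 \<le> ?q e" using part[OF bd(3), of "{}"] unfolding proj by simp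
    show ?thesis by (rule le_mult_sqrt_imp[OF le nn L2_set_nonneg])
  qed
  finally show "L2_set (\<lambda>i. cmod (\<Sum>j\<in>J. a i j * w j)) I \<le> 1 * ?W"
    unfolding mult_1 by (rule power2_le_imp_le) simp
qed

section \<open>Uniform bounds for representations, and the minimal tensor product\<close>

lemma star_representationD:
  assumes "star_representation A \<pi>" "x \<in> carrier A"
  shows "bounded_op (\<pi> x)"
    and "y \<in> carrier A \<Longrightarrow> \<pi> (x \<oplus>\<^bsub>A\<^esub> y) = op_add (\<pi> x) (\<pi> y)"
    and "y \<in> carrier A \<Longrightarrow> \<pi> (x \<otimes>\<^bsub>A\<^esub> y) = op_mult (\<pi> x) (\<pi> y)"
    and "\<pi> (cscale A z x) = op_scale z (\<pi> x)"
    and "\<pi> (cstar A x) = op_adjoint (\<pi> x)"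
  using assms by (auto simp: star_representation_def)

lemma zero_star_representation: "star_representation A (\<lambda>_. op_zero)"
  by (auto simp: star_representation_def)
    (auto simp: op_zero_def op_add_def op_scale_def op_adjoint_def)

text \<open>The algebraic source of all uniform bounds on representations: \<open>\<pi>(e)\<close> is a projection for every
representation \<open>\<pi>\<close>, so an equation \<open>a\<^sup>*a + b\<^sup>*b = e\<close> bounds \<open>\<pi>(a)\<close> by 1, whatever \<open>\<pi>\<close> is.\<close>

lemma star_representation_contraction:
  assumes \<pi>: "star_representation A \<pi>"
    and car: "a \<in> carrier A" "b \<in> carrier A" "e \<in> carrier A" 
      "cstar A a \<in> carrier A" "cstar A b \<in> carrier A" "cstar A e \<in> carrier A"
      "cstar A a \<otimes>\<^bsub>A\<^esub> a \<in> carrier A" "cstar A b \<otimes>\<^bsub>A\<^esub> b \<in> carrier A"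
    and proj: "cstar A e \<otimes>\<^bsub>A\<^esub> e = e"
    and sum: "cstar A a \<otimes>\<^bsub>A\<^esub> a \<oplus>\<^bsub>A\<^esub> cstar A b \<otimes>\<^bsub>A\<^esub> b = e"
  shows "op_bound (\<pi> a) 1"
proof (rule op_bound_sum_of_squares[of _ "\<pi> b" "\<pi> e"])
  note D = star_representationD[OF \<pi>]
  show "bounded_op (\<pi> a)" "bounded_op (\<pi> b)" "bounded_op (\<pi> e)"
    using D(1) car by blast+
  show "op_mult (op_adjoint (\<pi> e)) (\<pi> e) = \<pi> e"
    using arg_cong[OF proj, of \<pi>] car by (simp add: D)
  show "op_add (op_mult (op_adjoint (\<pi> a)) (\<pi> a)) (op_mult (op_adjoint (\<pi> b)) (\<pi> b)) = \<pi> e"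
    using arg_cong[OF sum, of \<pi>] car by (simp add: D)
qed

text \<open>Only representations on the families indexed by \<open>'a\<close> are considered, since the minimal
tensor norm is a supremum over exactly these.\<close>

definition rep_bounded :: "'a cstar_alg \<Rightarrow> 'a \<Rightarrow> bool" where
  "rep_bounded A a \<longleftrightarrow> (\<exists>K. \<forall>\<pi> :: 'a \<Rightarrow> 'a op. star_representation A \<pi> \<longrightarrow> op_bound (\<pi> a) K)"

lemma rep_boundedI:
  "(\<And>\<pi> :: 'a \<Rightarrow> 'a op. star_representation A \<pi> \<Longrightarrow> op_bound (\<pi> a) K) \<Longrightarrow> rep_bounded A a"
  unfolding rep_bounded_def by blast

lemma rep_bounded_add:
  assumes "a \<in> carrier A" "b \<in> carrier A" "rep_bounded A a" "rep_bounded A b"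
  shows "rep_bounded A (a \<oplus>\<^bsub>A\<^esub> b)"
proof -
  obtain K L where "\<And>\<pi> :: 'a \<Rightarrow> 'a op. star_representation A \<pi> \<Longrightarrow> op_bound (\<pi> a) K"
    "\<And>\<pi> :: 'a \<Rightarrow> 'a op. star_representation A \<pi> \<Longrightarrow> op_bound (\<pi> b) L"
    using assms(3,4) unfolding rep_bounded_def by blast
  then show ?thesis
    using assms(1,2) by (intro rep_boundedI[of _ _ "K + L"]) (simp add: star_representationD op_bound_add)
qed

lemma rep_bounded_cscale:
  assumes "a \<in> carrier A" "rep_bounded A a"
  shows "rep_bounded A (cscale A z a)"
proof -
  obtain K where "\<And>\<pi> :: 'a \<Rightarrow> 'a op. star_representation A \<pi> \<Longrightarrow> op_bound (\<pi> a) K"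
    using assms(2) unfolding rep_bounded_def by blast
  then show ?thesis
    using assms(1) by (intro rep_boundedI[of _ _ "cmod z * K"]) (simp add: star_representationD op_bound_scale)
qed

text \<open>What makes the supremum norm on a minimal tensor product a genuine norm: without uniform bounds, the
supremum over the representations is a meaningless default value.\<close>

locale tensor_factor =
  fixes A :: "'a cstar_alg"
  assumes one_in: "\<one>\<^bsub>A\<^esub> \<in> carrier A"
    and mult_in: "x \<in> carrier A \<Longrightarrow> y \<in> carrier A \<Longrightarrow> x \<otimes>\<^bsub>A\<^esub> y \<in> carrier A"
    and cscale_in: "x \<in> carrier A \<Longrightarrow> cscale A z x \<in> carrier A"
    and bounded: "x \<in> carrier A \<Longrightarrow> rep_bounded A x"

lemma (in unital_cstar_algebra) tensor_factorI:
  "(\<And>x. x \<in> carrier A \<Longrightarrow> rep_bounded A x) \<Longrightarrow> tensor_factor A"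
  by (simp add: tensor_factor_def cscale_closed)

lemma M2_simps [simp]:
  "carrier M2 = UNIV" "mult M2 = (**)" "one M2 = mat 1" "zero M2 = 0" "add M2 = (+)"
  "cscale M2 = (\<lambda>z m. \<chi> i j. z * m $ i $ j)" "cstar M2 = (\<lambda>m. \<chi> i j. cnj (m $ j $ i))"
  by (simp_all add: M2_def)

definition matrix_unit :: "2 \<Rightarrow> 2 \<Rightarrow> complex^2^2" where
  "matrix_unit i j = (\<chi> k l. if k = i \<and> l = j then 1 else 0)"

lemma matrix_unit_mult:
  "matrix_unit i j ** matrix_unit k l = (if j = k then matrix_unit i l else 0)"
  by (auto simp: matrix_unit_def matrix_matrix_mult_def vec_eq_iff sum_2 UNIV_2)
    (metis exhaust_2)+

lemma matrix_unit_star: "cstar M2 (matrix_unit i j) = matrix_unit j i"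
  by (auto simp: matrix_unit_def vec_eq_iff)

lemma matrix_unit_expansion:
  "m = (\<Sum>i\<in>UNIV. \<Sum>j\<in>UNIV. cscale M2 (m $ i $ j) (matrix_unit i j))"
  by (auto simp: matrix_unit_def vec_eq_iff UNIV_2 forall_2)

lemma M2_representation_expansion:
  assumes "star_representation M2 \<pi>"
  shows "\<pi> m p q = (\<Sum>i\<in>UNIV. \<Sum>j\<in>UNIV. m $ i $ j * \<pi> (matrix_unit i j) p q)"
proof -
  have "\<pi> (x + y) p q = \<pi> x p q + \<pi> y p q" for x y
    using star_representationD(2)[OF assms, of x y] by (simp add: op_add_def)
  moreover have "\<pi> (cscale M2 z x) p q = z * \<pi> x p q" for z x
    using star_representationD(4)[OF assms, of x z] by (simp add: op_scale_def)
  ultimately show ?thesis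
    by (subst matrix_unit_expansion[of m]) (simp add: UNIV_2 del: M2_simps(6))
qed

text \<open>A matrix unit \<open>e\<^sub>i\<^sub>j\<close> is a partial isometry: \<open>e\<^sub>i\<^sub>j\<^sup>*e\<^sub>i\<^sub>j\<close> is the projection \<open>e\<^sub>j\<^sub>j\<close>.\<close>

lemma matrix_unit_rep_bound:
  assumes "star_representation M2 \<pi>"
  shows "op_bound (\<pi> (matrix_unit i j)) 1"
  by (rule star_representation_contraction[OF assms, of _ 0 "matrix_unit j j"])
    (auto simp: matrix_unit_star matrix_unit_mult simp del: M2_simps(7))

lemma tensor_factor_M2: "tensor_factor M2"
proof
  fix x :: "complex^2^2"
  show "rep_bounded M2 x"
  proof (rule rep_boundedI)
    fix \<pi> :: "complex^2^2 \<Rightarrow> (complex^2^2) op" assume \<pi>: "star_representation M2 \<pi>"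
    have add: "\<pi> (x + y) = op_add (\<pi> x) (\<pi> y)" for x y
      using star_representationD(2)[OF \<pi>, of x y] by simp
    have b: "op_bound (\<pi> (cscale M2 (x $ i $ j) (matrix_unit i j))) (cmod (x $ i $ j) * 1)" for i j
      using op_bound_scale[OF matrix_unit_rep_bound[OF \<pi>], of "x $ i $ j" i j]
        star_representationD(4)[OF \<pi>, of "matrix_unit i j" "x $ i $ j"] by simp
    show "op_bound (\<pi> x) (((cmod (x $ 1 $ 1) * 1) + (cmod (x $ 1 $ 2) * 1))
        + ((cmod (x $ 2 $ 1) * 1) + (cmod (x $ 2 $ 2) * 1)))"
      by (subst matrix_unit_expansion[of x], unfold UNIV_2, simp del: M2_simps(6) mult_1_right add: add)
        (intro op_bound_add b)
  qed
qed auto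


lemma rep_pairs_iff: "(\<pi>, \<sigma>) \<in> rep_pairs A B \<longleftrightarrow> star_representation A \<pi> \<and> star_representation B \<sigma>"
  by (simp add: rep_pairs_def)

text \<open>The zero representation is available because representations need not be unital.\<close>

lemma rep_pairs_nonempty: "rep_pairs A B \<noteq> {}"
  unfolding rep_pairs_def using zero_star_representation[of A] zero_star_representation[of B] by auto

lemma elem_tensor_apply:
  "star_representation A \<pi> \<Longrightarrow> star_representation B \<sigma> \<Longrightarrow>
     elem_tensor A B a b (\<pi>, \<sigma>) = op_tensor (\<pi> a) (\<sigma> b)"
  by (simp add: elem_tensor_def rep_pairs_iff)

lemma elem_tensor_outside: "p \<notin> rep_pairs A B \<Longrightarrow> elem_tensor A B a b p = op_zero"
  by (cases p) (simp add: elem_tensor_def)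

lemma alg_tensor_outside:
  "t \<in> alg_tensor A B \<Longrightarrow> p \<notin> rep_pairs A B \<Longrightarrow> t p = op_zero"
  by (induction rule: alg_tensor.induct) (auto simp: elem_tensor_outside op_zero_def op_add_def)

lemma alg_tensor_add:
  assumes "t \<in> alg_tensor A B" "s \<in> alg_tensor A B"
  shows "(\<lambda>p. op_add (t p) (s p)) \<in> alg_tensor A B"
  using assms(2)
proof (induction rule: alg_tensor.induct)
  case zero
  then show ?case using assms(1) by (simp add: op_add_def op_zero_def)
next
  case (add_elem s a b)
  then show ?case using alg_tensor.add_elem[OF add_elem(4) add_elem(2,3)]
    by (simp add: op_add_def add.assoc)
qed

lemma elem_in_alg_tensor:
  "a \<in> carrier A \<Longrightarrow> b \<in> carrier B \<Longrightarrow> elem_tensor A B a b \<in> alg_tensor A B"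
  using alg_tensor.add_elem[OF alg_tensor.zero, of a A b B] by (simp add: op_add_def op_zero_def)

lemma op_scale_elem_tensor:
  "a \<in> carrier A \<Longrightarrow> op_scale z (elem_tensor A B a b p) = elem_tensor A B (cscale A z a) b p"
  by (cases p) (auto simp: elem_tensor_def rep_pairs_iff star_representationD
      op_scale_def op_tensor_def op_zero_def mult.assoc intro!: ext)

lemma alg_tensor_scale:
  assumes "\<And>a. a \<in> carrier A \<Longrightarrow> cscale A z a \<in> carrier A"
  shows "t \<in> alg_tensor A B \<Longrightarrow> (\<lambda>p. op_scale z (t p)) \<in> alg_tensor A B"
proof (induction rule: alg_tensor.induct)
  case zero
  then show ?case using alg_tensor.zero by (simp add: op_scale_def op_zero_def)
next
  case (add_elem t a b)
  have "op_scale z (op_add (t p) (elem_tensor A B a b p))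
     = op_add (op_scale z (t p)) (elem_tensor A B (cscale A z a) b p)" for p
    using add_elem(2) by (simp flip: op_scale_elem_tensor add: op_scale_def op_add_def distrib_left)
  then show ?case
    using alg_tensor.add_elem[OF add_elem(4) assms[OF add_elem(2)] add_elem(3)] by simp
qed

lemma elem_tensor_mult:
  assumes "a \<in> carrier A" "b \<in> carrier B" "a' \<in> carrier A" "b' \<in> carrier B"
  shows "op_mult (elem_tensor A B a b p) (elem_tensor A B a' b' p)
     = elem_tensor A B (a \<otimes>\<^bsub>A\<^esub> a') (b \<otimes>\<^bsub>B\<^esub> b') p"
  using assms
  by (cases p) (auto simp: elem_tensor_def rep_pairs_iff star_representationD op_mult_tensor)

lemma elem_tensor_bounded_op:
  assumes "a \<in> carrier A" "b \<in> carrier B"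
  shows "bounded_op (elem_tensor A B a b p)"
  using assms by (cases p) (auto simp: elem_tensor_def rep_pairs_iff star_representationD)

lemma alg_tensor_bounded_op: "t \<in> alg_tensor A B \<Longrightarrow> bounded_op (t p)"
  by (induction rule: alg_tensor.induct) (auto simp: elem_tensor_bounded_op)

lemma min_tensor_simps:
  "mult (min_tensor A B) = (\<lambda>x y p. op_mult (x p) (y p))"
  "one (min_tensor A B) = elem_tensor A B \<one>\<^bsub>A\<^esub> \<one>\<^bsub>B\<^esub>"
  "zero (min_tensor A B) = (\<lambda>p. op_zero)"
  "add (min_tensor A B) = (\<lambda>x y p. op_add (x p) (y p))"
  "cscale (min_tensor A B) = (\<lambda>z x p. op_scale z (x p))"
  "cstar (min_tensor A B) = (\<lambda>x p. op_adjoint (x p))"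
  "cnorm (min_tensor A B) = (\<lambda>x. SUP p\<in>rep_pairs A B. op_norm (x p))"
  by (simp_all add: min_tensor_def)

lemma carrier_min_tensor:
  "x \<in> carrier (min_tensor A B) \<longleftrightarrow> (\<forall>p. p \<notin> rep_pairs A B \<longrightarrow> x p = op_zero) \<and>
     (\<forall>e>0. \<exists>t\<in>alg_tensor A B. \<forall>p\<in>rep_pairs A B. op_bound (op_diff (x p) (t p)) e)"
  by (simp add: min_tensor_def op_bound_iff)

lemma carrier_min_tensorD:
  assumes "x \<in> carrier (min_tensor A B)"
  shows "p \<notin> rep_pairs A B \<Longrightarrow> x p = op_zero"
    and "e > 0 \<Longrightarrow> \<exists>t\<in>alg_tensor A B. \<forall>p\<in>rep_pairs A B. op_bound (op_diff (x p) (t p)) e"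
  using assms unfolding carrier_min_tensor by blast+

lemma op_diff_self: "op_diff m m = op_zero"
  by (simp add: op_diff_def op_zero_def)

lemma alg_tensor_subset: "t \<in> alg_tensor A B \<Longrightarrow> t \<in> carrier (min_tensor A B)"
  unfolding carrier_min_tensor
  by (auto simp: alg_tensor_outside op_diff_self intro!: bexI[of _ t])

lemma elem_in_min_tensor:
  "a \<in> carrier A \<Longrightarrow> b \<in> carrier B \<Longrightarrow> elem_tensor A B a b \<in> carrier (min_tensor A B)"
  by (simp add: alg_tensor_subset elem_in_alg_tensor)

lemma min_tensor_add_closed:
  assumes x: "x \<in> carrier (min_tensor A B)" and y: "y \<in> carrier (min_tensor A B)"
  shows "(\<lambda>p. op_add (x p) (y p)) \<in> carrier (min_tensor A B)"
  unfolding carrier_min_tensor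
proof (intro conjI allI impI)
  fix p assume "p \<notin> rep_pairs A B"
  then show "op_add (x p) (y p) = op_zero"
    using carrier_min_tensorD(1)[OF x] carrier_min_tensorD(1)[OF y]
    by (simp add: op_add_def op_zero_def)
next
  fix e :: real assume "e > 0"
  then have e2: "e / 2 > 0" by simp
  obtain s t where st: "s \<in> alg_tensor A B" "t \<in> alg_tensor A B"
    "\<And>p. p \<in> rep_pairs A B \<Longrightarrow> op_bound (op_diff (x p) (s p)) (e/2)"
    "\<And>p. p \<in> rep_pairs A B \<Longrightarrow> op_bound (op_diff (y p) (t p)) (e/2)"
    using carrier_min_tensorD(2)[OF x e2] carrier_min_tensorD(2)[OF y e2] by blast
  have "op_bound (op_diff (op_add (x p) (y p)) (op_add (s p) (t p))) e" if "p \<in> rep_pairs A B" for p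
  proof -
    have "op_diff (op_add (x p) (y p)) (op_add (s p) (t p))
        = op_add (op_diff (x p) (s p)) (op_diff (y p) (t p))"
      by (auto simp: op_diff_def op_add_def intro!: ext)
    then show ?thesis using op_bound_add[OF st(3,4)[OF that]] by simp
  qed
  then show "\<exists>t\<in>alg_tensor A B. \<forall>p\<in>rep_pairs A B. op_bound (op_diff (op_add (x p) (y p)) (t p)) e"
    using alg_tensor_add[OF st(1,2)] by (intro bexI[of _ "\<lambda>p. op_add (s p) (t p)"]) auto
qed

locale tensor_product = A: tensor_factor A + B: tensor_factor B
  for A :: "'a cstar_alg" and B :: "'b cstar_alg"
begin

lemma alg_tensor_mult_elem:
  assumes "a \<in> carrier A" "b \<in> carrier B"
  shows "t \<in> alg_tensor A B \<Longrightarrow> (\<lambda>p. op_mult (t p) (elem_tensor A B a b p)) \<in> alg_tensor A B"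
proof (induction rule: alg_tensor.induct)
  case zero
  then show ?case using alg_tensor.zero by simp
next
  case (add_elem t a' b')
  have "op_mult (op_add (t p) (elem_tensor A B a' b' p)) (elem_tensor A B a b p)
     = op_add (op_mult (t p) (elem_tensor A B a b p)) (elem_tensor A B (a' \<otimes>\<^bsub>A\<^esub> a) (b' \<otimes>\<^bsub>B\<^esub> b) p)" for p
    using add_elem assms 
    by (simp add: op_mult_add_left alg_tensor_bounded_op elem_tensor_bounded_op elem_tensor_mult)
  then show ?case
    using alg_tensor.add_elem[OF add_elem(4)] add_elem(2,3) assms A.mult_in B.mult_in by simp
qed

lemma elem_tensor_uniformly_bounded:
  assumes "a \<in> carrier A" "b \<in> carrier B"
  shows "\<exists>K. \<forall>p\<in>rep_pairs A B. op_bound (elem_tensor A B a b p) K"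
proof -
  obtain K L where "\<And>\<pi> :: 'a \<Rightarrow> 'a op. star_representation A \<pi> \<Longrightarrow> op_bound (\<pi> a) K"
    "\<And>\<pi> :: 'b \<Rightarrow> 'b op. star_representation B \<pi> \<Longrightarrow> op_bound (\<pi> b) L"
    using A.bounded[OF assms(1)] B.bounded[OF assms(2)] unfolding rep_bounded_def by blast
  then show ?thesis
    by (intro exI[of _ "K * L"]) (auto simp: rep_pairs_iff elem_tensor_apply op_bound_tensor)
qed

lemma alg_tensor_uniformly_bounded:
  "t \<in> alg_tensor A B \<Longrightarrow> \<exists>K. \<forall>p\<in>rep_pairs A B. op_bound (t p) K"
proof (induction rule: alg_tensor.induct)
  case zero
  then show ?case by (intro exI[of _ 0]) simp
next
  case (add_elem t a b)
  then show ?case using op_bound_add elem_tensor_uniformly_bounded[of a b] by meson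
qed

lemma uniformly_bounded:
  assumes "x \<in> carrier (min_tensor A B)"
  shows "\<exists>K. \<forall>p\<in>rep_pairs A B. op_bound (x p) K"
proof -
  obtain t where t: "t \<in> alg_tensor A B" "\<forall>p\<in>rep_pairs A B. op_bound (op_diff (x p) (t p)) 1"
    using carrier_min_tensorD(2)[OF assms, of 1] by auto
  obtain K where K: "\<forall>p\<in>rep_pairs A B. op_bound (t p) K"
    using alg_tensor_uniformly_bounded[OF t(1)] by blast
  have "x p = op_add (op_diff (x p) (t p)) (t p)" for p
    by (simp add: op_add_def op_diff_def)
  then show ?thesis using t(2) K op_bound_add by metis
qed

lemma op_bound_cnorm:
  assumes "x \<in> carrier (min_tensor A B)" "p \<in> rep_pairs A B"
  shows "op_bound (x p) (cnorm (min_tensor A B) x)"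
proof -
  obtain K where K: "\<And>p. p \<in> rep_pairs A B \<Longrightarrow> op_bound (x p) K"
    using uniformly_bounded[OF assms(1)] by blast
  have "bdd_above ((\<lambda>p. op_norm (x p)) ` rep_pairs A B)"
    using K op_norm_le by (intro bdd_aboveI2[of _ _ K]) blast
  then have "op_norm (x p) \<le> cnorm (min_tensor A B) x"
    unfolding min_tensor_simps using assms(2) by (rule cSUP_upper2[OF _ _ order_refl])
  then show ?thesis using K[OF assms(2)] op_bound_iff by blast
qed

lemma min_tensor_scale_closed:
  assumes x: "x \<in> carrier (min_tensor A B)"
  shows "(\<lambda>p. op_scale z (x p)) \<in> carrier (min_tensor A B)"
  unfolding carrier_min_tensor
proof (intro conjI allI impI)
  fix p assume "p \<notin> rep_pairs A B"
  then show "op_scale z (x p) = op_zero"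
    using carrier_min_tensorD(1)[OF x] by (simp add: op_scale_def op_zero_def)
next
  fix e :: real assume "e > 0"
  then have e2: "e / (cmod z + 1) > 0" by (simp add: add_nonneg_pos)
  obtain s where s: "s \<in> alg_tensor A B"
    "\<And>p. p \<in> rep_pairs A B \<Longrightarrow> op_bound (op_diff (x p) (s p)) (e / (cmod z + 1))"
    using carrier_min_tensorD(2)[OF x e2] by blast
  have "op_bound (op_diff (op_scale z (x p)) (op_scale z (s p))) e" if "p \<in> rep_pairs A B" for p
  proof (rule op_bound_mono)
    have "op_diff (op_scale z (x p)) (op_scale z (s p)) = op_scale z (op_diff (x p) (s p))"
      by (auto simp: op_diff_def op_scale_def algebra_simps)
    then show "op_bound (op_diff (op_scale z (x p)) (op_scale z (s p))) (cmod z * (e / (cmod z + 1)))"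
      using op_bound_scale[OF s(2)[OF that], of z] by simp
    have "cmod z * e \<le> e * (cmod z + 1)" using \<open>e > 0\<close> by (simp add: algebra_simps)
    then show "cmod z * (e / (cmod z + 1)) \<le> e"
      by (simp add: divide_le_eq add_nonneg_pos)
  qed
  then show "\<exists>t\<in>alg_tensor A B. \<forall>p\<in>rep_pairs A B. op_bound (op_diff (op_scale z (x p)) (t p)) e"
    using alg_tensor_scale[OF A.cscale_in s(1)] by (intro bexI[of _ "\<lambda>p. op_scale z (s p)"]) auto
qed

lemma bounded_op_min_tensor:
  assumes "x \<in> carrier (min_tensor A B)"
  shows "bounded_op (x p)"
  using op_bound_imp_bounded_op[OF op_bound_cnorm[OF assms, of p]] carrier_min_tensorD(1)[OF assms, of p]
  by (cases "p \<in> rep_pairs A B") simp_all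

text \<open>The density conditions for a quantum group speak about products of this kind.\<close>

lemma min_tensor_mult_elem_closed:
  assumes x: "x \<in> carrier (min_tensor A B)" and ab: "a \<in> carrier A" "b \<in> carrier B"
  shows "(\<lambda>p. op_mult (x p) (elem_tensor A B a b p)) \<in> carrier (min_tensor A B)"
  unfolding carrier_min_tensor
proof (intro conjI allI impI)
  fix p assume "p \<notin> rep_pairs A B"
  then show "op_mult (x p) (elem_tensor A B a b p) = op_zero"
    using carrier_min_tensorD(1)[OF x] by simp
next
  fix e :: real assume "e > 0"
  obtain K where K: "\<And>p. p \<in> rep_pairs A B \<Longrightarrow> op_bound (elem_tensor A B a b p) K"
    using elem_tensor_uniformly_bounded[OF ab] by blast
  have K0: "0 \<le> K" using K rep_pairs_nonempty op_bound_nonneg by blast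
  then have e2: "e / (K + 1) > 0" using \<open>e > 0\<close> by simp
  obtain s where s: "s \<in> alg_tensor A B"
    "\<And>p. p \<in> rep_pairs A B \<Longrightarrow> op_bound (op_diff (x p) (s p)) (e / (K + 1))"
    using carrier_min_tensorD(2)[OF x e2] by blast
  let ?u = "elem_tensor A B a b"
  have "op_bound (op_diff (op_mult (x p) (?u p)) (op_mult (s p) (?u p))) e" if p: "p \<in> rep_pairs A B" for p
  proof (rule op_bound_mono)
    have "op_diff (op_mult (x p) (?u p)) (op_mult (s p) (?u p)) = op_mult (op_diff (x p) (s p)) (?u p)"
      using bounded_op_min_tensor[OF x] alg_tensor_bounded_op[OF s(1)] elem_tensor_bounded_op[OF ab]
      by (simp add: op_diff_eq op_mult_add_left op_mult_scale_left)
    then show "op_bound (op_diff (op_mult (x p) (?u p)) (op_mult (s p) (?u p))) (e / (K + 1) * K)"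
      using op_bound_mult[OF s(2)[OF p] K[OF p]] by simp
    show "e / (K + 1) * K \<le> e"
      using \<open>e > 0\<close> K0 by (simp add: divide_le_eq algebra_simps)
  qed
  then show "\<exists>t\<in>alg_tensor A B. \<forall>p\<in>rep_pairs A B. op_bound (op_diff (op_mult (x p) (?u p)) (t p)) e"
    using alg_tensor_mult_elem[OF ab s(1)] by (intro bexI[of _ "\<lambda>p. op_mult (s p) (?u p)"]) auto
qed

text \<open>The additive inverse of the record is a definite description over the carrier; it is the pointwise
one because the carrier is closed under scalar multiplication.\<close>

lemma min_tensor_minus:
  assumes x: "x \<in> carrier (min_tensor A B)" and y: "y \<in> carrier (min_tensor A B)"
  shows "x \<ominus>\<^bsub>min_tensor A B\<^esub> y = (\<lambda>p. op_diff (x p) (y p))"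
proof -
  have "\<ominus>\<^bsub>min_tensor A B\<^esub> y = (\<lambda>p. op_scale (-1) (y p))"
    unfolding a_inv_def m_inv_def
  proof (rule the_equality)
    show "(\<lambda>p. op_scale (-1) (y p)) \<in> carrier (add_monoid (min_tensor A B)) \<and>
       y \<otimes>\<^bsub>add_monoid (min_tensor A B)\<^esub> (\<lambda>p. op_scale (-1) (y p)) = \<one>\<^bsub>add_monoid (min_tensor A B)\<^esub> \<and>
       (\<lambda>p. op_scale (-1) (y p)) \<otimes>\<^bsub>add_monoid (min_tensor A B)\<^esub> y = \<one>\<^bsub>add_monoid (min_tensor A B)\<^esub>"
      using min_tensor_scale_closed[OF y, of "-1"]
      by (auto simp: min_tensor_simps op_add_def op_scale_def op_zero_def)
  next
    fix z assume "z \<in> carrier (add_monoid (min_tensor A B)) \<and>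
       y \<otimes>\<^bsub>add_monoid (min_tensor A B)\<^esub> z = \<one>\<^bsub>add_monoid (min_tensor A B)\<^esub> \<and>
       z \<otimes>\<^bsub>add_monoid (min_tensor A B)\<^esub> y = \<one>\<^bsub>add_monoid (min_tensor A B)\<^esub>"
    then have "(\<lambda>p. op_add (y p) (z p)) = (\<lambda>p. op_zero)"
      by (simp add: min_tensor_simps)
    then have "y p i j + z p i j = 0" for p i j
      unfolding op_add_def op_zero_def by meson
    then show "z = (\<lambda>p. op_scale (-1) (y p))"
      by (intro ext) (simp add: op_scale_def eq_neg_iff_add_eq_0 add.commute)
  qed
  then show ?thesis by (simp add: a_minus_def min_tensor_simps op_diff_eq)
qed

end

section \<open>Characters and slices of tensors\<close>

definition character :: "'a cstar_alg \<Rightarrow> ('a \<Rightarrow> complex) \<Rightarrow> bool" where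
  "character A \<kappa> \<longleftrightarrow> \<kappa> \<one>\<^bsub>A\<^esub> = 1 \<and>
     (\<forall>x\<in>carrier A. \<forall>y\<in>carrier A. \<kappa> (x \<oplus>\<^bsub>A\<^esub> y) = \<kappa> x + \<kappa> y) \<and>
     (\<forall>x\<in>carrier A. \<forall>y\<in>carrier A. \<kappa> (x \<otimes>\<^bsub>A\<^esub> y) = \<kappa> x * \<kappa> y) \<and>
     (\<forall>z. \<forall>x\<in>carrier A. \<kappa> (cscale A z x) = z * \<kappa> x) \<and>
     (\<forall>x\<in>carrier A. \<kappa> (cstar A x) = cnj (\<kappa> x))"

lemma characterD:
  assumes "character A \<kappa>"
  shows "\<kappa> \<one>\<^bsub>A\<^esub> = 1"
    and "x \<in> carrier A \<Longrightarrow> y \<in> carrier A \<Longrightarrow> \<kappa> (x \<oplus>\<^bsub>A\<^esub> y) = \<kappa> x + \<kappa> y"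
    and "x \<in> carrier A \<Longrightarrow> y \<in> carrier A \<Longrightarrow> \<kappa> (x \<otimes>\<^bsub>A\<^esub> y) = \<kappa> x * \<kappa> y"
    and "x \<in> carrier A \<Longrightarrow> \<kappa> (cscale A z x) = z * \<kappa> x"
    and "x \<in> carrier A \<Longrightarrow> \<kappa> (cstar A x) = cnj (\<kappa> x)"
  using assms by (auto simp: character_def)

lemma bounded_op_finite_support:
  fixes m :: "'i op"
  assumes R: "finite R" and supp: "\<And>i j. i \<notin> R \<or> j \<notin> R \<Longrightarrow> m i j = 0"
  shows "bounded_op m"
proof -
  let ?K = "\<Sum>i\<in>R. \<Sum>j\<in>R. cmod (m i j)"
  have "op_bound m ?K"
  proof (rule op_boundI_form)
    show "0 \<le> ?K" by (simp add: sum_nonneg)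
    fix I J :: "'i set" and v w :: "'i \<Rightarrow> complex"
    assume fin: "finite I" "finite J"
    let ?V = "L2_set (\<lambda>i. cmod (v i)) I" and ?W = "L2_set (\<lambda>j. cmod (w j)) J"
    have "(\<Sum>i\<in>I. \<Sum>j\<in>J. cnj (v i) * m i j * w j) = (\<Sum>i\<in>I\<inter>R. \<Sum>j\<in>J. cnj (v i) * m i j * w j)"
      using fin supp by (intro sum.mono_neutral_right) auto
    also have "\<dots> = (\<Sum>i\<in>I\<inter>R. \<Sum>j\<in>J\<inter>R. cnj (v i) * m i j * w j)"
      using fin supp by (intro sum.cong refl sum.mono_neutral_right) auto
    finally have "cmod (\<Sum>i\<in>I. \<Sum>j\<in>J. cnj (v i) * m i j * w j)
        \<le> (\<Sum>i\<in>I\<inter>R. \<Sum>j\<in>J\<inter>R. cmod (cnj (v i) * m i j * w j))"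
      by (simp add: sum_norm_le)
    also have "\<dots> \<le> (\<Sum>i\<in>I\<inter>R. \<Sum>j\<in>J\<inter>R. ?V * cmod (m i j) * ?W)"
      using fin by (intro sum_mono) (auto simp: norm_mult intro!: mult_mono member_le_L2_set)
    also have "\<dots> \<le> (\<Sum>i\<in>R. \<Sum>j\<in>R. ?V * cmod (m i j) * ?W)"
      using R by (intro order_trans[OF sum_mono sum_mono2] sum_mono2) (auto intro!: sum_nonneg)
    also have "\<dots> = ?K * ?V * ?W"
      by (simp add: sum_distrib_left sum_distrib_right mult_ac)
    finally show "cmod (\<Sum>i\<in>I. \<Sum>j\<in>J. cnj (v i) * m i j * w j) \<le> ?K * ?V * ?W" .
  qed
  then show ?thesis by (rule op_bound_imp_bounded_op)
qed

text \<open>The operator \<open>m\<close> on the span of the basis vectors \<open>u k\<close>, extended by zero. It turns a finite-dimensional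
representation into one on the Hilbert space that the minimal tensor norm refers to.\<close>

definition inflate :: "('m \<Rightarrow> 'i) \<Rightarrow> 'm op \<Rightarrow> 'i op" where
  "inflate u m = (\<lambda>i j. if i \<in> range u \<and> j \<in> range u then m (inv_into UNIV u i) (inv_into UNIV u j) else 0)"

lemma inflate_apply [simp]: "inj u \<Longrightarrow> inflate u m (u i) (u j) = m i j"
  by (simp add: inflate_def)

lemma inflate_outside: "i \<notin> range u \<or> j \<notin> range u \<Longrightarrow> inflate u m i j = 0"
  by (auto simp: inflate_def)

lemma op_mult_finite: "op_mult m n i k = (\<Sum>j\<in>UNIV. m i j * n j k)" for m n :: "'m::finite op"
  by (simp add: op_mult_def)

lemma op_mult_range:
  fixes u :: "'m::finite \<Rightarrow> 'i"
  assumes "inj u" and "\<And>j. j \<notin> range u \<Longrightarrow> m i j = 0 \<or> n j k = 0"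
  shows "op_mult m n i k = (\<Sum>j\<in>UNIV. m i (u j) * n (u j) k)"
proof -
  have "op_mult m n i k = (\<Sum>\<^sub>\<infinity>j\<in>range u. m i j * n j k)"
    unfolding op_mult_def using assms(2) by (intro infsum_cong_neutral) auto
  also have "\<dots> = (\<Sum>j\<in>range u. m i j * n j k)" by simp
  also have "\<dots> = (\<Sum>j\<in>UNIV. m i (u j) * n (u j) k)"
    using assms(1) by (simp add: sum.reindex)
  finally show ?thesis .
qed

lemma star_representation_inflate:
  fixes u :: "'m::finite \<Rightarrow> 'i"
  assumes \<theta>: "star_representation A \<theta>" and u: "inj u"
  shows "star_representation A (\<lambda>a. inflate u (\<theta> a))"
proof -
  note D = star_representationD[OF \<theta>]
  have "bounded_op (inflate u m)" for m
    by (rule bounded_op_finite_support[of "range u"]) (auto simp: inflate_outside)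
  moreover have "inflate u (op_mult m n) = op_mult (inflate u m) (inflate u n)" for m n
  proof (intro ext)
    fix i k
    have "op_mult (inflate u m) (inflate u n) i k = (\<Sum>j\<in>UNIV. inflate u m i (u j) * inflate u n (u j) k)"
      by (rule op_mult_range[OF u]) (simp add: inflate_outside)
    then show "inflate u (op_mult m n) i k = op_mult (inflate u m) (inflate u n) i k"
      using u by (cases "i \<in> range u"; cases "k \<in> range u") (auto simp: inflate_def op_mult_finite)
  qed
  ultimately show ?thesis
    unfolding star_representation_def
    by (auto simp: D)
      (auto simp: inflate_def op_add_def op_scale_def op_adjoint_def intro!: ext)
qed

lemma star_representation_character:
  assumes "character A \<kappa>"
  shows "star_representation A (\<lambda>a (_::unit) (_::unit). \<kappa> a)"
  unfolding star_representation_def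
  using characterD[OF assms]
  by (auto simp: op_add_def op_scale_def op_adjoint_def op_mult_finite fun_eq_iff UNIV_unit
      intro!: bounded_op_finite_support[of UNIV])

text \<open>The pair consisting of a finite-dimensional representation \<open>\<theta>\<close> and a character \<open>\<kappa>\<close>, both inflated.
Elements of the minimal tensor product are families indexed by such pairs, so the slice map
\<open>\<theta> \<otimes> \<kappa>\<close> is simply the evaluation at this index.\<close>

definition slice_point :: "('m \<Rightarrow> 'a) \<Rightarrow> ('a \<Rightarrow> 'm op) \<Rightarrow> ('b \<Rightarrow> complex) \<Rightarrow> ('a \<Rightarrow> 'a op) \<times> ('b \<Rightarrow> 'b op)" where
  "slice_point u \<theta> \<kappa> = (\<lambda>a. inflate u (\<theta> a), \<lambda>b. inflate (\<lambda>_::unit. undefined) (\<lambda>_ _. \<kappa> b))"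

definition slice :: "('m \<Rightarrow> 'a) \<Rightarrow> ('a \<Rightarrow> 'm op) \<Rightarrow> ('b \<Rightarrow> complex) \<Rightarrow> ('a, 'b) tensor \<Rightarrow> 'm op" where
  "slice u \<theta> \<kappa> x = (\<lambda>i j. x (slice_point u \<theta> \<kappa>) (u i, undefined) (u j, undefined))"

lemma slice_linear:
  "slice u \<theta> \<kappa> (\<lambda>p. op_add (x p) (y p)) = op_add (slice u \<theta> \<kappa> x) (slice u \<theta> \<kappa> y)"
  "slice u \<theta> \<kappa> (\<lambda>p. op_scale z (x p)) = op_scale z (slice u \<theta> \<kappa> x)"
  "slice u \<theta> \<kappa> (\<lambda>p. op_diff (x p) (y p)) = op_diff (slice u \<theta> \<kappa> x) (slice u \<theta> \<kappa> y)"
  "slice u \<theta> \<kappa> (\<lambda>p. op_adjoint (x p)) = op_adjoint (slice u \<theta> \<kappa> x)"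
  "slice u \<theta> \<kappa> (\<lambda>p. op_zero) = op_zero"
  by (simp_all add: slice_def op_add_def op_scale_def op_diff_def op_adjoint_def op_zero_def)

text \<open>Two continuous linear functionals on the completion are equal if they agree on elementary
  tensors. In the applications \<open>h\<close> is their difference.\<close>

lemma min_tensor_functional_zero:
  fixes h :: "('a, 'b) tensor \<Rightarrow> complex"
  assumes x: "x \<in> carrier (min_tensor A B)"
    and zero: "h (\<lambda>p. op_zero) = 0"
    and add: "\<And>t a b. t \<in> alg_tensor A B \<Longrightarrow> a \<in> carrier A \<Longrightarrow> b \<in> carrier B \<Longrightarrow>
        h (\<lambda>p. op_add (t p) (elem_tensor A B a b p)) = h t"
    and cont: "\<And>t e. t \<in> alg_tensor A B \<Longrightarrow> 0 < e \<Longrightarrow> 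
        (\<And>p. p \<in> rep_pairs A B \<Longrightarrow> op_bound (op_diff (x p) (t p)) e) \<Longrightarrow> cmod (h x - h t) \<le> M * e"
  shows "h x = 0"
proof -
  have h: "h t = 0" if "t \<in> alg_tensor A B" for t
    using that by (induction rule: alg_tensor.induct) (auto simp: zero add)
  have "cmod (h x) \<le> e" if "e > 0" for e
  proof -
    have e': "e / (\<bar>M\<bar> + 1) > 0" using that by simp
    obtain t where t: "t \<in> alg_tensor A B"
        "\<And>p. p \<in> rep_pairs A B \<Longrightarrow> op_bound (op_diff (x p) (t p)) (e / (\<bar>M\<bar> + 1))"
      using carrier_min_tensorD(2)[OF x e'] by blast
    have "cmod (h x) \<le> M * (e / (\<bar>M\<bar> + 1))"
      using cont[OF t(1) e' t(2)] h[OF t(1)] by simp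
    also have "\<dots> \<le> \<bar>M\<bar> * (e / (\<bar>M\<bar> + 1))"
      using e' by (intro mult_right_mono) auto
    also have "\<dots> \<le> e"
      using that by (simp add: divide_le_eq algebra_simps)
    finally show ?thesis .
  qed
  then have "cmod (h x) \<le> 0" by (rule field_le_epsilon[of _ 0, simplified])
  then show ?thesis by simp
qed

locale slicing =
  fixes A :: "'a cstar_alg" and B :: "'b cstar_alg"
    and u :: "'m::finite \<Rightarrow> 'a" and \<theta> :: "'a \<Rightarrow> 'm op" and \<kappa> :: "'b \<Rightarrow> complex"
  assumes rep: "star_representation A \<theta>" and inj: "inj u" and char: "character B \<kappa>"
begin

lemma slice_point_in: "slice_point u \<theta> \<kappa> \<in> rep_pairs A B"
  unfolding slice_point_def rep_pairs_iff
  using star_representation_inflate[OF rep inj]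
    star_representation_inflate[OF star_representation_character[OF char], of "\<lambda>_. undefined"]
  by (auto simp: inj_def)

lemma slice_elem: "slice u \<theta> \<kappa> (elem_tensor A B a b) = op_scale (\<kappa> b) (\<theta> a)"
proof -
  have "inflate (\<lambda>_::unit. undefined) (\<lambda>_ _. \<kappa> b) (undefined :: 'b) undefined = \<kappa> b"
    by (simp add: inflate_def)
  then show ?thesis
    using slice_point_in inj
    by (simp add: slice_def slice_point_def elem_tensor_def op_tensor_def op_scale_def mult.commute)
qed

lemma slice_one: "slice u \<theta> \<kappa> (one (min_tensor A B)) = \<theta> \<one>\<^bsub>A\<^esub>"
  by (simp add: min_tensor_simps slice_elem characterD(1)[OF char] op_scale_def)

lemma slice_le:
  assumes "\<And>p. p \<in> rep_pairs A B \<Longrightarrow> op_bound (x p) e"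
  shows "cmod (slice u \<theta> \<kappa> x i j) \<le> e"
  unfolding slice_def using op_bound_entry[OF assms[OF slice_point_in]] .

lemma slice_diff_le:
  assumes "\<And>p. p \<in> rep_pairs A B \<Longrightarrow> op_bound (op_diff (x p) (y p)) e"
  shows "cmod (slice u \<theta> \<kappa> x i j - slice u \<theta> \<kappa> y i j) \<le> e"
  using slice_le[where x = "\<lambda>p. op_diff (x p) (y p)" and i = i and j = j, OF assms]
  unfolding slice_linear(3) by (simp add: op_diff_def)

text \<open>Elementary tensors vanish off the inflated block; by continuity so does every element. Hence
the product of two elements at this index is a finite matrix product.\<close>

lemma slice_point_support:
  assumes x: "x \<in> carrier (min_tensor A B)" and q: "q \<notin> range (\<lambda>i. (u i, undefined))"
  shows "x (slice_point u \<theta> \<kappa>) p q = 0" "x (slice_point u \<theta> \<kappa>) q p = 0"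
proof -
  let ?s = "slice_point u \<theta> \<kappa>"
  have elem: "elem_tensor A B a b ?s q p = 0 \<and> elem_tensor A B a b ?s p q = 0" for a b
  proof -
    obtain q1 q2 where "q = (q1, q2)" by (cases q)
    moreover have "q1 \<notin> range u \<or> q2 \<notin> range (\<lambda>_::unit. undefined)"
      using q calculation by auto
    ultimately show ?thesis
      using slice_point_in
      by (cases p) (auto simp: slice_point_def elem_tensor_def op_tensor_def inflate_def)
  qed
  show "x ?s p q = 0"
    by (rule min_tensor_functional_zero[OF x, where h = "\<lambda>x. x ?s p q" and M = 1])
      (use elem op_bound_entry[OF _, of "op_diff (x ?s) _" _ p q] slice_point_in 
        in \<open>auto simp: op_zero_def op_add_def op_diff_def\<close>)
  show "x ?s q p = 0"
    by (rule min_tensor_functional_zero[OF x, where h = "\<lambda>x. x ?s q p" and M = 1])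
      (use elem op_bound_entry[OF _, of "op_diff (x ?s) _" _ q p] slice_point_in 
        in \<open>auto simp: op_zero_def op_add_def op_diff_def\<close>)
qed

lemma slice_mult:
  assumes "x \<in> carrier (min_tensor A B)"
  shows "slice u \<theta> \<kappa> (\<lambda>p. op_mult (x p) (y p)) = op_mult (slice u \<theta> \<kappa> x) (slice u \<theta> \<kappa> y)"
proof (intro ext)
  fix i k
  let ?s = "slice_point u \<theta> \<kappa>"
  have "op_mult (x ?s) (y ?s) (u i, undefined) (u k, undefined)
    = (\<Sum>j\<in>UNIV. x ?s (u i, undefined) (u j, undefined) * y ?s (u j, undefined) (u k, undefined))"
    using inj slice_point_support(1)[OF assms]
    by (intro op_mult_range[of "\<lambda>j. (u j, undefined)"]) (auto simp: inj_def)
  then show "slice u \<theta> \<kappa> (\<lambda>p. op_mult (x p) (y p)) i k = op_mult (slice u \<theta> \<kappa> x) (slice u \<theta> \<kappa> y) i k"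
    by (simp add: slice_def op_mult_finite)
qed

end

section \<open>Functoriality, and the universal property tested on scalars\<close>

lemma unital_star_homD:
  assumes "unital_star_hom A B f"
  shows "x \<in> carrier A \<Longrightarrow> f x \<in> carrier B"
    and "x \<in> carrier A \<Longrightarrow> y \<in> carrier A \<Longrightarrow> f (x \<otimes>\<^bsub>A\<^esub> y) = f x \<otimes>\<^bsub>B\<^esub> f y"
    and "x \<in> carrier A \<Longrightarrow> y \<in> carrier A \<Longrightarrow> f (x \<oplus>\<^bsub>A\<^esub> y) = f x \<oplus>\<^bsub>B\<^esub> f y"
    and "f \<one>\<^bsub>A\<^esub> = \<one>\<^bsub>B\<^esub>"
    and "x \<in> carrier A \<Longrightarrow> f (cscale A z x) = cscale B z (f x)"
    and "x \<in> carrier A \<Longrightarrow> f (cstar A x) = cstar B (f x)"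
  using assms by (auto simp: unital_star_hom_def ring_hom_def)

lemma unital_star_homI:
  assumes "\<And>x. x \<in> carrier A \<Longrightarrow> f x \<in> carrier B"
    and "\<And>x y. x \<in> carrier A \<Longrightarrow> y \<in> carrier A \<Longrightarrow> f (x \<otimes>\<^bsub>A\<^esub> y) = f x \<otimes>\<^bsub>B\<^esub> f y"
    and "\<And>x y. x \<in> carrier A \<Longrightarrow> y \<in> carrier A \<Longrightarrow> f (x \<oplus>\<^bsub>A\<^esub> y) = f x \<oplus>\<^bsub>B\<^esub> f y"
    and "f \<one>\<^bsub>A\<^esub> = \<one>\<^bsub>B\<^esub>"
    and "\<And>z x. x \<in> carrier A \<Longrightarrow> f (cscale A z x) = cscale B z (f x)"
    and "\<And>x. x \<in> carrier A \<Longrightarrow> f (cstar A x) = cstar B (f x)"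
  shows "unital_star_hom A B f"
  using assms by (auto simp: unital_star_hom_def ring_hom_def)

lemma unital_star_hom_compose:
  assumes "unital_star_hom A B f" "unital_star_hom B C g"
  shows "unital_star_hom A C (\<lambda>x. g (f x))"
  by (rule unital_star_homI) (simp_all add: unital_star_homD[OF assms(1)] unital_star_homD[OF assms(2)])

lemma star_representation_compose:
  assumes "unital_star_hom C D \<Lambda>" "star_representation D \<sigma>"
  shows "star_representation C (\<lambda>x. \<sigma> (\<Lambda> x))"
  unfolding star_representation_def
  using unital_star_homD[OF assms(1)] star_representationD[OF assms(2)] by simp

lemma character_compose:
  assumes "unital_star_hom C D \<Lambda>" "character D \<kappa>"
  shows "character C (\<lambda>x. \<kappa> (\<Lambda> x))"
  unfolding character_def
  using unital_star_homD[OF assms(1)] characterD[OF assms(2)] by simp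

text \<open>The map \<open>id \<otimes> \<Lambda>\<close>. As tensors are families over pairs of representations, it is the pullback along
\<open>\<sigma> \<mapsto> \<sigma> \<circ> \<Lambda>\<close>, and it is visibly multiplicative and contractive.\<close>

definition tensor_map ::
    "'b cstar_alg \<Rightarrow> 'c cstar_alg \<Rightarrow> ('c \<Rightarrow> 'c) \<Rightarrow> ('b, 'c) tensor \<Rightarrow> ('b, 'c) tensor" where
  "tensor_map B D \<Lambda> x =
     (\<lambda>(\<pi>, \<sigma>). if (\<pi>, \<sigma>) \<in> rep_pairs B D then x (\<pi>, \<lambda>c. \<sigma> (\<Lambda> c)) else op_zero)"

lemma tensor_map_apply:
  "(\<pi>, \<sigma>) \<in> rep_pairs B D \<Longrightarrow> tensor_map B D \<Lambda> x (\<pi>, \<sigma>) = x (\<pi>, \<lambda>c. \<sigma> (\<Lambda> c))"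
  by (simp add: tensor_map_def)

lemma tensor_map_outside: "p \<notin> rep_pairs B D \<Longrightarrow> tensor_map B D \<Lambda> x p = op_zero"
  by (cases p) (simp add: tensor_map_def)

context
  fixes B :: "'b cstar_alg" and C D :: "'c cstar_alg" and \<Lambda> :: "'c \<Rightarrow> 'c"
  assumes \<Lambda>: "unital_star_hom C D \<Lambda>"
begin

lemma pullback_rep_pair:
  "(\<pi>, \<sigma>) \<in> rep_pairs B D \<Longrightarrow> (\<pi>, \<lambda>c. \<sigma> (\<Lambda> c)) \<in> rep_pairs B C"
  using star_representation_compose[OF \<Lambda>] by (auto simp: rep_pairs_iff)

lemma tensor_map_elem:
  "tensor_map B D \<Lambda> (elem_tensor B C b c) = elem_tensor B D b (\<Lambda> c)"
  using pullback_rep_pair by (auto simp: tensor_map_def elem_tensor_def)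

lemma tensor_map_add:
  "tensor_map B D \<Lambda> (\<lambda>p. op_add (x p) (y p)) =
     (\<lambda>p. op_add (tensor_map B D \<Lambda> x p) (tensor_map B D \<Lambda> y p))"
  by (auto simp: tensor_map_def op_add_def op_zero_def)

lemma tensor_map_alg:
  "t \<in> alg_tensor B C \<Longrightarrow> tensor_map B D \<Lambda> t \<in> alg_tensor B D"
proof (induction rule: alg_tensor.induct)
  case zero
  have "tensor_map B D \<Lambda> (\<lambda>p. op_zero) = (\<lambda>p. op_zero)" by (auto simp: tensor_map_def)
  then show ?case using alg_tensor.zero by metis
next
  case (add_elem t b c)
  then show ?case
    using alg_tensor.add_elem[OF add_elem(4)] unital_star_homD(1)[OF \<Lambda>]
    by (simp add: tensor_map_add tensor_map_elem)
qed

lemma tensor_map_closed: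
  assumes x: "x \<in> carrier (min_tensor B C)"
  shows "tensor_map B D \<Lambda> x \<in> carrier (min_tensor B D)"
  unfolding carrier_min_tensor
proof (intro conjI allI impI)
  fix e :: real assume "e > 0"
  then obtain t where t: "t \<in> alg_tensor B C"
    "\<And>p. p \<in> rep_pairs B C \<Longrightarrow> op_bound (op_diff (x p) (t p)) e"
    using carrier_min_tensorD(2)[OF x] by blast
  have "op_bound (op_diff (tensor_map B D \<Lambda> x p) (tensor_map B D \<Lambda> t p)) e"
    if "p \<in> rep_pairs B D" for p
    using that t(2) pullback_rep_pair by (cases p) (simp add: tensor_map_apply)
  then show "\<exists>t\<in>alg_tensor B D. \<forall>p\<in>rep_pairs B D. op_bound (op_diff (tensor_map B D \<Lambda> x p) (t p)) e"
    using tensor_map_alg[OF t(1)] by blast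
qed (simp add: tensor_map_outside)

lemma unital_star_hom_tensor_map:
  "unital_star_hom (min_tensor B C) (min_tensor B D) (tensor_map B D \<Lambda>)"
proof (rule unital_star_homI)
  show "tensor_map B D \<Lambda> \<one>\<^bsub>min_tensor B C\<^esub> = \<one>\<^bsub>min_tensor B D\<^esub>"
    by (simp add: min_tensor_simps tensor_map_elem unital_star_homD(4)[OF \<Lambda>])
next
  fix z x assume "x \<in> carrier (min_tensor B C)"
  show "tensor_map B D \<Lambda> (cscale (min_tensor B C) z x) = cscale (min_tensor B D) z (tensor_map B D \<Lambda> x)"
    by (auto simp: min_tensor_simps tensor_map_def op_scale_def op_zero_def)
next
  fix x assume "x \<in> carrier (min_tensor B C)"
  show "tensor_map B D \<Lambda> (cstar (min_tensor B C) x) = cstar (min_tensor B D) (tensor_map B D \<Lambda> x)"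
    by (auto simp: min_tensor_simps tensor_map_def op_adjoint_def op_zero_def)
next
  fix x y
  show "tensor_map B D \<Lambda> (x \<otimes>\<^bsub>min_tensor B C\<^esub> y)
     = tensor_map B D \<Lambda> x \<otimes>\<^bsub>min_tensor B D\<^esub> tensor_map B D \<Lambda> y"
    by (auto simp: min_tensor_simps tensor_map_def)
qed (simp_all add: tensor_map_closed tensor_map_add min_tensor_simps)

lemma is_tensor_hom_tensor_map:
  assumes "tensor_product B C"
  shows "is_tensor_hom B C B D (\<lambda>b. b) \<Lambda> (tensor_map B D \<Lambda>)"
  unfolding is_tensor_hom_def
proof (intro conjI ballI unital_star_hom_tensor_map tensor_map_elem)
  interpret tensor_product B C by (rule assms)
  fix x assume x: "x \<in> carrier (min_tensor B C)"
  have "op_norm (tensor_map B D \<Lambda> x p) \<le> cnorm (min_tensor B C) x" if "p \<in> rep_pairs B D" for p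
    using that op_norm_le[OF op_bound_cnorm[OF x pullback_rep_pair]]
    by (cases p) (simp add: tensor_map_apply)
  then show "cnorm (min_tensor B D) (tensor_map B D \<Lambda> x) \<le> cnorm (min_tensor B C) x"
    unfolding min_tensor_simps(7)[of B D] by (intro cSUP_least rep_pairs_nonempty)
qed

end

lemma C2_simps [simp]:
  "carrier C2 = UNIV" "mult C2 = (*)" "one C2 = 1" "zero C2 = 0" "add C2 = (+)"
  "cscale C2 = (\<lambda>z x. \<chi> i. z * x $ i)" "cstar C2 = (\<lambda>x. \<chi> i. cnj (x $ i))"
  by (simp_all add: C2_def)

text \<open>The minimal projection that together with \<open>1\<close> spans \<open>\<complex>\<^sup>2\<close>: homomorphisms on \<open>\<complex>\<^sup>2\<close> are projections.\<close>

definition C2_unit :: "complex^2" where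
  "C2_unit = (\<chi> i. if i = 1 then 1 else 0)"

lemma C2_expansion: "a = cscale C2 (a $ 1 - a $ 2) C2_unit + cscale C2 (a $ 2) 1"
  by (auto simp: vec_eq_iff C2_unit_def) (metis exhaust_2)

text \<open>An arbitrary pair of distinct basis vectors, to host the defining representation of \<open>M\<^sub>2(\<complex>)\<close>.\<close>

definition M2_index :: "2 \<Rightarrow> complex^2^2" where
  "M2_index i = matrix_unit i i"

definition M2_entries :: "complex^2^2 \<Rightarrow> 2 op" where
  "M2_entries m = (\<lambda>i j. m $ i $ j)"

lemma inj_M2_index: "inj M2_index"
  by (rule injI) (auto simp: M2_index_def matrix_unit_def vec_eq_iff split: if_splits)

lemma star_representation_M2_entries: "star_representation M2 M2_entries"
  unfolding star_representation_def
  by (auto simp: M2_entries_def op_add_def op_scale_def op_adjoint_def op_mult_finite fun_eq_iff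
      matrix_matrix_mult_def intro!: bounded_op_finite_support[of UNIV])

abbreviation M2_slice :: "('c \<Rightarrow> complex) \<Rightarrow> (complex^2^2, 'c) tensor \<Rightarrow> 2 op" where
  "M2_slice \<equiv> slice M2_index M2_entries"

lemma slicing_M2: "character C \<kappa> \<Longrightarrow> slicing M2 C M2_index M2_entries \<kappa>"
  by (simp add: slicing_def star_representation_M2_entries inj_M2_index)

lemma M2_slice_hom:
  assumes "unital_star_hom C2 (min_tensor M2 C) \<Phi>" "character C \<kappa>"
  shows "M2_slice \<kappa> (\<Phi> a) i j =
     (a $ 1 - a $ 2) * M2_slice \<kappa> (\<Phi> C2_unit) i j + a $ 2 * (if i = j then 1 else 0)"
proof -
  interpret slicing M2 C M2_index M2_entries \<kappa> by (rule slicing_M2[OF assms(2)])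
  note D = unital_star_homD[OF assms(1)]
  have add: "\<Phi> (x + y) = (\<lambda>p. op_add (\<Phi> x p) (\<Phi> y p))" for x y
    using D(3)[of x y] by (simp add: min_tensor_simps)
  have sc: "\<Phi> (cscale C2 z x) = (\<lambda>p. op_scale z (\<Phi> x p))" for z x
    using D(5)[of x z] by (simp add: min_tensor_simps)
  have one: "\<Phi> 1 = one (min_tensor M2 C)"
    using D(4) by simp
  have "M2_slice \<kappa> (\<Phi> 1) i j = (if i = j then 1 else 0)"
    unfolding one slice_one by (simp add: M2_entries_def mat_def)
  then show ?thesis
    unfolding arg_cong[OF C2_expansion[of a], of \<Phi>] add sc slice_linear
    by (simp add: op_add_def op_scale_def)
qed

lemma M2_slice_projection:
  assumes "unital_star_hom C2 (min_tensor M2 C) \<Phi>" "character C \<kappa>"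
  shows "op_mult (M2_slice \<kappa> (\<Phi> C2_unit)) (M2_slice \<kappa> (\<Phi> C2_unit)) = M2_slice \<kappa> (\<Phi> C2_unit)"
    and "op_adjoint (M2_slice \<kappa> (\<Phi> C2_unit)) = M2_slice \<kappa> (\<Phi> C2_unit)"
proof -
  interpret slicing M2 C M2_index M2_entries \<kappa> by (rule slicing_M2[OF assms(2)])
  note D = unital_star_homD[OF assms(1)]
  have "C2_unit * C2_unit = C2_unit" "cstar C2 C2_unit = C2_unit"
    by (auto simp: C2_unit_def vec_eq_iff)
  then have sq: "\<Phi> C2_unit = (\<lambda>p. op_mult (\<Phi> C2_unit p) (\<Phi> C2_unit p))"
    and st: "\<Phi> C2_unit = (\<lambda>p. op_adjoint (\<Phi> C2_unit p))"
    using D(2)[of C2_unit C2_unit] D(6)[of C2_unit] by (simp_all add: min_tensor_simps)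
  have car: "\<Phi> C2_unit \<in> carrier (min_tensor M2 C)" using D(1) by simp
  show "op_mult (M2_slice \<kappa> (\<Phi> C2_unit)) (M2_slice \<kappa> (\<Phi> C2_unit)) = M2_slice \<kappa> (\<Phi> C2_unit)"
    using slice_mult[OF car, of "\<Phi> C2_unit"] unfolding sq[symmetric] by (rule sym)
  show "op_adjoint (M2_slice \<kappa> (\<Phi> C2_unit)) = M2_slice \<kappa> (\<Phi> C2_unit)"
    using slice_linear(4)[of M2_index M2_entries \<kappa> "\<Phi> C2_unit"] unfolding st[symmetric] by (rule sym)
qed

lemma cmod_diff_diff: "cmod ((a - b) - (c - d)) \<le> cmod (a - c) + cmod (b - d)"
  using norm_triangle_ineq4[of "a - c" "b - d"] by (simp add: algebra_simps)

text \<open>Both sides are continuous and linear in \<open>x\<close>, the left one since \<open>F\<close> is a contraction, and they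
agree on elementary tensors.\<close>

lemma M2_slice_tensor_hom:
  assumes F: "is_tensor_hom M2 C M2 D (\<lambda>b. b) \<Lambda> F"
    and \<Lambda>: "unital_star_hom C D \<Lambda>" and \<kappa>: "character D \<kappa>"
    and C: "tensor_factor C" and D: "tensor_factor D"
    and x: "x \<in> carrier (min_tensor M2 C)"
  shows "M2_slice \<kappa> (F x) = M2_slice (\<lambda>c. \<kappa> (\<Lambda> c)) x"
proof (intro ext)
  fix i j
  interpret MC: tensor_product M2 C
    using C tensor_factor_M2 by (simp add: tensor_product_def)
  interpret MD: tensor_product M2 D
    using D tensor_factor_M2 by (simp add: tensor_product_def)
  interpret sD: slicing M2 D M2_index M2_entries \<kappa> by (rule slicing_M2[OF \<kappa>])
  interpret sC: slicing M2 C M2_index M2_entries "\<lambda>c. \<kappa> (\<Lambda> c)" 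
    by (rule slicing_M2[OF character_compose[OF \<Lambda> \<kappa>]])
  have hom: "unital_star_hom (min_tensor M2 C) (min_tensor M2 D) F"
    and contr: "\<And>x. x \<in> carrier (min_tensor M2 C) \<Longrightarrow> cnorm (min_tensor M2 D) (F x) \<le> cnorm (min_tensor M2 C) x"
    and elem: "\<And>a b. b \<in> carrier C \<Longrightarrow> F (elem_tensor M2 C a b) = elem_tensor M2 D a (\<Lambda> b)"
    using F unfolding is_tensor_hom_def by auto
  note Fhom = unital_star_homD[OF hom, unfolded min_tensor_simps]
  have F0: "F (\<lambda>p. op_zero) = (\<lambda>p. op_zero)"
  proof -
    have "F (\<lambda>p. op_scale 0 (op_zero)) = (\<lambda>p. op_scale 0 (F (\<lambda>p. op_zero) p))"
      using Fhom(5)[OF alg_tensor_subset[OF alg_tensor.zero], of 0] by simp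
    then show ?thesis by (simp add: op_scale_def op_zero_def)
  qed
  let ?h = "\<lambda>x. M2_slice \<kappa> (F x) i j - M2_slice (\<lambda>c. \<kappa> (\<Lambda> c)) x i j"
  have "?h x = 0"
  proof (rule min_tensor_functional_zero[OF x, where M = 2])
    show "?h (\<lambda>p. op_zero) = 0" unfolding F0 slice_linear by (simp add: op_zero_def)
  next
    fix t a b assume t: "t \<in> alg_tensor M2 C" and b: "b \<in> carrier C"
    show "?h (\<lambda>p. op_add (t p) (elem_tensor M2 C a b p)) = ?h t"
    proof -
      have "F (\<lambda>p. op_add (t p) (elem_tensor M2 C a b p)) = (\<lambda>p. op_add (F t p) (elem_tensor M2 D a (\<Lambda> b) p))"
        using Fhom(3)[OF alg_tensor_subset[OF t] elem_in_min_tensor, of a b] b by (simp add: elem)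
      then show ?thesis
        by (simp only: slice_linear sC.slice_elem sD.slice_elem) (simp add: op_add_def)
    qed
  next
    fix t e assume t: "t \<in> alg_tensor M2 C" and e: "0 < e"
      and le: "\<And>p. p \<in> rep_pairs M2 C \<Longrightarrow> op_bound (op_diff (x p) (t p)) e"
    have t': "t \<in> carrier (min_tensor M2 C)" using alg_tensor_subset[OF t] .
    let ?y = "\<lambda>p. op_diff (x p) (t p)"
    have mt: "(\<lambda>p. op_scale (-1) (t p)) \<in> carrier (min_tensor M2 C)"
      by (rule MC.min_tensor_scale_closed[OF t'])
    have y: "?y \<in> carrier (min_tensor M2 C)"
      unfolding op_diff_eq by (rule min_tensor_add_closed[OF x mt])
    have Fy: "F ?y = (\<lambda>p. op_diff (F x p) (F t p))"
      unfolding op_diff_eq using Fhom(3)[OF x mt] Fhom(5)[OF t', of "-1"] by simp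
    have "cnorm (min_tensor M2 C) ?y \<le> e"
      unfolding min_tensor_simps(7) using le rep_pairs_nonempty by (intro cSUP_least op_norm_le)
    then have "op_bound (op_diff (F x p) (F t p)) e" if "p \<in> rep_pairs M2 D" for p
      using op_bound_mono[OF MD.op_bound_cnorm[OF Fhom(1)[OF y] that] order_trans[OF contr[OF y]]]
      unfolding Fy by blast
    then have 1: "cmod (M2_slice \<kappa> (F x) i j - M2_slice \<kappa> (F t) i j) \<le> e"
      by (rule sD.slice_diff_le)
    have 2: "cmod (M2_slice (\<lambda>c. \<kappa> (\<Lambda> c)) x i j - M2_slice (\<lambda>c. \<kappa> (\<Lambda> c)) t i j) \<le> e"
      using le by (rule sC.slice_diff_le)
    show "cmod (?h x - ?h t) \<le> 2 * e"
      using order_trans[OF cmod_diff_diff add_mono[OF 1 2]] by simp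
  qed
  then show "M2_slice \<kappa> (F x) i j = M2_slice (\<lambda>c. \<kappa> (\<Lambda> c)) x i j" by simp
qed

context unital_cstar_algebra
begin

lemma cstar_one: "cstar A \<one> = \<one>"
proof -
  show ?thesis
    using cstar_mult[OF cstar_closed[OF one_closed] one_closed] by (simp add: cstar_cstar cstar_closed)
qed

lemma unital_star_hom_scalar:
  assumes \<kappa>: "character A \<kappa>"
  shows "unital_star_hom A A (restrict (\<lambda>c. cscale A (\<kappa> c) \<one>) (carrier A))"
proof (rule unital_star_homI)
  fix x y assume "x \<in> carrier A" "y \<in> carrier A"
  then show "restrict (\<lambda>c. cscale A (\<kappa> c) \<one>) (carrier A) (x \<otimes> y) =
     restrict (\<lambda>c. cscale A (\<kappa> c) \<one>) (carrier A) x \<otimes> restrict (\<lambda>c. cscale A (\<kappa> c) \<one>) (carrier A) y"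
    by (simp add: characterD(3)[OF \<kappa>] cscale_mult_left cscale_mult_right cscale_closed cscale_cscale mult.commute)
qed (auto simp: characterD[OF \<kappa>] cscale_closed cscale_add_left cscale_one cstar_closed cscale_cscale
    cstar_cscale cstar_one)

end

text \<open>Amplifying \<open>c \<mapsto> \<kappa>(c) 1\<close> sends \<open>x\<close> to \<open>m \<otimes> 1\<close>, where \<open>m\<close> is the matrix of the slice. The right
  hand side is the value of this tensor at \<open>(\<pi>, \<sigma>)\<close>, with \<open>m\<close> expanded in matrix units.\<close>

lemma tensor_map_scalar:
  assumes "unital_cstar_algebra C" and \<kappa>: "character C \<kappa>"
    and x: "x \<in> carrier (min_tensor M2 C)" and ps: "(\<pi>, \<sigma>) \<in> rep_pairs M2 C"
  shows "tensor_map M2 C (restrict (\<lambda>c. cscale C (\<kappa> c) \<one>\<^bsub>C\<^esub>) (carrier C)) x (\<pi>, \<sigma>) (p, p') (q, q')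
    = (\<Sum>i\<in>UNIV. \<Sum>j\<in>UNIV. M2_slice \<kappa> x i j * \<pi> (matrix_unit i j) p q) * \<sigma> \<one>\<^bsub>C\<^esub> p' q'"
proof -
  interpret C: unital_cstar_algebra C by fact
  interpret s: slicing M2 C M2_index M2_entries \<kappa> by (rule slicing_M2[OF \<kappa>])
  let ?L = "restrict (\<lambda>c. cscale C (\<kappa> c) \<one>\<^bsub>C\<^esub>) (carrier C)"
  have pull: "(\<pi>, \<lambda>c. \<sigma> (?L c)) \<in> rep_pairs M2 C"
    by (rule pullback_rep_pair[OF C.unital_star_hom_scalar[OF \<kappa>] ps])
  have \<pi>: "star_representation M2 \<pi>" and \<sigma>: "star_representation C \<sigma>"
    using ps by (auto simp: rep_pairs_iff)
  let ?S = "\<lambda>x. (\<Sum>i\<in>UNIV. \<Sum>j\<in>UNIV. M2_slice \<kappa> x i j * \<pi> (matrix_unit i j) p q) * \<sigma> \<one>\<^bsub>C\<^esub> p' q'"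
  let ?h = "\<lambda>x. x (\<pi>, \<lambda>c. \<sigma> (?L c)) (p, p') (q, q') - ?S x"
  let ?N = "\<Sum>i\<in>UNIV. \<Sum>j\<in>UNIV. cmod (\<pi> (matrix_unit i j) p q)"
  have "?h x = 0"
  proof (rule min_tensor_functional_zero[OF x, where M = "1 + ?N * cmod (\<sigma> \<one>\<^bsub>C\<^esub> p' q')"])
    show "?h (\<lambda>p. op_zero) = 0" unfolding slice_linear by (simp add: op_zero_def)
  next
    fix t a b assume t: "t \<in> alg_tensor M2 C" and b: "b \<in> carrier C"
    have "?S (\<lambda>r. op_add (t r) (elem_tensor M2 C a b r))
        = ?S t + (\<Sum>i\<in>UNIV. \<Sum>j\<in>UNIV. \<kappa> b * a $ i $ j * \<pi> (matrix_unit i j) p q) * \<sigma> \<one>\<^bsub>C\<^esub> p' q'"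
      unfolding slice_linear s.slice_elem
      by (simp add: op_add_def op_scale_def M2_entries_def distrib_right sum.distrib)
    also have "(\<Sum>i\<in>UNIV. \<Sum>j\<in>UNIV. \<kappa> b * a $ i $ j * \<pi> (matrix_unit i j) p q) = \<kappa> b * \<pi> a p q"
      unfolding M2_representation_expansion[OF \<pi>, of a] by (simp add: sum_distrib_left mult.assoc)
    finally show "?h (\<lambda>p. op_add (t p) (elem_tensor M2 C a b p)) = ?h t"
      using pull b star_representationD(4)[OF \<sigma> C.one_closed, of "\<kappa> b"]
      by (simp add: op_add_def elem_tensor_def op_tensor_def op_scale_def)
  next
    fix t e assume t: "t \<in> alg_tensor M2 C" and e: "0 < e"
      and le: "\<And>p. p \<in> rep_pairs M2 C \<Longrightarrow> op_bound (op_diff (x p) (t p)) e"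
    have 1: "cmod (x (\<pi>, \<lambda>c. \<sigma> (?L c)) (p, p') (q, q') - t (\<pi>, \<lambda>c. \<sigma> (?L c)) (p, p') (q, q')) \<le> e"
      using op_bound_entry[OF le[OF pull], of "(p, p')" "(q, q')"] by (simp add: op_diff_def)
    have "?S x - ?S t = (\<Sum>i\<in>UNIV. \<Sum>j\<in>UNIV. (M2_slice \<kappa> x i j - M2_slice \<kappa> t i j)
         * \<pi> (matrix_unit i j) p q) * \<sigma> \<one>\<^bsub>C\<^esub> p' q'"
      by (simp add: left_diff_distrib sum_subtractf)
    also have "cmod \<dots> \<le> (\<Sum>i\<in>UNIV. \<Sum>j\<in>UNIV. e * cmod (\<pi> (matrix_unit i j) p q)) * cmod (\<sigma> \<one>\<^bsub>C\<^esub> p' q')"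
      unfolding norm_mult
      by (intro mult_right_mono order_trans[OF norm_sum] sum_mono)
        (auto simp: norm_mult intro!: mult_right_mono s.slice_diff_le le)
    also have "\<dots> = ?N * cmod (\<sigma> \<one>\<^bsub>C\<^esub> p' q') * e"
      by (simp add: sum_distrib_left mult_ac)
    finally have 2: "cmod (?S x - ?S t) \<le> ?N * cmod (\<sigma> \<one>\<^bsub>C\<^esub> p' q') * e" .
    have "cmod (?h x - ?h t) \<le> e + ?N * cmod (\<sigma> \<one>\<^bsub>C\<^esub> p' q') * e"
      by (rule order_trans[OF cmod_diff_diff add_mono[OF 1 2]])
    then show "cmod (?h x - ?h t) \<le> (1 + ?N * cmod (\<sigma> \<one>\<^bsub>C\<^esub> p' q')) * e"
      by (simp only: distrib_right mult_1)
  qed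
  then show ?thesis using ps by (simp add: tensor_map_apply)
qed

lemma ex1_unique: "\<exists>!x. P x \<Longrightarrow> P a \<Longrightarrow> P b \<Longrightarrow> a = b"
  by blast

lemma universal_property:
  fixes C D :: "'c cstar_alg"
  assumes univ: "quantum_space_of_all_maps B A C \<Phi>"
    and "unital_cstar_algebra D" "unital_star_hom A (min_tensor B D) \<Psi>"
  shows "\<exists>!\<Lambda>. \<Lambda> \<in> extensional (carrier C) \<and> unital_star_hom C D \<Lambda> \<and>
           (\<exists>F. is_tensor_hom B C B D (\<lambda>b. b) \<Lambda> F \<and> (\<forall>a\<in>carrier A. F (\<Phi> a) = \<Psi> a))"
  by (rule univ[unfolded quantum_space_of_all_maps_def, THEN conjunct2, THEN conjunct2,
        THEN spec, THEN spec, THEN mp, THEN mp, OF assms(2,3)])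

text \<open>A character \<open>\<kappa>\<close> of \<open>C\<close> gives the homomorphism \<open>c \<mapsto> \<kappa>(c) 1\<close> from \<open>C\<close> to itself. By
\<open>tensor_map_scalar\<close>, its amplification after \<open>\<Phi>\<close> depends on the slices of \<open>\<Phi>\<close> only, and the
uniqueness part of the universal property, tested on \<open>C\<close> itself, applies.\<close>

lemma character_determined_by_slice:
  fixes C :: "'c cstar_alg"
  assumes univ: "quantum_space_of_all_maps M2 C2 C \<Phi>" and C: "tensor_factor C"
    and \<kappa>: "character C \<kappa>" and \<kappa>': "character C \<kappa>'"
    and eq: "M2_slice \<kappa> (\<Phi> C2_unit) = M2_slice \<kappa>' (\<Phi> C2_unit)"
    and c: "c \<in> carrier C"
  shows "\<kappa> c = \<kappa>' c"
proof -
  have Cstar: "unital_cstar_algebra C" and \<Phi>: "unital_star_hom C2 (min_tensor M2 C) \<Phi>"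
    using univ by (auto simp: quantum_space_of_all_maps_def)
  interpret C: unital_cstar_algebra C by (rule Cstar)
  have tp: "tensor_product M2 C" using C tensor_factor_M2 by (simp add: tensor_product_def)
  let ?L = "\<lambda>\<kappa>. restrict (\<lambda>c. cscale C (\<kappa> c) \<one>\<^bsub>C\<^esub>) (carrier C)"
  let ?F = "\<lambda>\<kappa>. tensor_map M2 C (?L \<kappa>)"
  have \<Psi>: "unital_star_hom C2 (min_tensor M2 C) (\<lambda>a. ?F \<kappa> (\<Phi> a))"
    by (rule unital_star_hom_compose[OF \<Phi> unital_star_hom_tensor_map[OF C.unital_star_hom_scalar[OF \<kappa>]]])
  have same: "?F \<kappa>' (\<Phi> a) = ?F \<kappa> (\<Phi> a)" for a
  proof
    fix r :: "(complex^2^2 \<Rightarrow> (complex^2^2) op) \<times> ('c \<Rightarrow> 'c op)"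
    obtain \<pi> \<sigma> where r: "r = (\<pi>, \<sigma>)" by (cases r)
    have \<Phi>a: "\<Phi> a \<in> carrier (min_tensor M2 C)" using unital_star_homD(1)[OF \<Phi>] by simp
    have "M2_slice \<kappa>' (\<Phi> a) i j = M2_slice \<kappa> (\<Phi> a) i j" for i j
      unfolding M2_slice_hom[OF \<Phi> \<kappa>, of a i j] M2_slice_hom[OF \<Phi> \<kappa>', of a i j] eq ..
    then show "?F \<kappa>' (\<Phi> a) r = ?F \<kappa> (\<Phi> a) r"
      by (cases "r \<in> rep_pairs M2 C")
        (auto simp: r fun_eq_iff tensor_map_outside tensor_map_scalar[OF Cstar \<kappa> \<Phi>a] tensor_map_scalar[OF Cstar \<kappa>' \<Phi>a])
  qed
  define P where "P \<Lambda> \<longleftrightarrow> \<Lambda> \<in> extensional (carrier C) \<and> unital_star_hom C C \<Lambda> \<and>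
      (\<exists>F. is_tensor_hom M2 C M2 C (\<lambda>b. b) \<Lambda> F \<and> (\<forall>a\<in>carrier C2. F (\<Phi> a) = ?F \<kappa> (\<Phi> a)))" for \<Lambda>
  have ex1: "\<exists>!\<Lambda>. P \<Lambda>"
    unfolding P_def by (rule universal_property[OF univ Cstar \<Psi>])
  have P\<kappa>: "P (?L \<kappa>)"
    unfolding P_def
    using C.unital_star_hom_scalar[OF \<kappa>] is_tensor_hom_tensor_map[OF C.unital_star_hom_scalar[OF \<kappa>] tp]
    by (intro conjI exI[of _ "?F \<kappa>"] ballI) auto
  have P\<kappa>': "P (?L \<kappa>')"
    unfolding P_def
    using C.unital_star_hom_scalar[OF \<kappa>'] is_tensor_hom_tensor_map[OF C.unital_star_hom_scalar[OF \<kappa>'] tp] same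
    by (intro conjI exI[of _ "?F \<kappa>'"] ballI) auto
  have "?L \<kappa> = ?L \<kappa>'" by (rule ex1_unique[of P, OF ex1 P\<kappa> P\<kappa>'])
  from fun_cong[OF this, of c] have "cscale C (\<kappa> c) \<one>\<^bsub>C\<^esub> = cscale C (\<kappa>' c) \<one>\<^bsub>C\<^esub>"
    using c by simp
  then have "\<kappa> (cscale C (\<kappa> c) \<one>\<^bsub>C\<^esub>) = \<kappa> (cscale C (\<kappa>' c) \<one>\<^bsub>C\<^esub>)" by simp
  then show ?thesis by (simp add: characterD[OF \<kappa>])
qed

section \<open>Uniform bounds from a contraction\<close>

lemma op_bound_tensor_corner:
  assumes "op_bound (op_tensor m n) K" and "m i i = 1"
  shows "op_bound n K"
  unfolding op_bound_def
proof (intro conjI allI impI)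
  show "0 \<le> K" using op_bound_nonneg[OF assms(1)] .
  fix I J :: "'b set" and w :: "'b \<Rightarrow> complex"
  assume fin: "finite I" "finite J"
  have inj: "inj_on (Pair i) X" for X :: "'b set" by (auto simp: inj_on_def)
  have "L2_set (\<lambda>p. cmod (\<Sum>q\<in>Pair i ` J. op_tensor m n p q * w (snd q))) (Pair i ` I)
      \<le> K * L2_set (\<lambda>q. cmod (w (snd q))) (Pair i ` J)"
    using fin by (intro op_boundD[OF assms(1)]) auto
  then show "L2_set (\<lambda>j. cmod (\<Sum>l\<in>J. n j l * w l)) I \<le> K * L2_set (\<lambda>l. cmod (w l)) J"
    by (simp add: L2_set_def sum.reindex[OF inj] op_tensor_def assms(2))
qed

lemma Sup_unbounded: "\<not> bdd_above S \<Longrightarrow> Sup S = (LEAST z::real. False)"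
  unfolding Sup_real_def bdd_above_def by meson

text \<open>Uniform bounds for \<open>C\<close> are inherited from an algebra \<open>D\<close> that has them and that receives
  a contraction \<open>id \<otimes> \<Lambda>\<close>. If the representations of \<open>C\<close> were not uniformly bounded on \<open>a\<close>, then
  \<open>\<parallel>1 \<otimes> n a\<parallel>\<close> would be one and the same default value for all \<open>n > 0\<close>, whereas the contraction
  forces it to be at least \<open>n \<bar>\<kappa>(\<Lambda> a)\<bar>\<close>. This settles the case \<open>\<kappa>(\<Lambda> a) \<noteq> 0\<close>; otherwise
  \<open>a + 1\<close> takes the place of \<open>a\<close>.\<close>

lemma tensor_factor_of_contraction:
  assumes Cstar: "unital_cstar_algebra C" and D: "tensor_factor D"
    and \<Lambda>: "unital_star_hom C D \<Lambda>" and \<kappa>: "character D \<kappa>"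
    and F: "is_tensor_hom M2 C M2 D (\<lambda>b. b) \<Lambda> F"
  shows "tensor_factor C"
proof -
  interpret C: unital_cstar_algebra C by (rule Cstar)
  interpret MD: tensor_product M2 D
    using D tensor_factor_M2 by (simp add: tensor_product_def)
  interpret s: slicing M2 D M2_index M2_entries \<kappa> by (rule slicing_M2[OF \<kappa>])
  have contr: "cnorm (min_tensor M2 D) (F x) \<le> cnorm (min_tensor M2 C) x"
    if "x \<in> carrier (min_tensor M2 C)" for x
    using F that unfolding is_tensor_hom_def by blast
  let ?\<pi> = "\<lambda>a. inflate M2_index (M2_entries a)"
  have \<pi>: "star_representation M2 ?\<pi>"
    by (rule star_representation_inflate[OF star_representation_M2_entries inj_M2_index])
  have \<pi>1: "?\<pi> (mat 1) (M2_index 1) (M2_index 1) = 1"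
    by (simp add: inj_M2_index M2_entries_def mat_def)
  have nz: "rep_bounded C a" if a: "a \<in> carrier C" and a0: "\<kappa> (\<Lambda> a) \<noteq> 0" for a
  proof (rule ccontr)
    assume nb: "\<not> rep_bounded C a"
    let ?x = "\<lambda>n. elem_tensor M2 C (mat 1) (cscale C (of_nat (Suc n)) a)"
    have "\<not> bdd_above ((\<lambda>p. op_norm (?x n p)) ` rep_pairs M2 C)" for n
    proof
      assume "bdd_above ((\<lambda>p. op_norm (?x n p)) ` rep_pairs M2 C)"
      then obtain R where R: "op_norm (?x n p) \<le> R" if "p \<in> rep_pairs M2 C" for p
        unfolding bdd_above_def by auto
      have "rep_bounded C a"
      proof (rule rep_boundedI)
        fix \<sigma> :: "'a \<Rightarrow> 'a op" assume \<sigma>: "star_representation C \<sigma>"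
        have p: "(?\<pi>, \<sigma>) \<in> rep_pairs M2 C" using \<pi> \<sigma> by (simp add: rep_pairs_iff)
        have "op_bound (?x n (?\<pi>, \<sigma>)) R"
          using R[OF p] elem_tensor_bounded_op[of "mat 1" M2 "cscale C (of_nat (Suc n)) a" C] a
          by (simp add: op_bound_iff C.cscale_closed)
        then have "op_bound (\<sigma> (cscale C (of_nat (Suc n)) a)) R"
          unfolding elem_tensor_apply[OF \<pi> \<sigma>] using \<pi>1 by (rule op_bound_tensor_corner)
        then have "op_bound (op_scale (1 / of_nat (Suc n)) (op_scale (of_nat (Suc n)) (\<sigma> a))) (cmod (1 / of_nat (Suc n)) * R)"
          unfolding star_representationD(4)[OF \<sigma> a] by (rule op_bound_scale)
        then show "op_bound (\<sigma> a) (cmod (1 / of_nat (Suc n)) * R)"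
          by (simp add: op_scale_def del: of_nat_Suc)
      qed
      then show False using nb by blast
    qed
    then have cn: "cnorm (min_tensor M2 C) (?x n) = (LEAST z. False)" for n
      unfolding min_tensor_simps by (rule Sup_unbounded)
    have "of_nat (Suc n) * cmod (\<kappa> (\<Lambda> a)) \<le> (LEAST z. False)" for n
    proof -
      have na: "cscale C (of_nat (Suc n)) a \<in> carrier C" using a by (rule C.cscale_closed)
      have "F (?x n) = elem_tensor M2 D (mat 1) (\<Lambda> (cscale C (of_nat (Suc n)) a))"
        using F na unfolding is_tensor_hom_def by simp
      also have "\<Lambda> (cscale C (of_nat (Suc n)) a) = cscale D (of_nat (Suc n)) (\<Lambda> a)"
        using unital_star_homD(5)[OF \<Lambda> a] .
      finally have Fx: "F (?x n) = elem_tensor M2 D (mat 1) (cscale D (of_nat (Suc n)) (\<Lambda> a))" .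
      have \<Lambda>a: "\<Lambda> a \<in> carrier D" using unital_star_homD(1)[OF \<Lambda> a] .
      have "M2_slice \<kappa> (F (?x n)) 1 1 = of_nat (Suc n) * \<kappa> (\<Lambda> a)"
        unfolding Fx s.slice_elem 
        by (simp add: characterD(4)[OF \<kappa> \<Lambda>a] op_scale_def M2_entries_def mat_def del: of_nat_Suc)
      then have "of_nat (Suc n) * cmod (\<kappa> (\<Lambda> a)) = cmod (M2_slice \<kappa> (F (?x n)) 1 1)"
        by (simp add: norm_mult del: of_nat_Suc)
      also have "\<dots> \<le> cnorm (min_tensor M2 D) (F (?x n))"
        unfolding Fx using \<Lambda>a
        by (intro s.slice_le MD.op_bound_cnorm elem_in_min_tensor) (auto simp: MD.B.cscale_in)
      also have "\<dots> \<le> cnorm (min_tensor M2 C) (?x n)"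
        using na by (intro contr elem_in_min_tensor) simp_all
      finally show ?thesis unfolding cn .
    qed
    moreover obtain n where "(LEAST z. False) < of_nat n * cmod (\<kappa> (\<Lambda> a))"
      using a0 reals_Archimedean3 by (metis zero_less_norm_iff)
    moreover have "of_nat n * cmod (\<kappa> (\<Lambda> a)) \<le> of_nat (Suc n) * cmod (\<kappa> (\<Lambda> a))"
      by (intro mult_right_mono) auto
    ultimately show False by (meson linorder_not_less order_less_le_trans)
  qed
  have \<Lambda>1: "\<kappa> (\<Lambda> \<one>\<^bsub>C\<^esub>) = 1"
    by (simp add: unital_star_homD(4)[OF \<Lambda>] characterD(1)[OF \<kappa>])
  have "rep_bounded C a" if a: "a \<in> carrier C" for a
  proof (cases "\<kappa> (\<Lambda> a) = 0")
    case False
    then show ?thesis using nz a by blast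
  next
    case True
    have "\<kappa> (\<Lambda> (a \<oplus>\<^bsub>C\<^esub> \<one>\<^bsub>C\<^esub>)) = 1"
      using True \<Lambda>1 a unital_star_homD(1,3)[OF \<Lambda>] characterD(2)[OF \<kappa>] by simp
    then have b: "rep_bounded C (a \<oplus>\<^bsub>C\<^esub> \<one>\<^bsub>C\<^esub>)" "rep_bounded C (cscale C (-1) \<one>\<^bsub>C\<^esub>)"
      using nz[of "a \<oplus>\<^bsub>C\<^esub> \<one>\<^bsub>C\<^esub>"] nz[of "\<one>\<^bsub>C\<^esub>"] \<Lambda>1 a rep_bounded_cscale[OF C.one_closed, of "-1"] by auto
    have "\<one>\<^bsub>C\<^esub> \<oplus>\<^bsub>C\<^esub> cscale C (-1) \<one>\<^bsub>C\<^esub> = cscale C 0 \<one>\<^bsub>C\<^esub>"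
      using C.cscale_add_left[OF C.one_closed, of 1 "-1"] C.cscale_one by simp
    moreover have "cscale C 0 \<one>\<^bsub>C\<^esub> = \<zero>\<^bsub>C\<^esub>"
      using C.cnorm_cscale[of "\<one>\<^bsub>C\<^esub>" 0] C.cnorm_eq_zero C.cscale_closed by simp
    ultimately have "a \<oplus>\<^bsub>C\<^esub> \<one>\<^bsub>C\<^esub> \<oplus>\<^bsub>C\<^esub> cscale C (-1) \<one>\<^bsub>C\<^esub> = a"
      using a C.cscale_closed by (simp add: C.a_assoc)
    then show ?thesis
      using rep_bounded_add[OF _ _ b] a C.cscale_closed by simp
  qed
  then show ?thesis by (rule C.tensor_factorI)
qed

section \<open>Continuous functions on a compact space\<close>

text \<open>Functions vanish off \<open>K\<close>, so that a continuous function on \<open>K\<close> has exactly one representative.\<close>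

definition continuous_functions :: "'k::topological_space set \<Rightarrow> ('k \<Rightarrow> complex) set" where
  "continuous_functions K = {f. continuous_on K f \<and> (\<forall>p. p \<notin> K \<longrightarrow> f p = 0)}"

definition restrict0 :: "'k set \<Rightarrow> ('k \<Rightarrow> complex) \<Rightarrow> 'k \<Rightarrow> complex" where
  "restrict0 K f = (\<lambda>p. if p \<in> K then f p else 0)"

lemma restrict0_in: "continuous_on K f \<Longrightarrow> restrict0 K f \<in> continuous_functions K"
  by (simp add: continuous_functions_def restrict0_def cong: continuous_on_cong)

definition sup_norm :: "'k set \<Rightarrow> ('k \<Rightarrow> complex) \<Rightarrow> real" where
  "sup_norm K f = (SUP p\<in>K. cmod (f p))"

text \<open>The algebra of continuous functions on \<open>K\<close>, transported along an injection \<open>\<iota>\<close> into the type \<open>'c\<close>,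
because the universal property is tested on algebras on this type.\<close>

locale function_model =
  fixes K :: "'k::topological_space set" and \<iota> :: "('k \<Rightarrow> complex) \<Rightarrow> 'c"
  assumes compact: "compact K" and nonempty: "K \<noteq> {}"
    and inj: "inj_on \<iota> (continuous_functions K)"
begin

text \<open>Elements outside the carrier are read as \<open>0\<close>. This makes \<open>\<parallel>x - y\<parallel>\<close> nonnegative and symmetric on the
whole type, as the notion of a metric space demands even off the carrier.\<close>

definition dec :: "'c \<Rightarrow> 'k \<Rightarrow> complex" where
  "dec x = (if x \<in> \<iota> ` continuous_functions K
     then inv_into (continuous_functions K) \<iota> x else (\<lambda>_. 0))"

definition D :: "'c cstar_alg" where
  "D = \<lparr>carrier = \<iota> ` continuous_functions K,
        mult = (\<lambda>x y. \<iota> (\<lambda>p. dec x p * dec y p)),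
        one = \<iota> (restrict0 K (\<lambda>_. 1)),
        zero = \<iota> (\<lambda>_. 0),
        add = (\<lambda>x y. \<iota> (\<lambda>p. dec x p + dec y p)),
        cscale = (\<lambda>z x. \<iota> (\<lambda>p. z * dec x p)),
        cstar = (\<lambda>x. \<iota> (\<lambda>p. cnj (dec x p))),
        cnorm = (\<lambda>x. sup_norm K (dec x))\<rparr>"

lemma dec_\<iota> [simp]: "f \<in> continuous_functions K \<Longrightarrow> dec (\<iota> f) = f"
  by (simp add: dec_def inj)

lemma zero_continuous: "(\<lambda>_. 0) \<in> continuous_functions K"
  by (simp add: continuous_functions_def)

lemma dec_in [simp]: "dec x \<in> continuous_functions K"
  by (auto simp: dec_def inv_into_into zero_continuous)

lemma continuous_on_dec: "continuous_on K (dec x)"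
  using dec_in[of x] by (simp add: continuous_functions_def)

lemma dec_outside: "p \<notin> K \<Longrightarrow> dec x p = 0"
  using dec_in[of x] by (simp add: continuous_functions_def)

lemma continuous_functions_closed [simp]:
  "(\<lambda>p. dec x p * dec y p) \<in> continuous_functions K"
  "(\<lambda>p. dec x p + dec y p) \<in> continuous_functions K"
  "(\<lambda>p. z * dec x p) \<in> continuous_functions K"
  "(\<lambda>p. cnj (dec x p)) \<in> continuous_functions K"
  "(\<lambda>p. - dec x p) \<in> continuous_functions K"
  by (auto simp: continuous_functions_def dec_outside intro!: continuous_intros continuous_on_dec)

lemma carrier_D: "carrier D = \<iota> ` continuous_functions K"
  by (simp add: D_def)

lemma \<iota>_in [simp]: "f \<in> continuous_functions K \<Longrightarrow> \<iota> f \<in> carrier D"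
  by (simp add: carrier_D)

lemma D_simps:
  "dec (x \<otimes>\<^bsub>D\<^esub> y) = (\<lambda>p. dec x p * dec y p)"
  "dec (x \<oplus>\<^bsub>D\<^esub> y) = (\<lambda>p. dec x p + dec y p)"
  "dec \<one>\<^bsub>D\<^esub> = restrict0 K (\<lambda>_. 1)"
  "dec \<zero>\<^bsub>D\<^esub> = (\<lambda>_. 0)"
  "dec (cscale D z x) = (\<lambda>p. z * dec x p)"
  "dec (cstar D x) = (\<lambda>p. cnj (dec x p))"
  "cnorm D x = sup_norm K (dec x)"
  by (simp_all add: D_def zero_continuous restrict0_in)

lemma D_closed:
  "x \<otimes>\<^bsub>D\<^esub> y \<in> carrier D" "x \<oplus>\<^bsub>D\<^esub> y \<in> carrier D" "\<one>\<^bsub>D\<^esub> \<in> carrier D" "\<zero>\<^bsub>D\<^esub> \<in> carrier D"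
  "cscale D z x \<in> carrier D" "cstar D x \<in> carrier D"
  by (simp_all add: D_def zero_continuous restrict0_in)

lemma dec_eqI: "x \<in> carrier D \<Longrightarrow> y \<in> carrier D \<Longrightarrow> dec x = dec y \<Longrightarrow> x = y"
  by (auto simp: carrier_D)

lemma restrict0_mult [simp]: "restrict0 K (\<lambda>_. 1) p * dec x p = dec x p" "dec x p * restrict0 K (\<lambda>_. 1) p = dec x p"
  by (simp_all add: restrict0_def dec_outside)

lemma ring_D: "ring D"
proof (intro ringI abelian_groupI monoidI)
  fix x assume x: "x \<in> carrier D"
  show "\<exists>y\<in>carrier D. y \<oplus>\<^bsub>D\<^esub> x = \<zero>\<^bsub>D\<^esub>"
    by (intro bexI[of _ "\<iota> (\<lambda>p. - dec x p)"] dec_eqI D_closed)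
      (simp_all add: D_simps)
qed (auto intro!: dec_eqI D_closed simp: D_simps algebra_simps)

lemma cmod_le_sup_norm: "f \<in> continuous_functions K \<Longrightarrow> p \<in> K \<Longrightarrow> cmod (f p) \<le> sup_norm K f"
  unfolding sup_norm_def
  by (intro cSUP_upper bounded_imp_bdd_above compact_imp_bounded compact_continuous_image compact)
    (auto simp: continuous_functions_def intro!: continuous_intros)

lemma sup_norm_le: "(\<And>p. p \<in> K \<Longrightarrow> cmod (f p) \<le> c) \<Longrightarrow> sup_norm K f \<le> c"
  unfolding sup_norm_def by (rule cSUP_least[OF nonempty])

lemma sup_norm_nonneg: "f \<in> continuous_functions K \<Longrightarrow> 0 \<le> sup_norm K f"
  using nonempty cmod_le_sup_norm norm_ge_zero order_trans by blast

lemma D_minus: "dec (x \<ominus>\<^bsub>D\<^esub> y) = (\<lambda>p. dec x p - dec y p)"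
proof -
  have "\<ominus>\<^bsub>D\<^esub> y = \<iota> (\<lambda>p. - dec y p)"
    unfolding a_inv_def m_inv_def
  proof (rule the_equality)
    show "\<iota> (\<lambda>p. - dec y p) \<in> carrier (add_monoid D) \<and>
      y \<otimes>\<^bsub>add_monoid D\<^esub> \<iota> (\<lambda>p. - dec y p) = \<one>\<^bsub>add_monoid D\<^esub> \<and>
      \<iota> (\<lambda>p. - dec y p) \<otimes>\<^bsub>add_monoid D\<^esub> y = \<one>\<^bsub>add_monoid D\<^esub>"
      by (auto intro!: dec_eqI D_closed simp: D_simps)
  next
    fix z assume z: "z \<in> carrier (add_monoid D) \<and>
      y \<otimes>\<^bsub>add_monoid D\<^esub> z = \<one>\<^bsub>add_monoid D\<^esub> \<and> z \<otimes>\<^bsub>add_monoid D\<^esub> y = \<one>\<^bsub>add_monoid D\<^esub>"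
    then have "dec (y \<oplus>\<^bsub>D\<^esub> z) = dec \<zero>\<^bsub>D\<^esub>" by simp
    then have "dec y p + dec z p = 0" for p by (simp add: D_simps fun_eq_iff)
    then have "dec z p = - dec y p" for p by (simp add: eq_neg_iff_add_eq_0 add.commute)
    then have "dec z = (\<lambda>p. - dec y p)" by (intro ext)
    then show "z = \<iota> (\<lambda>p. - dec y p)" using z by (intro dec_eqI) (auto simp: D_simps)
  qed
  then show ?thesis by (simp add: a_minus_def D_simps)
qed

lemma sup_norm_triangle:
  assumes "f \<in> continuous_functions K" "g \<in> continuous_functions K"
  shows "sup_norm K (\<lambda>p. f p + g p) \<le> sup_norm K f + sup_norm K g"
  by (intro sup_norm_le order_trans[OF norm_triangle_ineq] add_mono cmod_le_sup_norm assms)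

lemma sup_norm_scale:
  assumes "f \<in> continuous_functions K"
  shows "sup_norm K (\<lambda>p. z * f p) = cmod z * sup_norm K f"
proof (rule antisym)
  show "sup_norm K (\<lambda>p. z * f p) \<le> cmod z * sup_norm K f"
    by (intro sup_norm_le) (simp add: norm_mult mult_left_mono cmod_le_sup_norm[OF assms])
  show "cmod z * sup_norm K f \<le> sup_norm K (\<lambda>p. z * f p)"
  proof (cases "z = 0")
    case True
    then show ?thesis using nonempty by (simp add: sup_norm_def)
  next
    case False
    have zf: "(\<lambda>p. z * f p) \<in> continuous_functions K"
      using assms by (auto simp: continuous_functions_def intro!: continuous_intros)
    have "sup_norm K f \<le> sup_norm K (\<lambda>p. z * f p) / cmod z"
      using cmod_le_sup_norm[OF zf] False
      by (intro sup_norm_le) (simp add: pos_le_divide_eq norm_mult mult.commute)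
    then show ?thesis using False by (simp add: pos_le_divide_eq mult.commute)
  qed
qed

lemma D_metric: "Metric_space (carrier D) (\<lambda>x y. cnorm D (x \<ominus>\<^bsub>D\<^esub> y))"
proof
  have diff: "(\<lambda>p. dec x p - dec y p) \<in> continuous_functions K" for x y
    by (auto simp: continuous_functions_def dec_outside intro!: continuous_intros continuous_on_dec)
  fix x y
  show "0 \<le> cnorm D (x \<ominus>\<^bsub>D\<^esub> y)"
    unfolding D_simps D_minus by (rule sup_norm_nonneg[OF diff])
  show "cnorm D (x \<ominus>\<^bsub>D\<^esub> y) = cnorm D (y \<ominus>\<^bsub>D\<^esub> x)"
    unfolding D_simps D_minus sup_norm_def by (simp add: norm_minus_commute)
  assume x: "x \<in> carrier D" and y: "y \<in> carrier D"
  show "(cnorm D (x \<ominus>\<^bsub>D\<^esub> y) = 0) = (x = y)"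
  proof
    assume 0: "cnorm D (x \<ominus>\<^bsub>D\<^esub> y) = 0"
    have "dec x p = dec y p" for p
      using cmod_le_sup_norm[OF diff[of x y], of p] 0 unfolding D_simps D_minus
      by (cases "p \<in> K") (auto simp: dec_outside)
    then show "x = y" using x y by (intro dec_eqI ext)
  next
    assume "x = y"
    then show "cnorm D (x \<ominus>\<^bsub>D\<^esub> y) = 0"
      unfolding D_simps D_minus sup_norm_def using nonempty by simp
  qed
  fix z
  show "cnorm D (x \<ominus>\<^bsub>D\<^esub> z) \<le> cnorm D (x \<ominus>\<^bsub>D\<^esub> y) + cnorm D (y \<ominus>\<^bsub>D\<^esub> z)"
    using sup_norm_triangle[OF diff[of x y] diff[of y z]] unfolding D_simps D_minus by simp
qed

text \<open>Uniform limits of continuous functions are continuous.\<close>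

lemma D_complete: "Metric_space.mcomplete (carrier D) (\<lambda>x y. cnorm D (x \<ominus>\<^bsub>D\<^esub> y))"
proof -
  interpret Metric_space "carrier D" "\<lambda>x y. cnorm D (x \<ominus>\<^bsub>D\<^esub> y)" by (rule D_metric)
  show ?thesis
    unfolding mcomplete_def
  proof (intro allI impI)
    fix s assume s: "MCauchy s"
    have diff: "(\<lambda>p. dec x p - dec y p) \<in> continuous_functions K" for x y
      by (auto simp: continuous_functions_def dec_outside intro!: continuous_intros continuous_on_dec)
    have "uniformly_Cauchy_on K (\<lambda>n. dec (s n))"
      unfolding uniformly_Cauchy_on_def
    proof (intro allI impI)
      fix e :: real assume "e > 0"
      then obtain N where N: "\<And>n n'. N \<le> n \<Longrightarrow> N \<le> n' \<Longrightarrow> cnorm D (s n \<ominus>\<^bsub>D\<^esub> s n') < e"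
        using s unfolding MCauchy_def by blast
      have "dist (dec (s m) p) (dec (s n) p) < e" if "p \<in> K" "m \<ge> N" "n \<ge> N" for p m n
        using cmod_le_sup_norm[OF diff that(1), of "s m" "s n"] N[OF that(2,3)]
        unfolding D_simps D_minus dist_norm by linarith
      then show "\<exists>M. \<forall>p\<in>K. \<forall>m\<ge>M. \<forall>n\<ge>M. dist (dec (s m) p) (dec (s n) p) < e" by blast
    qed
    then obtain g where g: "uniform_limit K (\<lambda>n. dec (s n)) g sequentially"
      using Cauchy_uniformly_convergent unfolding uniformly_convergent_on_def by blast
    have "continuous_on K g"
      by (rule uniform_limit_theorem[OF _ g]) (auto simp: continuous_on_dec)
    then have f: "restrict0 K g \<in> continuous_functions K" by (rule restrict0_in)
    have "limitin mtopology s (\<iota> (restrict0 K g)) sequentially"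
      unfolding limit_metric_sequentially
    proof (intro conjI allI impI)
      show "\<iota> (restrict0 K g) \<in> carrier D" using f by simp
      fix e :: real assume e: "e > 0"
      then have "\<forall>\<^sub>F n in sequentially. \<forall>p\<in>K. dist (dec (s n) p) (g p) < e / 2"
        by (intro uniform_limitD[OF g]) simp
      then obtain N where N: "\<And>n p. n \<ge> N \<Longrightarrow> p \<in> K \<Longrightarrow> dist (dec (s n) p) (g p) < e / 2"
        unfolding eventually_sequentially by blast
      have "cnorm D (s n \<ominus>\<^bsub>D\<^esub> \<iota> (restrict0 K g)) < e" if "n \<ge> N" for n
      proof -
        have "cnorm D (s n \<ominus>\<^bsub>D\<^esub> \<iota> (restrict0 K g)) \<le> e / 2"
          unfolding D_simps D_minus dec_\<iota>[OF f]
          using N[OF that] by (intro sup_norm_le) (auto simp: restrict0_def dist_norm intro: less_imp_le)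
        then show ?thesis using e by linarith
      qed
      moreover have "s n \<in> carrier D" for n using s unfolding MCauchy_def by blast
      ultimately show "\<exists>N. \<forall>n\<ge>N. s n \<in> carrier D \<and> cnorm D (s n \<ominus>\<^bsub>D\<^esub> \<iota> (restrict0 K g)) < e" by blast
    qed
    then show "\<exists>x. limitin mtopology s x sequentially" by blast
  qed
qed

lemma unital_cstar_algebra_D: "unital_cstar_algebra D"
proof (intro unital_cstar_algebra.intro unital_cstar_algebra_axioms.intro ring_D D_complete)
  show "\<one>\<^bsub>D\<^esub> \<noteq> \<zero>\<^bsub>D\<^esub>"
  proof
    assume "\<one>\<^bsub>D\<^esub> = \<zero>\<^bsub>D\<^esub>"
    then have "dec \<one>\<^bsub>D\<^esub> = dec \<zero>\<^bsub>D\<^esub>" by simp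
    then have "restrict0 K (\<lambda>_. 1) = (\<lambda>_. 0)" by (simp only: D_simps)
    moreover obtain p where "p \<in> K" using nonempty by blast
    ultimately show False by (auto simp: restrict0_def fun_eq_iff split: if_splits)
  qed
next
  fix x assume x: "x \<in> carrier D"
  show "0 \<le> cnorm D x" unfolding D_simps by (rule sup_norm_nonneg) simp
  show "cnorm D x = 0 \<longleftrightarrow> x = \<zero>\<^bsub>D\<^esub>"
  proof
    assume 0: "cnorm D x = 0"
    have "dec x p = 0" for p
      using cmod_le_sup_norm[OF dec_in, of p x] 0 unfolding D_simps
      by (cases "p \<in> K") (auto simp: dec_outside)
    then show "x = \<zero>\<^bsub>D\<^esub>" using x by (intro dec_eqI D_closed) (auto simp: D_simps)
  next
    assume "x = \<zero>\<^bsub>D\<^esub>"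
    then show "cnorm D x = 0" using nonempty by (simp add: D_simps sup_norm_def)
  qed
  show "cnorm D (cscale D z x) = cmod z * cnorm D x" for z
    unfolding D_simps by (rule sup_norm_scale) simp
  show "cnorm D (cstar D x \<otimes>\<^bsub>D\<^esub> x) = (cnorm D x)\<^sup>2"
    unfolding D_simps
  proof (rule antisym)
    show "sup_norm K (\<lambda>p. cnj (dec x p) * dec x p) \<le> (sup_norm K (dec x))\<^sup>2"
      by (intro sup_norm_le) 
        (auto simp: norm_mult power2_eq_square intro!: mult_mono cmod_le_sup_norm sup_norm_nonneg)
    have f: "(\<lambda>p. cnj (dec x p) * dec x p) \<in> continuous_functions K"
      by (auto simp: continuous_functions_def dec_outside intro!: continuous_intros continuous_on_dec)
    have "sup_norm K (dec x) \<le> sqrt (sup_norm K (\<lambda>p. cnj (dec x p) * dec x p))"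
      using cmod_le_sup_norm[OF f]
      by (intro sup_norm_le real_le_rsqrt) (simp add: norm_mult power2_eq_square)
    then show "(sup_norm K (dec x))\<^sup>2 \<le> sup_norm K (\<lambda>p. cnj (dec x p) * dec x p)"
      using sup_norm_nonneg[OF f] sup_norm_nonneg[OF dec_in[of x]]
      by (metis power_mono real_sqrt_pow2)
  qed
  fix y assume y: "y \<in> carrier D"
  show "cnorm D (x \<oplus>\<^bsub>D\<^esub> y) \<le> cnorm D x + cnorm D y"
    unfolding D_simps by (rule sup_norm_triangle) simp_all
  show "cnorm D (x \<otimes>\<^bsub>D\<^esub> y) \<le> cnorm D x * cnorm D y"
    unfolding D_simps
    by (intro sup_norm_le) (auto simp: norm_mult intro!: mult_mono cmod_le_sup_norm sup_norm_nonneg)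
qed (auto intro!: dec_eqI D_closed simp: D_simps algebra_simps)

lemma character_evaluation: "p \<in> K \<Longrightarrow> character D (\<lambda>x. dec x p)"
  by (simp add: character_def D_simps restrict0_def)

text \<open>After rescaling to \<open>\<bar>a\<bar> \<le> 1\<close>, the function \<open>b = (1 - \<bar>a\<bar>\<^sup>2)\<^sup>1\<^sup>/\<^sup>2\<close> is continuous and solves
\<open>a\<^sup>*a + b\<^sup>*b = 1\<close>.\<close>

lemma tensor_factor_D: "tensor_factor D"
proof (rule unital_cstar_algebra.tensor_factorI[OF unital_cstar_algebra_D])
  fix x assume x: "x \<in> carrier D"
  \<comment> \<open>The summand 1 keeps the scaling factor invertible when \<open>x = 0\<close>.\<close>
  define s where "s = sup_norm K (dec x) + 1"
  have s: "s > 0" using sup_norm_nonneg[OF dec_in, of x] by (simp add: s_def)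
  define a where "a = cscale D (of_real (1 / s)) x"
  define b where "b = \<iota> (restrict0 K (\<lambda>p. of_real (sqrt (1 - (cmod (dec a p))\<^sup>2))))"
  have cb: "restrict0 K (\<lambda>p. of_real (sqrt (1 - (cmod (dec a p))\<^sup>2))) \<in> continuous_functions K"
    by (intro restrict0_in continuous_intros continuous_on_dec)
  have a1: "(cmod (dec a p))\<^sup>2 \<le> 1" if "p \<in> K" for p
  proof -
    have "cmod (dec x p) \<le> s"
      using cmod_le_sup_norm[OF dec_in that, of x] by (simp add: s_def)
    then have "cmod (dec a p) \<le> 1"
      using s by (simp add: a_def D_simps norm_mult norm_divide)
    then show ?thesis by (simp add: power_le_one)
  qed
  have ab: "a \<in> carrier D" "b \<in> carrier D" using cb by (auto simp: a_def b_def D_closed)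
  have sum: "cstar D a \<otimes>\<^bsub>D\<^esub> a \<oplus>\<^bsub>D\<^esub> cstar D b \<otimes>\<^bsub>D\<^esub> b = \<one>\<^bsub>D\<^esub>"
  proof (intro dec_eqI D_closed ext)
    fix p
    show "dec (cstar D a \<otimes>\<^bsub>D\<^esub> a \<oplus>\<^bsub>D\<^esub> cstar D b \<otimes>\<^bsub>D\<^esub> b) p = dec \<one>\<^bsub>D\<^esub> p"
    proof (cases "p \<in> K")
      case True
      have "cnj (dec a p) * dec a p = of_real ((cmod (dec a p))\<^sup>2)"
        by (simp add: complex_norm_square mult.commute del: of_real_power)
      moreover have "cnj (dec b p) * dec b p = of_real (1 - (cmod (dec a p))\<^sup>2)"
        using a1[OF True] True cb by (simp add: b_def restrict0_def flip: of_real_mult)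
      ultimately show ?thesis using True by (simp add: D_simps restrict0_def)
    qed (simp add: D_simps restrict0_def dec_outside)
  qed
  show "rep_bounded D x"
  proof (rule rep_boundedI)
    fix \<pi> :: "'c \<Rightarrow> 'c op" assume \<pi>: "star_representation D \<pi>"
    have "op_bound (\<pi> a) 1"
      by (rule star_representation_contraction[OF \<pi> ab D_closed(3) _ _ _ _ _ _ sum])
        (auto intro!: dec_eqI D_closed simp: D_simps restrict0_def)
    then have "op_bound (op_scale (of_real s) (\<pi> a)) (cmod (of_real s) * 1)" by (rule op_bound_scale)
    moreover have "op_scale (of_real s) (\<pi> a) = \<pi> x"
      using s star_representationD(4)[OF \<pi> x] by (simp add: a_def op_scale_def)
    ultimately show "op_bound (\<pi> x) (cmod (of_real s) * 1)" by simp
  qed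
qed

end

text \<open>A continuous function on \<open>K\<close> is coded by the set of pairs \<open>(t, V)\<close> with \<open>f t \<in> V\<close>, where \<open>t\<close>
  ranges over a countable dense set and \<open>V\<close> over a countable base; so there are at most
  continuum many.\<close>

lemma continuous_functions_inject_reals:
  fixes K :: "'k::{metric_space, second_countable_topology} set"
  assumes "closed K"
  shows "\<exists>g :: ('k \<Rightarrow> complex) \<Rightarrow> real. inj_on g (continuous_functions K)"
proof -
  obtain T where T: "countable T" "T \<subseteq> K" "K \<subseteq> closure T"
    by (rule separable)
  obtain \<B> :: "complex set set" where \<B>: "countable \<B>" "topological_basis \<B>"
    using ex_countable_basis by blast
  define code where "code f = {(t, V). t \<in> T \<and> V \<in> \<B> \<and> f t \<in> V}" for f :: "'k \<Rightarrow> complex"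
  have code_inj: "inj_on code (continuous_functions K)"
  proof (rule inj_onI)
    fix f g assume f: "f \<in> continuous_functions K" and g: "g \<in> continuous_functions K"
      and eq: "code f = code g"
    have "f t = g t" if t: "t \<in> T" for t
    proof (rule ccontr)
      assume "f t \<noteq> g t"
      then obtain U where "open U" "f t \<in> U" "g t \<notin> U" using t1_space by blast
      then obtain V where "V \<in> \<B>" "f t \<in> V" "g t \<notin> V"
        using topological_basisE[OF \<B>(2)] by (metis subsetD)
      then have "(t, V) \<in> code f" "(t, V) \<notin> code g" using t by (auto simp: code_def)
      then show False using eq by simp
    qed
    then have "T \<subseteq> {p \<in> K. f p - g p = 0}" using T(2) by auto
    moreover have "closed {p \<in> K. f p - g p = 0}"
      using f g assms
      by (intro continuous_closed_preimage_constant continuous_intros) (auto simp: continuous_functions_def)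
    ultimately have "K \<subseteq> {p \<in> K. f p - g p = 0}" using closure_minimal T(3) by blast
    then have "f p = g p" for p
      using f g by (cases "p \<in> K") (auto simp: continuous_functions_def)
    then show "f = g" by (rule ext)
  qed
  have cnt: "countable (T \<times> \<B>)" using T(1) \<B>(1) by (rule countable_SIGMA)
  let ?n = "to_nat_on (T \<times> \<B>)"
  have sub: "code f \<subseteq> T \<times> \<B>" for f by (auto simp: code_def)
  have n_inj: "inj_on ((`) ?n) (Pow (T \<times> \<B>))"
    by (rule inj_on_image_Pow[OF inj_on_to_nat_on[OF cnt]])
  obtain h :: "nat set \<Rightarrow> real" where h: "inj h"
    using nat_sets_eqpoll_reals unfolding eqpoll_def bij_betw_def by blast
  have "inj_on (\<lambda>f. h (?n ` code f)) (continuous_functions K)"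
  proof (rule inj_onI)
    fix f g assume fg: "f \<in> continuous_functions K" "g \<in> continuous_functions K"
      and "h (?n ` code f) = h (?n ` code g)"
    then have "?n ` code f = ?n ` code g" using h by (simp add: inj_eq)
    then have "code f = code g" using sub inj_onD[OF n_inj] by (metis PowI)
    then show "f = g" using fg inj_onD[OF code_inj] by blast
  qed
  then show ?thesis by (rule exI[where x = "\<lambda>f. h (?n ` code f)"])
qed

lemma (in unital_cstar_algebra) inj_scalars: "inj (\<lambda>z. cscale A z \<one>)"
proof (rule injI)
  fix z w assume eq: "cscale A z \<one> = cscale A w \<one>"
  have "cscale A (z - w) \<one> = cscale A z \<one> \<oplus> cscale A (- w) \<one>"
    using cscale_add_left[OF one_closed, of z "- w"] by simp
  also have "\<dots> = cscale A (w - w) \<one>"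
    using cscale_add_left[OF one_closed, of w "- w"] eq by simp
  finally have "cnorm A (cscale A (z - w) \<one>) = cnorm A (cscale A (w - w) \<one>)" by simp
  then have "cmod (z - w) * cnorm A \<one> = 0"
    using cnorm_cscale[OF one_closed] by simp
  then show "z = w" using cnorm_eq_zero[OF one_closed] one_not_zero by simp
qed

text \<open>The carrier of \<open>A\<close> contains the scalars, hence continuum many elements.\<close>

lemma (in unital_cstar_algebra) continuous_functions_inject:
  fixes K :: "'k::{metric_space, second_countable_topology} set"
  assumes "closed K"
  shows "\<exists>g :: ('k \<Rightarrow> complex) \<Rightarrow> 'a. inj_on g (continuous_functions K)"
proof -
  obtain g :: "('k \<Rightarrow> complex) \<Rightarrow> real" where g: "inj_on g (continuous_functions K)"
    using continuous_functions_inject_reals[OF assms] by blast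
  have "inj_on (\<lambda>f. cscale A (of_real (g f)) \<one>) (continuous_functions K)"
  proof (rule inj_onI)
    fix f f' assume f: "f \<in> continuous_functions K" "f' \<in> continuous_functions K"
      and "cscale A (of_real (g f)) \<one> = cscale A (of_real (g f')) \<one>"
    then have "g f = g f'" using injD[OF inj_scalars] by (metis of_real_eq_iff)
    then show "f = f'" using inj_onD[OF g] f by blast
  qed
  then show ?thesis by (rule exI[where x = "\<lambda>f. cscale A (of_real (g f)) \<one>"])
qed

section \<open>Homomorphisms given by projections over an algebra\<close>

lemma op_mult_sum_left:
  assumes "\<And>i. i \<in> S \<Longrightarrow> bounded_op (m i)" "bounded_op n"
  shows "op_mult (\<lambda>p q. \<Sum>i\<in>S. m i p q) n = (\<lambda>p q. \<Sum>i\<in>S. op_mult (m i) n p q)"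
proof (intro ext)
  fix p q
  have "((\<lambda>j. m i p j * n j q) has_sum op_mult (m i) n p q) UNIV" if "i \<in> S" for i
    using op_mult_has_sum[OF op_bound_op_norm[OF assms(1)[OF that]] op_bound_op_norm[OF assms(2)]] .
  then have "((\<lambda>j. \<Sum>i\<in>S. m i p j * n j q) has_sum (\<Sum>i\<in>S. op_mult (m i) n p q)) UNIV"
    by (rule has_sum_finite_sum)
  then show "op_mult (\<lambda>p q. \<Sum>i\<in>S. m i p q) n p q = (\<Sum>i\<in>S. op_mult (m i) n p q)"
    unfolding op_mult_def by (simp add: sum_distrib_right infsumI)
qed

lemma op_mult_sum_right:
  assumes "\<And>i. i \<in> S \<Longrightarrow> bounded_op (m i)" "bounded_op n"
  shows "op_mult n (\<lambda>p q. \<Sum>i\<in>S. m i p q) = (\<lambda>p q. \<Sum>i\<in>S. op_mult n (m i) p q)"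
proof (intro ext)
  fix p q
  have "((\<lambda>j. n p j * m i j q) has_sum op_mult n (m i) p q) UNIV" if "i \<in> S" for i
    using op_mult_has_sum[OF op_bound_op_norm[OF assms(2)] op_bound_op_norm[OF assms(1)[OF that]]] .
  then have "((\<lambda>j. \<Sum>i\<in>S. n p j * m i j q) has_sum (\<Sum>i\<in>S. op_mult n (m i) p q)) UNIV"
    by (rule has_sum_finite_sum)
  then show "op_mult n (\<lambda>p q. \<Sum>i\<in>S. m i p q) p q = (\<Sum>i\<in>S. op_mult n (m i) p q)"
    unfolding op_mult_def by (simp add: sum_distrib_left infsumI)
qed

text \<open>The isomorphism \<open>M\<^sub>2(D) \<cong> M\<^sub>2(\<complex>) \<otimes> D\<close>. A projection in \<open>M\<^sub>2(D)\<close> becomes a projection in the tensor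
product, which is the same as a unital homomorphism from \<open>\<complex>\<^sup>2\<close>.\<close>

definition matrix_tensor :: "'c cstar_alg \<Rightarrow> (2 \<Rightarrow> 2 \<Rightarrow> 'c) \<Rightarrow> (complex^2^2, 'c) tensor" where
  "matrix_tensor D f = (\<lambda>r p q. \<Sum>(i, j)\<in>UNIV. elem_tensor M2 D (matrix_unit i j) (f i j) r p q)"

lemma UNIV_22: "(UNIV :: (2 \<times> 2) set) = {(1, 1), (1, 2), (2, 1), (2, 2)}"
  unfolding UNIV_Times_UNIV[symmetric] UNIV_2 by auto

lemma elem_tensor_zero_left: "elem_tensor M2 D 0 d r = op_zero"
proof (cases r)
  case (Pair \<pi> \<sigma>)
  show ?thesis
  proof (cases "r \<in> rep_pairs M2 D")
    case True
    then have "star_representation M2 \<pi>" by (simp add: Pair rep_pairs_iff)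
    then have "\<pi> 0 = op_zero"
      using M2_representation_expansion[of \<pi> 0] by (auto simp: op_zero_def)
    then show ?thesis by (simp add: Pair elem_tensor_def op_tensor_def op_zero_def fun_eq_iff)
  qed (simp add: elem_tensor_outside)
qed

context unital_cstar_algebra
begin

lemma elem_tensor_add_right:
  assumes "d \<in> carrier A" "d' \<in> carrier A"
  shows "elem_tensor M2 A m (d \<oplus> d') r p q = elem_tensor M2 A m d r p q + elem_tensor M2 A m d' r p q"
proof (cases r)
  case (Pair \<pi> \<sigma>)
  show ?thesis
    using assms by (cases p; cases q)
      (auto simp: Pair elem_tensor_def rep_pairs_iff star_representationD op_add_def op_tensor_def
        op_zero_def distrib_left)
qed

lemma elem_tensor_adjoint:
  assumes "d \<in> carrier A"
  shows "op_adjoint (elem_tensor M2 A m d r) = elem_tensor M2 A (cstar M2 m) (cstar A d) r"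
proof (cases r)
  case (Pair \<pi> \<sigma>)
  have "star_representation M2 \<pi> \<Longrightarrow> \<pi> (cstar M2 m) = op_adjoint (\<pi> m)"
    using star_representationD(5)[of M2 \<pi> m] by simp
  then show ?thesis
    using assms
    by (auto simp: Pair elem_tensor_def rep_pairs_iff star_representationD op_tensor_def
        op_adjoint_def op_zero_def simp del: M2_simps(7) intro!: ext)
qed

lemma matrix_tensor_in: 
  assumes f: "\<And>i j. f i j \<in> carrier A"
  shows "matrix_tensor A f \<in> alg_tensor M2 A"
proof -
  have "matrix_tensor A f = (\<lambda>r. op_add (op_add (elem_tensor M2 A (matrix_unit 1 1) (f 1 1) r)
      (elem_tensor M2 A (matrix_unit 1 2) (f 1 2) r)) (op_add (elem_tensor M2 A (matrix_unit 2 1) (f 2 1) r)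
      (elem_tensor M2 A (matrix_unit 2 2) (f 2 2) r)))"
    by (simp add: matrix_tensor_def op_add_def UNIV_22 add.assoc)
  then show ?thesis
    using f by (simp add: alg_tensor_add elem_in_alg_tensor)
qed

lemma matrix_tensor_idem:
  assumes f: "\<And>i j. f i j \<in> carrier A"
    and idem: "\<And>i j. (f i 1 \<otimes> f 1 j) \<oplus> (f i 2 \<otimes> f 2 j) = f i j"
  shows "op_mult (matrix_tensor A f r) (matrix_tensor A f r) = matrix_tensor A f r"
proof -
  let ?e = "\<lambda>p. elem_tensor M2 A (matrix_unit (fst p) (snd p)) (f (fst p) (snd p)) r"
  have X: "matrix_tensor A f r = (\<lambda>p q. \<Sum>i\<in>UNIV. ?e i p q)"
    by (simp add: matrix_tensor_def case_prod_unfold)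
  have b: "bounded_op (?e p)" for p
    by (rule elem_tensor_bounded_op) (simp_all add: f)
  have bX: "bounded_op (\<lambda>p q. \<Sum>i\<in>UNIV. ?e i p q)"
    using alg_tensor_bounded_op[OF matrix_tensor_in[of f, OF f], where p = r] unfolding X .
  have mult: "op_mult (?e p) (?e q) = elem_tensor M2 A (matrix_unit (fst p) (snd p) ** matrix_unit (fst q) (snd q))
      (f (fst p) (snd p) \<otimes> f (fst q) (snd q)) r" for p q
    using elem_tensor_mult[of "matrix_unit (fst p) (snd p)" M2 "f (fst p) (snd p)" A
      "matrix_unit (fst q) (snd q)" "f (fst q) (snd q)" r] f by simp
  have "op_mult (matrix_tensor A f r) (matrix_tensor A f r)
     = (\<lambda>p q. \<Sum>i\<in>UNIV. \<Sum>j\<in>UNIV. op_mult (?e i) (?e j) p q)"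
    unfolding X by (subst op_mult_sum_left[OF b bX]) (simp only: op_mult_sum_right[OF b b])
  also have "\<dots> = matrix_tensor A f r"
  proof (intro ext)
    fix p q
    have e: "elem_tensor M2 A (matrix_unit i j) (f i j) r p q
      = elem_tensor M2 A (matrix_unit i j) (f i 1 \<otimes> f 1 j) r p q
        + elem_tensor M2 A (matrix_unit i j) (f i 2 \<otimes> f 2 j) r p q" for i j
      using elem_tensor_add_right[of "f i 1 \<otimes> f 1 j" "f i 2 \<otimes> f 2 j" "matrix_unit i j" r p q] f
      by (simp add: idem)
    show "(\<Sum>i\<in>UNIV. \<Sum>j\<in>UNIV. op_mult (?e i) (?e j) p q) = matrix_tensor A f r p q"
      unfolding mult matrix_tensor_def
      by (simp add: UNIV_22 matrix_unit_mult elem_tensor_zero_left op_zero_def e)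
  qed
  finally show ?thesis .
qed

lemma matrix_tensor_adjoint:
  assumes f: "\<And>i j. f i j \<in> carrier A" and adj: "\<And>i j. cstar A (f i j) = f j i"
  shows "op_adjoint (matrix_tensor A f r) = matrix_tensor A f r"
proof (intro ext)
  fix p q
  have "cnj (elem_tensor M2 A (matrix_unit i j) (f i j) r q p) = elem_tensor M2 A (matrix_unit j i) (f j i) r p q" for i j
    using fun_cong[OF fun_cong[OF elem_tensor_adjoint[OF f[of i j], of "matrix_unit i j" r]], of p q]
    by (simp add: op_adjoint_def matrix_unit_star adj del: M2_simps(7))
  then show "op_adjoint (matrix_tensor A f r) p q = matrix_tensor A f r p q"
    by (simp add: op_adjoint_def matrix_tensor_def UNIV_22 add_ac)
qed

definition projection_hom :: "(2 \<Rightarrow> 2 \<Rightarrow> 'a) \<Rightarrow> complex^2 \<Rightarrow> (complex^2^2, 'a) tensor" where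
  "projection_hom f a = (\<lambda>r. op_add (op_scale (a $ 1 - a $ 2) (matrix_tensor A f r))
     (op_scale (a $ 2) (elem_tensor M2 A (mat 1) \<one> r)))"

lemma unital_star_hom_projection:
  assumes f: "\<And>i j. f i j \<in> carrier A"
    and idem: "\<And>i j. (f i 1 \<otimes> f 1 j) \<oplus> (f i 2 \<otimes> f 2 j) = f i j"
    and adj: "\<And>i j. cstar A (f i j) = f j i"
  shows "unital_star_hom C2 (min_tensor M2 A) (projection_hom f)"
proof -
  let ?X = "matrix_tensor A f" and ?E = "elem_tensor M2 A (mat 1) \<one>"
  have XX: "op_mult (?X r) (?X r) = ?X r" for r by (rule matrix_tensor_idem[of f, OF f idem])
  have EE: "op_mult (?E r) (?E r) = ?E r" for r
    using elem_tensor_mult[of "mat 1" M2 "\<one>" A "mat 1" "\<one>" r] by simp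
  have e1: "op_mult (elem_tensor M2 A m d r) (?E r) = elem_tensor M2 A m d r" if "d \<in> carrier A" for m d r
    using elem_tensor_mult[of m M2 d A "mat 1" "\<one>" r] that by simp
  have e2: "op_mult (?E r) (elem_tensor M2 A m d r) = elem_tensor M2 A m d r" if "d \<in> carrier A" for m d r
    using elem_tensor_mult[of "mat 1" M2 "\<one>" A m d r] that by simp
  have bX: "bounded_op (?X r)" for r by (rule alg_tensor_bounded_op[OF matrix_tensor_in[of f, OF f]])
  have be: "bounded_op (elem_tensor M2 A m d r)" if "d \<in> carrier A" for m d r
    using elem_tensor_bounded_op[of m M2 d A r] that by simp
  have bE: "bounded_op (?E r)" for r by (rule be) simp
  have XE: "op_mult (?X r) (?E r) = ?X r" for r
    unfolding matrix_tensor_def case_prod_unfold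
    by (subst op_mult_sum_left) (simp_all add: be bE e1 f)
  have EX: "op_mult (?E r) (?X r) = ?X r" for r
    unfolding matrix_tensor_def case_prod_unfold
    by (subst op_mult_sum_right) (simp_all add: be bE e2 f)
  have Xs: "op_adjoint (?X r) = ?X r" for r by (rule matrix_tensor_adjoint[of f, OF f adj])
  have "cstar M2 (mat 1) = mat 1" by (auto simp: mat_def vec_eq_iff)
  then have Es: "op_adjoint (?E r) = ?E r" for r
    unfolding elem_tensor_adjoint[OF one_closed] cstar_one by simp
  show ?thesis
  proof (rule unital_star_homI)
    fix a b :: "complex^2"
    show "projection_hom f a \<in> carrier (min_tensor M2 A)"
      unfolding projection_hom_def
      by (intro alg_tensor_subset alg_tensor_add alg_tensor_scale matrix_tensor_in f elem_in_alg_tensor) simp_all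
    show "projection_hom f (a \<otimes>\<^bsub>C2\<^esub> b) = projection_hom f a \<otimes>\<^bsub>min_tensor M2 A\<^esub> projection_hom f b"
      unfolding min_tensor_simps projection_hom_def
    proof
      fix r
      show "op_add (op_scale ((a \<otimes>\<^bsub>C2\<^esub> b) $ 1 - (a \<otimes>\<^bsub>C2\<^esub> b) $ 2) (?X r)) (op_scale ((a \<otimes>\<^bsub>C2\<^esub> b) $ 2) (?E r)) =
        op_mult (op_add (op_scale (a $ 1 - a $ 2) (?X r)) (op_scale (a $ 2) (?E r)))
          (op_add (op_scale (b $ 1 - b $ 2) (?X r)) (op_scale (b $ 2) (?E r)))"
        by (simp add: op_mult_add_left op_mult_add_right bX bE op_mult_scale_left op_mult_scale_right XX XE EX EE)
          (auto simp: op_add_def op_scale_def algebra_simps intro!: ext)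
    qed
    show "projection_hom f (a \<oplus>\<^bsub>C2\<^esub> b) = projection_hom f a \<oplus>\<^bsub>min_tensor M2 A\<^esub> projection_hom f b"
      by (auto simp: min_tensor_simps projection_hom_def op_add_def op_scale_def algebra_simps intro!: ext)
    show "projection_hom f (cscale C2 z a) = cscale (min_tensor M2 A) z (projection_hom f a)" for z
      by (auto simp: min_tensor_simps projection_hom_def op_add_def op_scale_def algebra_simps intro!: ext)
    show "projection_hom f (cstar C2 a) = cstar (min_tensor M2 A) (projection_hom f a)"
    proof -
      have "op_adjoint (op_add (op_scale z (?X r)) (op_scale w (?E r)))
         = op_add (op_scale (cnj z) (?X r)) (op_scale (cnj w) (?E r))" for z w r
        by (subst (2) Xs[symmetric], subst (2) Es[symmetric]) (simp add: op_adjoint_def op_add_def op_scale_def)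
      then show ?thesis by (simp add: min_tensor_simps projection_hom_def)
    qed
  qed (auto simp: min_tensor_simps projection_hom_def op_add_def op_scale_def)
qed

end

section \<open>The continuous family of characters over the projections\<close>

text \<open>The Bloch parametrisation of the rank-one projections in \<open>M\<^sub>2(\<complex>)\<close> by the unit sphere of \<open>\<complex> \<times> \<real>\<close>.\<close>

definition bloch :: "complex \<times> real \<Rightarrow> complex^2^2" where
  "bloch x = (\<chi> i j. if i = 1
     then (if j = 1 then of_real ((1 + snd x) / 2) else fst x / 2)
     else (if j = 1 then cnj (fst x) / 2 else of_real ((1 - snd x) / 2)))"

lemma bloch_simps [simp]:
  "bloch x $ 1 $ 1 = of_real ((1 + snd x) / 2)" "bloch x $ 1 $ 2 = fst x / 2"
  "bloch x $ 2 $ 1 = cnj (fst x) / 2" "bloch x $ 2 $ 2 = of_real ((1 - snd x) / 2)"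
  by (simp_all add: bloch_def)

abbreviation two_sphere :: "(complex \<times> real) set" where
  "two_sphere \<equiv> sphere 0 1"

lemma in_two_sphere: "x \<in> two_sphere \<longleftrightarrow> (cmod (fst x))\<^sup>2 + (snd x)\<^sup>2 = 1"
  by (simp add: norm_prod_def)

lemma M2_entries_eq_iff: "M2_entries P = M2_entries R \<longleftrightarrow> P = R"
  by (auto simp: M2_entries_def fun_eq_iff vec_eq_iff)

lemma bloch_inject: "bloch x = bloch y \<Longrightarrow> x = y"
proof (rule prod_eqI)
  assume eq: "bloch x = bloch y"
  show "fst x = fst y" using arg_cong[OF eq, of "\<lambda>P. P $ 1 $ 2"] by simp
  have "complex_of_real ((1 + snd x) / 2) = of_real ((1 + snd y) / 2)"
    using arg_cong[OF eq, of "\<lambda>P. P $ 1 $ 1"] by simp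
  then have "(1 + snd x) / 2 = (1 + snd y) / 2" by (simp only: of_real_eq_iff)
  then show "snd x = snd y" by simp
qed

lemma continuous_on_bloch: "continuous_on S bloch"
proof -
  have "continuous_on S (\<lambda>x. bloch x $ i $ j)" for i j
  proof -
    have i: "i = 1 \<or> i = 2" and j: "j = 1 \<or> j = 2" by (rule exhaust_2)+
    from i j show ?thesis
      by (elim disjE; hypsubst; unfold bloch_simps; intro continuous_intros) simp_all
  qed
  then have "continuous_on S (\<lambda>x. \<chi> i. \<chi> j. bloch x $ i $ j)"
    by (intro continuous_on_vec_lambda)
  then show ?thesis by simp
qed

text \<open>The sphere of rank-one projections and one isolated point: the contradiction will come from
  translating the latter into the sphere.\<close>

definition projections :: "(complex^2^2) set" where
  "projections = insert 0 (bloch ` two_sphere)"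

lemma compact_projections: "compact projections"
  unfolding projections_def
  by (intro compact_insert compact_continuous_image continuous_on_bloch compact_sphere)

lemma bloch_projection:
  assumes "x \<in> two_sphere"
  shows "bloch x $ i $ 1 * bloch x $ 1 $ j + bloch x $ i $ 2 * bloch x $ 2 $ j = bloch x $ i $ j"
proof -
  have "fst x * cnj (fst x) = of_real ((cmod (fst x))\<^sup>2)"
    by (simp add: complex_norm_square del: of_real_power)
  also have "(cmod (fst x))\<^sup>2 = 1 - (snd x)\<^sup>2"
    using assms unfolding in_two_sphere by simp
  finally have z: "fst x * cnj (fst x) = 1 - (of_real (snd x))\<^sup>2" by simp
  then have z': "cnj (fst x) * fst x = 1 - (of_real (snd x))\<^sup>2" by (simp only: mult.commute)
  show ?thesis
    using exhaust_2[of i] exhaust_2[of j]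
    by (auto simp: z z' field_simps power2_eq_square)
qed

lemma projections_idem:
  "P \<in> projections \<Longrightarrow> P $ i $ 1 * P $ 1 $ j + P $ i $ 2 * P $ 2 $ j = P $ i $ j"
  by (auto simp: projections_def bloch_projection)

lemma projections_adjoint: "P \<in> projections \<Longrightarrow> cnj (P $ i $ j) = P $ j $ i"
  using exhaust_2[of i] exhaust_2[of j] by (auto simp: projections_def)

lemma slice_matrix_tensor:
  assumes "character D \<kappa>"
  shows "M2_slice \<kappa> (matrix_tensor D f) k l = \<kappa> (f k l)"
proof -
  interpret slicing M2 D M2_index M2_entries \<kappa> by (rule slicing_M2[OF assms])
  have "M2_slice \<kappa> (matrix_tensor D f) k l
     = (\<Sum>(i, j)\<in>UNIV. M2_slice \<kappa> (elem_tensor M2 D (matrix_unit i j) (f i j)) k l)"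
    by (simp add: slice_def matrix_tensor_def)
  also have "\<dots> = \<kappa> (f k l)"
    using exhaust_2[of k] exhaust_2[of l]
    unfolding slice_elem by (auto simp: UNIV_22 op_scale_def M2_entries_def matrix_unit_def)
  finally show ?thesis .
qed

text \<open>The coordinate functions \<open>P \<mapsto> P\<^sub>i\<^sub>j\<close> form a tautological projection over the algebra \<open>D\<close> of continuous
functions on the compact set of projections. The universal property turns it into a homomorphism
\<open>\<Lambda>\<close> from \<open>C\<close> to \<open>D\<close>, and evaluation at \<open>P\<close> after \<open>\<Lambda>\<close> is a character that depends
continuously on \<open>P\<close>. Because \<open>D\<close> has uniformly bounded representations, the same \<open>\<Lambda>\<close> shows that
\<open>C\<close> has them, too.\<close>

lemma continuous_character_family:
  assumes univ: "quantum_space_of_all_maps M2 C2 C \<Phi>"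
  obtains \<kappa> where "tensor_factor C"
    and "\<And>P. P \<in> projections \<Longrightarrow> character C (\<kappa> P)"
    and "\<And>P. P \<in> projections \<Longrightarrow> M2_slice (\<kappa> P) (\<Phi> C2_unit) = M2_entries P"
    and "\<And>c. c \<in> carrier C \<Longrightarrow> continuous_on projections (\<lambda>P. \<kappa> P c)"
proof -
  have Cstar: "unital_cstar_algebra C" and \<Phi>: "unital_star_hom C2 (min_tensor M2 C) \<Phi>"
    using univ by (auto simp: quantum_space_of_all_maps_def)
  interpret C: unital_cstar_algebra C by (rule Cstar)
  obtain \<iota> :: "(complex^2^2 \<Rightarrow> complex) \<Rightarrow> 'a" where \<iota>: "inj_on \<iota> (continuous_functions projections)"
    using C.continuous_functions_inject[OF compact_imp_closed[OF compact_projections]] by blast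
  interpret function_model projections \<iota>
    using compact_projections \<iota> by unfold_locales (auto simp: projections_def)
  interpret D: unital_cstar_algebra D by (rule unital_cstar_algebra_D)
  define f where "f i j = \<iota> (restrict0 projections (\<lambda>P. P $ i $ j))" for i j
  have fc: "restrict0 projections (\<lambda>P. P $ i $ j) \<in> continuous_functions projections" for i j
    by (intro restrict0_in continuous_intros)
  have f_in: "f i j \<in> carrier D" for i j unfolding f_def using fc by simp
  have dec_f: "dec (f i j) = restrict0 projections (\<lambda>P. P $ i $ j)" for i j
    unfolding f_def using fc by simp
  have idem: "(f i 1 \<otimes>\<^bsub>D\<^esub> f 1 j) \<oplus>\<^bsub>D\<^esub> (f i 2 \<otimes>\<^bsub>D\<^esub> f 2 j) = f i j" for i j
    by (intro dec_eqI D_closed f_in ext)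
      (simp add: D_simps dec_f restrict0_def projections_idem)
  have adj: "cstar D (f i j) = f j i" for i j
    by (intro dec_eqI D_closed f_in ext)
      (simp add: D_simps dec_f restrict0_def projections_adjoint)
  have \<Psi>: "unital_star_hom C2 (min_tensor M2 D) (D.projection_hom f)"
    by (rule D.unital_star_hom_projection[of f, OF f_in idem adj])
  obtain \<Lambda> F where \<Lambda>: "unital_star_hom C D \<Lambda>" and F: "is_tensor_hom M2 C M2 D (\<lambda>b. b) \<Lambda> F"
    and F\<Phi>: "\<And>a. F (\<Phi> a) = D.projection_hom f a"
    using universal_property[OF univ unital_cstar_algebra_D \<Psi>] by (auto elim!: ex1E)
  have ev: "character D (\<lambda>x. dec x P)" if "P \<in> projections" for P
    using that by (rule character_evaluation)
  have "0 \<in> projections" by (simp add: projections_def)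
  then have tf: "tensor_factor C"
    by (rule tensor_factor_of_contraction[OF Cstar tensor_factor_D \<Lambda> ev F])
  show thesis
  proof (rule that[OF tf])
    fix P assume P: "P \<in> projections"
    show "character C (\<lambda>c. dec (\<Lambda> c) P)" by (rule character_compose[OF \<Lambda> ev[OF P]])
    have "M2_slice (\<lambda>c. dec (\<Lambda> c) P) (\<Phi> C2_unit) = M2_slice (\<lambda>x. dec x P) (F (\<Phi> C2_unit))"
      using unital_star_homD(1)[OF \<Phi>]
      by (intro M2_slice_tensor_hom[OF F \<Lambda> ev[OF P] tf tensor_factor_D, symmetric]) simp
    also have "F (\<Phi> C2_unit) = matrix_tensor D f"
      by (simp add: F\<Phi> D.projection_hom_def C2_unit_def op_add_def op_scale_def)
    also have "M2_slice (\<lambda>x. dec x P) (matrix_tensor D f) = M2_entries P"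
      using P by (intro ext) (simp add: slice_matrix_tensor[OF ev[OF P]] dec_f restrict0_def M2_entries_def)
    finally show "M2_slice (\<lambda>c. dec (\<Lambda> c) P) (\<Phi> C2_unit) = M2_entries P" .
  next
    fix c show "continuous_on projections (\<lambda>P. dec (\<Lambda> c) P)" by (rule continuous_on_dec)
  qed
qed

text \<open>Elementary tensors have continuous slices, and the approximation by them is uniform over all
pairs of representations, hence over the family.\<close>

lemma continuous_on_slice:
  fixes S :: "'s::topological_space set"
  assumes sl: "\<And>s. s \<in> S \<Longrightarrow> slicing A B u (\<theta> s) (\<kappa> s)"
    and \<theta>: "\<And>a i j. a \<in> carrier A \<Longrightarrow> continuous_on S (\<lambda>s. \<theta> s a i j)"
    and \<kappa>: "\<And>b. b \<in> carrier B \<Longrightarrow> continuous_on S (\<lambda>s. \<kappa> s b)"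
    and x: "x \<in> carrier (min_tensor A B)"
  shows "continuous_on S (\<lambda>s. slice u (\<theta> s) (\<kappa> s) x i j)"
proof -
  have alg: "continuous_on S (\<lambda>s. slice u (\<theta> s) (\<kappa> s) t i j)" if "t \<in> alg_tensor A B" for t
    using that
  proof (induction rule: alg_tensor.induct)
    case zero
    then show ?case by (simp add: slice_def op_zero_def)
  next
    case (add_elem t a b)
    have "continuous_on S (\<lambda>s. slice u (\<theta> s) (\<kappa> s) (elem_tensor A B a b) i j)
       = continuous_on S (\<lambda>s. \<kappa> s b * \<theta> s a i j)"
      by (rule continuous_on_cong) (simp_all add: slicing.slice_elem[OF sl] op_scale_def)
    also have "\<dots>" using add_elem(2,3) by (intro continuous_intros \<theta> \<kappa>)
    finally show ?case
      unfolding slice_linear(1) unfolding op_add_def by (intro continuous_intros add_elem(4))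
  qed
  have "\<exists>t\<in>alg_tensor A B. \<forall>p\<in>rep_pairs A B. op_bound (op_diff (x p) (t p)) (1 / real (Suc n))" for n
    by (rule carrier_min_tensorD(2)[OF x]) simp
  then obtain t where t: "\<And>n. t n \<in> alg_tensor A B"
    "\<And>n p. p \<in> rep_pairs A B \<Longrightarrow> op_bound (op_diff (x p) (t n p)) (1 / real (Suc n))"
    by metis
  have "uniform_limit S (\<lambda>n s. slice u (\<theta> s) (\<kappa> s) (t n) i j) (\<lambda>s. slice u (\<theta> s) (\<kappa> s) x i j) sequentially"
    unfolding uniform_limit_iff
  proof (intro allI impI)
    fix e :: real assume "e > 0"
    then have "\<forall>\<^sub>F n in sequentially. 1 / real (Suc n) < e"
      using LIMSEQ_inverse_real_of_nat by (auto simp: inverse_eq_divide dest: order_tendstoD(2))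
    then show "\<forall>\<^sub>F n in sequentially. \<forall>s\<in>S. dist (slice u (\<theta> s) (\<kappa> s) (t n) i j) (slice u (\<theta> s) (\<kappa> s) x i j) < e"
    proof (rule eventually_mono, intro ballI)
      fix n s assume n: "1 / real (Suc n) < e" and s: "s \<in> S"
      have "cmod (slice u (\<theta> s) (\<kappa> s) x i j - slice u (\<theta> s) (\<kappa> s) (t n) i j) \<le> 1 / real (Suc n)"
        by (rule slicing.slice_diff_le[OF sl[OF s] t(2)])
      then show "dist (slice u (\<theta> s) (\<kappa> s) (t n) i j) (slice u (\<theta> s) (\<kappa> s) x i j) < e"
        using n by (simp add: dist_norm norm_minus_commute)
    qed
  qed
  then show ?thesis
    by (rule uniform_limit_theorem[rotated]) (simp_all add: alg[OF t(1)])
qed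

text \<open>A character is a function on the whole type, so two characters with equal values on the carrier may
give different indices of a tensor. The values there agree nevertheless, as they do for
elementary tensors.\<close>

lemma M2_slice_cong:
  assumes \<kappa>: "character C \<kappa>" and \<kappa>': "character C \<kappa>'" 
    and eq: "\<And>c. c \<in> carrier C \<Longrightarrow> \<kappa> c = \<kappa>' c"
    and x: "x \<in> carrier (min_tensor M2 C)"
  shows "M2_slice \<kappa> x = M2_slice \<kappa>' x"
proof (intro ext)
  fix i j
  interpret s: slicing M2 C M2_index M2_entries \<kappa> by (rule slicing_M2[OF \<kappa>])
  interpret s': slicing M2 C M2_index M2_entries \<kappa>' by (rule slicing_M2[OF \<kappa>'])
  let ?h = "\<lambda>x. M2_slice \<kappa> x i j - M2_slice \<kappa>' x i j"
  have "?h x = 0"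
  proof (rule min_tensor_functional_zero[OF x, where M = 2])
    show "?h (\<lambda>p. op_zero) = 0" by (simp add: slice_def)
  next
    fix t a b assume b: "b \<in> carrier C"
    show "?h (\<lambda>p. op_add (t p) (elem_tensor M2 C a b p)) = ?h t"
      unfolding slice_linear s.slice_elem s'.slice_elem eq[OF b] by (simp add: op_add_def)
  next
    fix t e assume le: "\<And>p. p \<in> rep_pairs M2 C \<Longrightarrow> op_bound (op_diff (x p) (t p)) e"
    show "cmod (?h x - ?h t) \<le> 2 * e"
      using order_trans[OF cmod_diff_diff add_mono[OF s.slice_diff_le[OF le] s'.slice_diff_le[OF le]]]
      by simp
  qed
  then show "M2_slice \<kappa> x i j = M2_slice \<kappa>' x i j" by simp
qed

section \<open>Convolution of characters\<close>

text \<open>The character \<open>\<psi> \<otimes> \<kappa>\<close>.\<close>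

definition pairing :: "('a \<Rightarrow> complex) \<Rightarrow> ('b \<Rightarrow> complex) \<Rightarrow> ('a, 'b) tensor \<Rightarrow> complex" where
  "pairing \<psi> \<kappa> x = slice (\<lambda>_::unit. undefined) (\<lambda>a _ _. \<psi> a) \<kappa> x () ()"

lemma slicing_pairing:
  "character A \<psi> \<Longrightarrow> character B \<kappa> \<Longrightarrow> slicing A B (\<lambda>_::unit. undefined) (\<lambda>a _ _. \<psi> a) \<kappa>"
  by (simp add: slicing_def star_representation_character inj_def)

lemma pairing_linear:
  "pairing \<psi> \<kappa> (\<lambda>p. op_add (x p) (y p)) = pairing \<psi> \<kappa> x + pairing \<psi> \<kappa> y"
  "pairing \<psi> \<kappa> (\<lambda>p. op_scale z (x p)) = z * pairing \<psi> \<kappa> x"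
  "pairing \<psi> \<kappa> (\<lambda>p. op_zero) = 0"
  "pairing \<psi> \<kappa> (\<lambda>p. op_adjoint (x p)) = cnj (pairing \<psi> \<kappa> x)"
  by (simp_all add: pairing_def slice_def op_add_def op_scale_def op_zero_def op_adjoint_def)

lemma pairing_elem:
  "character A \<psi> \<Longrightarrow> character B \<kappa> \<Longrightarrow> pairing \<psi> \<kappa> (elem_tensor A B a b) = \<psi> a * \<kappa> b"
  unfolding pairing_def slicing.slice_elem[OF slicing_pairing] by (simp add: op_scale_def)

lemma pairing_mult:
  "character A \<psi> \<Longrightarrow> character B \<kappa> \<Longrightarrow> x \<in> carrier (min_tensor A B) \<Longrightarrow>
     pairing \<psi> \<kappa> (\<lambda>p. op_mult (x p) (y p)) = pairing \<psi> \<kappa> x * pairing \<psi> \<kappa> y"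
  unfolding pairing_def slicing.slice_mult[OF slicing_pairing] by (simp add: op_mult_finite UNIV_unit)

lemma character_pairing:
  assumes "character A \<psi>" "character B \<kappa>"
  shows "character (min_tensor A B) (pairing \<psi> \<kappa>)"
  unfolding character_def min_tensor_simps
  using pairing_mult[OF assms] by (simp add: pairing_linear pairing_elem[OF assms] characterD(1)[OF assms(1)] characterD(1)[OF assms(2)])

text \<open>Product characters are bounded by the tensor norm, so a dense span determines them.\<close>

lemma pairing_eqI:
  assumes tp: "tensor_product A B"
    and chars: "character A \<psi>" "character B \<kappa>" "character A \<psi>'" "character B \<kappa>'"
    and S: "S \<subseteq> carrier (min_tensor A B)" and dense: "cdense (min_tensor A B) (cspan (min_tensor A B) S)"
    and eq: "\<And>s. s \<in> S \<Longrightarrow> pairing \<psi> \<kappa> s = pairing \<psi>' \<kappa>' s"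
    and x: "x \<in> carrier (min_tensor A B)"
  shows "pairing \<psi> \<kappa> x = pairing \<psi>' \<kappa>' x"
proof -
  interpret tensor_product A B by (rule tp)
  interpret s: slicing A B "\<lambda>_::unit. undefined" "\<lambda>a _ _. \<psi> a" \<kappa> by (rule slicing_pairing[OF chars(1,2)])
  interpret s': slicing A B "\<lambda>_::unit. undefined" "\<lambda>a _ _. \<psi>' a" \<kappa>' by (rule slicing_pairing[OF chars(3,4)])
  have span: "y \<in> carrier (min_tensor A B) \<and> pairing \<psi> \<kappa> y = pairing \<psi>' \<kappa>' y"
    if "y \<in> cspan (min_tensor A B) S" for y
    using that
  proof (induction rule: cspan.induct)
    case zero
    then show ?case using alg_tensor_subset[OF alg_tensor.zero] by (simp add: min_tensor_simps pairing_linear)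
  next
    case (add_scaled y s z)
    then have "s \<in> carrier (min_tensor A B)" using S by blast
    then show ?case
      using add_scaled min_tensor_add_closed[of y A B] min_tensor_scale_closed[of s z]
      by (simp add: min_tensor_simps(4,5) pairing_linear eq)
  qed
  have "cmod (pairing \<psi> \<kappa> x - pairing \<psi>' \<kappa>' x) \<le> e" if e: "e > 0" for e
  proof -
    obtain y where y: "y \<in> cspan (min_tensor A B) S" and lt: "cnorm (min_tensor A B) (x \<ominus>\<^bsub>min_tensor A B\<^esub> y) < e / 2"
      using dense x e unfolding cdense_def by (metis half_gt_zero)
    have yc: "y \<in> carrier (min_tensor A B)" and ye: "pairing \<psi> \<kappa> y = pairing \<psi>' \<kappa>' y"
      using span[OF y] by auto
    have diff: "(\<lambda>p. op_diff (x p) (y p)) \<in> carrier (min_tensor A B)"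
      unfolding op_diff_eq by (intro min_tensor_add_closed x min_tensor_scale_closed yc)
    have le: "op_bound (op_diff (x p) (y p)) (e / 2)" if "p \<in> rep_pairs A B" for p
      using op_bound_mono[OF op_bound_cnorm[OF diff that] less_imp_le[OF lt[unfolded min_tensor_minus[OF x yc]]]] .
    have "cmod ((pairing \<psi> \<kappa> x - pairing \<psi>' \<kappa>' x) - (pairing \<psi> \<kappa> y - pairing \<psi>' \<kappa>' y)) \<le> e / 2 + e / 2"
      unfolding pairing_def
      by (rule order_trans[OF cmod_diff_diff add_mono[OF s.slice_diff_le[OF le] s'.slice_diff_le[OF le]]])
    then show ?thesis using ye by simp
  qed
  then have "cmod (pairing \<psi> \<kappa> x - pairing \<psi>' \<kappa>' x) \<le> 0" by (rule field_le_epsilon[of _ 0, simplified])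
  then show ?thesis by simp
qed

definition convolve :: "('c \<Rightarrow> ('c, 'c) tensor) \<Rightarrow> ('c \<Rightarrow> complex) \<Rightarrow> ('c \<Rightarrow> complex) \<Rightarrow> 'c \<Rightarrow> complex" where
  "convolve \<Delta> \<psi> \<kappa> c = pairing \<psi> \<kappa> (\<Delta> c)"

context
  fixes C :: "'c cstar_alg" and \<Delta> :: "'c \<Rightarrow> ('c, 'c) tensor"
  assumes tf: "tensor_factor C" and cqg: "compact_quantum_group C \<Delta>"
begin

lemma comult_hom: "unital_star_hom C (min_tensor C C) \<Delta>"
  using cqg by (simp add: compact_quantum_group_def)

lemma comult_in: "c \<in> carrier C \<Longrightarrow> \<Delta> c \<in> carrier (min_tensor C C)"
  by (rule unital_star_homD(1)[OF comult_hom])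

lemma tensor_square: "tensor_product C C"
  using tf by (simp add: tensor_product_def)

lemma character_convolve:
  "character C \<psi> \<Longrightarrow> character C \<kappa> \<Longrightarrow> character C (convolve \<Delta> \<psi> \<kappa>)"
  unfolding convolve_def[abs_def]
  by (rule character_compose[OF comult_hom character_pairing])

lemma one_in_C: "\<one>\<^bsub>C\<^esub> \<in> carrier C"
  by (rule tensor_factor.one_in[OF tf])

text \<open>On \<open>\<Delta>(c)(d \<otimes> 1)\<close> the character \<open>\<psi> \<otimes> \<kappa>\<close> takes the value \<open>(\<psi> * \<kappa>)(c) \<psi>(d)\<close>, which depends on \<open>\<kappa>\<close> through
the convolution only. These elements span a dense subspace, so \<open>\<psi> * \<kappa>\<close> determines
\<open>\<psi> \<otimes> \<kappa>\<close>, and \<open>\<kappa>\<close> is recovered on the elements \<open>1 \<otimes> d\<close>.\<close>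

lemma convolve_left_cancel:
  assumes \<psi>: "character C \<psi>" and \<kappa>: "character C \<kappa>" and \<kappa>': "character C \<kappa>'"
    and eq: "\<And>c. c \<in> carrier C \<Longrightarrow> convolve \<Delta> \<psi> \<kappa> c = convolve \<Delta> \<psi> \<kappa>' c"
    and d: "d \<in> carrier C"
  shows "\<kappa> d = \<kappa>' d"
proof -
  interpret tensor_product C C by (rule tensor_square)
  let ?S = "{\<Delta> c \<otimes>\<^bsub>min_tensor C C\<^esub> elem_tensor C C d \<one>\<^bsub>C\<^esub> | c d. c \<in> carrier C \<and> d \<in> carrier C}"
  have "pairing \<psi> \<kappa> (elem_tensor C C \<one>\<^bsub>C\<^esub> d) = pairing \<psi> \<kappa>' (elem_tensor C C \<one>\<^bsub>C\<^esub> d)"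
  proof (rule pairing_eqI[OF tensor_square \<psi> \<kappa> \<psi> \<kappa>', where S = ?S])
    show "?S \<subseteq> carrier (min_tensor C C)"
      using min_tensor_mult_elem_closed comult_in one_in_C by (auto simp: min_tensor_simps(1))
    show "cdense (min_tensor C C) (cspan (min_tensor C C) ?S)"
      using cqg by (simp add: compact_quantum_group_def)
    show "elem_tensor C C \<one>\<^bsub>C\<^esub> d \<in> carrier (min_tensor C C)"
      using d one_in_C by (intro elem_in_min_tensor)
    fix s assume "s \<in> ?S"
    then obtain c d where c: "c \<in> carrier C" and d: "d \<in> carrier C"
      and s: "s = (\<lambda>p. op_mult (\<Delta> c p) (elem_tensor C C d \<one>\<^bsub>C\<^esub> p))"
      by (auto simp: min_tensor_simps(1))
    show "pairing \<psi> \<kappa> s = pairing \<psi> \<kappa>' s"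
      unfolding s pairing_mult[OF \<psi> \<kappa> comult_in[OF c]] pairing_mult[OF \<psi> \<kappa>' comult_in[OF c]]
      using eq[OF c] by (simp add: convolve_def pairing_elem \<psi> \<kappa> \<kappa>' characterD(1)[OF \<kappa>] characterD(1)[OF \<kappa>'])
  qed
  then show ?thesis by (simp add: pairing_elem \<psi> \<kappa> \<kappa>' characterD(1)[OF \<psi>])
qed

text \<open>The mirror image of the preceding argument, with the elements \<open>\<Delta>(c)(1 \<otimes> d)\<close>.\<close>

lemma convolve_right_cancel:
  assumes \<psi>: "character C \<psi>" and \<kappa>: "character C \<kappa>" and \<kappa>': "character C \<kappa>'"
    and eq: "\<And>c. c \<in> carrier C \<Longrightarrow> convolve \<Delta> \<kappa> \<psi> c = convolve \<Delta> \<kappa>' \<psi> c"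
    and d: "d \<in> carrier C"
  shows "\<kappa> d = \<kappa>' d"
proof -
  interpret tensor_product C C by (rule tensor_square)
  let ?S = "{\<Delta> c \<otimes>\<^bsub>min_tensor C C\<^esub> elem_tensor C C \<one>\<^bsub>C\<^esub> d | c d. c \<in> carrier C \<and> d \<in> carrier C}"
  have "pairing \<kappa> \<psi> (elem_tensor C C d \<one>\<^bsub>C\<^esub>) = pairing \<kappa>' \<psi> (elem_tensor C C d \<one>\<^bsub>C\<^esub>)"
  proof (rule pairing_eqI[OF tensor_square \<kappa> \<psi> \<kappa>' \<psi>, where S = ?S])
    show "?S \<subseteq> carrier (min_tensor C C)"
      using min_tensor_mult_elem_closed comult_in one_in_C by (auto simp: min_tensor_simps(1))
    show "cdense (min_tensor C C) (cspan (min_tensor C C) ?S)"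
      using cqg by (simp add: compact_quantum_group_def)
    show "elem_tensor C C d \<one>\<^bsub>C\<^esub> \<in> carrier (min_tensor C C)"
      using d one_in_C by (intro elem_in_min_tensor)
    fix s assume "s \<in> ?S"
    then obtain c d where c: "c \<in> carrier C" and d: "d \<in> carrier C"
      and s: "s = (\<lambda>p. op_mult (\<Delta> c p) (elem_tensor C C \<one>\<^bsub>C\<^esub> d p))"
      by (auto simp: min_tensor_simps(1))
    show "pairing \<kappa> \<psi> s = pairing \<kappa>' \<psi> s"
      unfolding s pairing_mult[OF \<kappa> \<psi> comult_in[OF c]] pairing_mult[OF \<kappa>' \<psi> comult_in[OF c]]
      using eq[OF c] by (simp add: convolve_def pairing_elem \<psi> \<kappa> \<kappa>' characterD(1)[OF \<kappa>] characterD(1)[OF \<kappa>'])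
  qed
  then show ?thesis by (simp add: pairing_elem \<psi> \<kappa> \<kappa>' characterD(1)[OF \<psi>])
qed

lemma continuous_on_convolve:
  fixes S :: "'s::topological_space set"
  assumes "\<And>s. s \<in> S \<Longrightarrow> character C (\<psi> s)" "\<And>s. s \<in> S \<Longrightarrow> character C (\<kappa> s)"
    and "\<And>c. c \<in> carrier C \<Longrightarrow> continuous_on S (\<lambda>s. \<psi> s c)"
    and "\<And>c. c \<in> carrier C \<Longrightarrow> continuous_on S (\<lambda>s. \<kappa> s c)"
    and c: "c \<in> carrier C"
  shows "continuous_on S (\<lambda>s. convolve \<Delta> (\<psi> s) (\<kappa> s) c)"
  unfolding convolve_def pairing_def
  by (rule continuous_on_slice[OF slicing_pairing _ _ comult_in[OF c]]) (use assms in auto)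

end

section \<open>Topology of the sphere of rank-one projections\<close>

text \<open>If a point \<open>y\<close> were missed, stereographic projection from \<open>y\<close> would embed the sphere into the
  plane.\<close>

lemma two_sphere_injective_imp_surjective:
  assumes cont: "continuous_on two_sphere f" and inj: "inj_on f two_sphere"
    and im: "f ` two_sphere \<subseteq> two_sphere"
  shows "f ` two_sphere = two_sphere"
proof (rule ccontr)
  assume "f ` two_sphere \<noteq> two_sphere"
  then obtain y where y: "y \<in> two_sphere" "y \<notin> f ` two_sphere" using im by blast
  have "(two_sphere - {y}) homeomorphic (UNIV :: complex set)"
    by (rule homeomorphic_punctured_sphere_affine) (use y in \<open>auto simp: aff_dim_UNIV\<close>)
  then obtain h k where hk: "homeomorphism (two_sphere - {y}) (UNIV :: complex set) h k"
    unfolding homeomorphic_def by blast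
  have sub: "f ` two_sphere \<subseteq> two_sphere - {y}" using im y by blast
  have "continuous_on two_sphere (\<lambda>x. h (f x))"
    using continuous_on_compose2[OF homeomorphism_cont1[OF hk] cont sub] .
  moreover have "inj_on (\<lambda>x. h (f x)) two_sphere"
  proof (rule inj_onI)
    fix a b assume ab: "a \<in> two_sphere" "b \<in> two_sphere" and "h (f a) = h (f b)"
    then have "k (h (f a)) = k (h (f b))" by simp
    then have "f a = f b" using homeomorphism_apply1[OF hk] sub ab by (metis image_eqI subsetD)
    then show "a = b" using inj_onD[OF inj] ab by blast
  qed
  ultimately have "DIM(complex \<times> real) \<le> DIM(complex)"
    by (rule no_embedding_sphere_lowdim) simp
  then show False by simp
qed

definition op_trace :: "2 op \<Rightarrow> complex" where
  "op_trace M = M 1 1 + M 2 2"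

text \<open>The inverse of the Bloch parametrisation.\<close>

definition bloch_vector :: "2 op \<Rightarrow> complex \<times> real" where
  "bloch_vector M = (2 * M 1 2, Re (M 1 1 - M 2 2))"

text \<open>The off-diagonal entry \<open>z\<close> satisfies \<open>z tr M = z\<close>. So either the trace is 1, or \<open>M\<close> is diagonal with
entries 0 and 1.\<close>

lemma projection_cases:
  fixes M :: "2 op"
  assumes idem: "op_mult M M = M" and adj: "op_adjoint M = M"
  shows "op_trace M \<in> {0, 1, 2}"
    and "op_trace M = 0 \<Longrightarrow> M = M2_entries 0"
    and "op_trace M = 2 \<Longrightarrow> M = M2_entries (mat 1)"
    and "op_trace M = 1 \<Longrightarrow> bloch_vector M \<in> two_sphere"
    and "op_trace M = 1 \<Longrightarrow> M = M2_entries (bloch (bloch_vector M))"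
proof -
  have i: "M i 1 * M 1 j + M i 2 * M 2 j = M i j" for i j
    using fun_cong[OF fun_cong[OF idem, of i], of j] by (simp add: op_mult_finite UNIV_2)
  have a: "cnj (M j i) = M i j" for i j
    using fun_cong[OF fun_cong[OF adj, of i], of j] by (simp add: op_adjoint_def)
  obtain p where p: "M 1 1 = of_real p" using a[of 1 1] by (metis Reals_cnj_iff Reals_cases)
  obtain q where q: "M 2 2 = of_real q" using a[of 2 2] by (metis Reals_cnj_iff Reals_cases)
  define z where "z = M 1 2"
  have z': "M 2 1 = cnj z" using a[of 1 2] unfolding z_def by simp
  have zz: "z * cnj z = of_real ((cmod z)\<^sup>2)" by (simp add: complex_norm_square del: of_real_power)
  have "complex_of_real (p * p + (cmod z)\<^sup>2) = of_real p"
    using i[of 1 1] zz by (simp add: p z' flip: z_def)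
  then have e1: "p * p + (cmod z)\<^sup>2 = p" by (simp only: of_real_eq_iff)
  have "complex_of_real ((cmod z)\<^sup>2 + q * q) = of_real q"
    using i[of 2 2] zz by (simp add: q z' mult.commute flip: z_def)
  then have e2: "(cmod z)\<^sup>2 + q * q = q" by (simp only: of_real_eq_iff)
  have e3: "z * of_real (p + q) = z"
    using i[of 1 2] by (simp add: p q distrib_left mult.commute flip: z_def)
  have tr: "op_trace M = of_real (p + q)" by (simp add: op_trace_def p q)
  have M: "M = M2_entries m" if "m $ 1 $ 1 = of_real p" "m $ 2 $ 2 = of_real q" "m $ 1 $ 2 = z" "m $ 2 $ 1 = cnj z" for m
  proof (intro ext)
    fix k l show "M k l = M2_entries m k l"
      using exhaust_2[of k] exhaust_2[of l] that p q z' by (auto simp: M2_entries_def z_def)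
  qed
  have z0: "p \<in> {0, 1} \<and> q \<in> {0, 1}" if "z = 0"
    using e1 e2 that by (auto simp: mult_eq_self_implies_10)
  have cases: "p + q = 1 \<or> (z = 0 \<and> p \<in> {0, 1} \<and> q \<in> {0, 1})"
  proof (cases "z = 0")
    case False
    then have "complex_of_real (p + q) = 1" using e3 by (simp only: mult_cancel_left2) simp
    then show ?thesis by (metis of_real_eq_1_iff)
  qed (use z0 in blast)
  show "op_trace M \<in> {0, 1, 2}"
    using cases unfolding tr by (auto simp flip: of_real_add)
  show "M = M2_entries 0" if "op_trace M = 0"
  proof -
    have "p + q = 0" using that unfolding tr by (simp only: of_real_eq_0_iff)
    then have "z = 0" "p = 0" "q = 0" using cases by auto
    then show ?thesis by (intro M) simp_all
  qed
  show "M = M2_entries (mat 1)" if "op_trace M = 2"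
  proof -
    have "complex_of_real (p + q) = of_real 2" using that unfolding tr by simp
    then have "p + q = 2" by (simp only: of_real_eq_iff)
    then have "z = 0" "p = 1" "q = 1" using cases by auto
    then show ?thesis by (intro M) (simp_all add: mat_def)
  qed
  assume "op_trace M = 1"
  then have pq: "p + q = 1" unfolding tr by (simp only: of_real_eq_1_iff)
  have bv: "bloch_vector M = (2 * z, p - q)" by (simp add: bloch_vector_def p q z_def)
  have q': "q = 1 - p" and zp: "(cmod z)\<^sup>2 = p - p * p" using pq e1 by simp_all
  have "(2 * cmod z)\<^sup>2 + (p - (1 - p))\<^sup>2 = 1"
    unfolding power_mult_distrib zp by (simp add: power2_eq_square algebra_simps)
  then show "bloch_vector M \<in> two_sphere"
    unfolding in_two_sphere bv q' by (simp add: norm_mult)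
  have "(1 + (p - q)) / 2 = p" "(1 - (p - q)) / 2 = q" using pq by (simp_all add: field_simps)
  then show "M = M2_entries (bloch (bloch_vector M))"
    by (intro M) (simp_all add: bv del: of_real_divide of_real_add of_real_diff)
qed

text \<open>The trace is constant, as the sphere is connected. It is not 0 or 2, since only one projection
  has such a trace and the family is injective. So the family is an injective continuous map of the
  sphere to itself, and therefore onto.\<close>

lemma injective_projection_family:
  assumes proj: "\<And>x. x \<in> two_sphere \<Longrightarrow> op_mult (g x) (g x) = g x"
      "\<And>x. x \<in> two_sphere \<Longrightarrow> op_adjoint (g x) = g x"
    and cont: "\<And>i j. continuous_on two_sphere (\<lambda>x. g x i j)"
    and inj: "inj_on g two_sphere"
  shows "\<And>x. x \<in> two_sphere \<Longrightarrow> op_trace (g x) = 1"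
    and "\<And>y. y \<in> two_sphere \<Longrightarrow> \<exists>x\<in>two_sphere. g x = M2_entries (bloch y)"
proof -
  note pc = projection_cases[OF proj(1) proj(2)]
  have "(\<lambda>x. op_trace (g x)) constant_on two_sphere"
  proof (rule continuous_finite_range_constant)
    show "connected two_sphere" by (rule connected_sphere) simp
    show "continuous_on two_sphere (\<lambda>x. op_trace (g x))"
      unfolding op_trace_def by (intro continuous_intros cont)
    show "finite ((\<lambda>x. op_trace (g x)) ` two_sphere)"
    proof (rule finite_subset)
      show "(\<lambda>x. op_trace (g x)) ` two_sphere \<subseteq> {0, 1, 2}" using pc(1) by blast
    qed simp
  qed
  then obtain c where c: "\<And>x. x \<in> two_sphere \<Longrightarrow> op_trace (g x) = c"
    unfolding constant_on_def by blast
  have pts: "(0, 1) \<in> two_sphere" "(0, -1) \<in> two_sphere" by (simp_all add: norm_prod_def)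
  have ne: "g (0, 1) \<noteq> g (0, -1)" using inj_onD[OF inj _ pts] by auto
  have "c \<noteq> 0"
    using pc(2)[OF pts(1) pts(1)] pc(2)[OF pts(2) pts(2)] c[OF pts(1)] c[OF pts(2)] ne by auto
  moreover have "c \<noteq> 2"
    using pc(3)[OF pts(1) pts(1)] pc(3)[OF pts(2) pts(2)] c[OF pts(1)] c[OF pts(2)] ne by auto
  moreover have "c \<in> {0, 1, 2}" using pc(1)[OF pts(1) pts(1)] c[OF pts(1)] by simp
  ultimately have "c = 1" by blast
  then show tr: "op_trace (g x) = 1" if "x \<in> two_sphere" for x using c that by simp
  have g: "g x = M2_entries (bloch (bloch_vector (g x)))" if "x \<in> two_sphere" for x
    by (rule pc(5)[OF that that tr[OF that]])
  have "(\<lambda>x. bloch_vector (g x)) ` two_sphere = two_sphere"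
  proof (rule two_sphere_injective_imp_surjective)
    show "continuous_on two_sphere (\<lambda>x. bloch_vector (g x))"
      unfolding bloch_vector_def by (intro continuous_intros cont)
    show "inj_on (\<lambda>x. bloch_vector (g x)) two_sphere"
    proof (rule inj_onI)
      fix x y assume xy: "x \<in> two_sphere" "y \<in> two_sphere"
        and eq: "bloch_vector (g x) = bloch_vector (g y)"
      have "g x = M2_entries (bloch (bloch_vector (g x)))" by (rule g[OF xy(1)])
      also have "\<dots> = M2_entries (bloch (bloch_vector (g y)))" by (simp only: eq)
      also have "\<dots> = g y" by (rule g[OF xy(2), symmetric])
      finally show "x = y" using inj_onD[OF inj] xy by blast
    qed
    show "(\<lambda>x. bloch_vector (g x)) ` two_sphere \<subseteq> two_sphere"
      using pc(4) tr by blast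
  qed
  then have "\<exists>x\<in>two_sphere. y = bloch_vector (g x)" if "y \<in> two_sphere" for y
    using that by blast
  then show "\<exists>x\<in>two_sphere. g x = M2_entries (bloch y)" if "y \<in> two_sphere" for y
    using that g by blast
qed

section \<open>No compact quantum group structure\<close>

theorem theorem5p1:
  fixes B :: "(complex^2^2) cstar_alg"
    and A :: "(complex^2) cstar_alg"
    and \<delta> :: "complex^2 \<Rightarrow> (complex^2, complex^2) tensor"
    and C :: "'c cstar_alg"
    and \<Phi> :: "complex^2 \<Rightarrow> (complex^2^2, 'c) tensor"
  assumes "B = M2"
    and "A = C2" and "\<delta> = Z2_comult"
    and "quantum_space_of_all_maps B A C \<Phi>"
  shows "\<not> (\<exists>\<Delta> :: 'c \<Rightarrow> ('c, 'c) tensor. compact_quantum_group C \<Delta>)"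
proof
  assume "\<exists>\<Delta> :: 'c \<Rightarrow> ('c, 'c) tensor. compact_quantum_group C \<Delta>"
  then obtain \<Delta> :: "'c \<Rightarrow> ('c, 'c) tensor" where cqg: "compact_quantum_group C \<Delta>" by blast
  have univ: "quantum_space_of_all_maps M2 C2 C \<Phi>" using assms by simp
  then have \<Phi>: "unital_star_hom C2 (min_tensor M2 C) \<Phi>"
    by (simp add: quantum_space_of_all_maps_def)
  have \<Phi>_in: "\<Phi> C2_unit \<in> carrier (min_tensor M2 C)" using unital_star_homD(1)[OF \<Phi>] by simp
  let ?Q = "\<lambda>\<kappa>. M2_slice \<kappa> (\<Phi> C2_unit)"
  obtain \<kappa> where tf: "tensor_factor C"
    and char: "\<And>P. P \<in> projections \<Longrightarrow> character C (\<kappa> P)"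
    and Q: "\<And>P. P \<in> projections \<Longrightarrow> ?Q (\<kappa> P) = M2_entries P"
    and cont: "\<And>c. c \<in> carrier C \<Longrightarrow> continuous_on projections (\<lambda>P. \<kappa> P c)"
    using continuous_character_family[OF univ] by blast
  define \<kappa>s where "\<kappa>s x = \<kappa> (bloch x)" for x
  have bloch_in: "bloch x \<in> projections" if "x \<in> two_sphere" for x
    using that by (auto simp: projections_def)
  have char_s: "character C (\<kappa>s x)" if "x \<in> two_sphere" for x
    unfolding \<kappa>s_def by (rule char[OF bloch_in[OF that]])
  have cont_s: "continuous_on two_sphere (\<lambda>x. \<kappa>s x c)" if "c \<in> carrier C" for c
    unfolding \<kappa>s_def using bloch_in
    by (intro continuous_on_compose2[OF cont[OF that] continuous_on_bloch]) blast
  have Q_s: "?Q (\<kappa>s x) = M2_entries (bloch x)" if "x \<in> two_sphere" for x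
    unfolding \<kappa>s_def by (rule Q[OF bloch_in[OF that]])
  have s_inj: "x = y" if "x \<in> two_sphere" "y \<in> two_sphere"
    and "\<And>c. c \<in> carrier C \<Longrightarrow> \<kappa>s x c = \<kappa>s y c" for x y
    using M2_slice_cong[OF char_s[OF that(1)] char_s[OF that(2)] that(3) \<Phi>_in]
    unfolding Q_s[OF that(1)] Q_s[OF that(2)] M2_entries_eq_iff by (rule bloch_inject)
  have Q_cont: "continuous_on two_sphere (\<lambda>x. ?Q (\<omega> x) i j)"
    if "\<And>x. x \<in> two_sphere \<Longrightarrow> character C (\<omega> x)"
      and "\<And>c. c \<in> carrier C \<Longrightarrow> continuous_on two_sphere (\<lambda>x. \<omega> x c)" for \<omega> i j
    by (rule continuous_on_slice[OF slicing_M2 _ _ \<Phi>_in]) (use that in auto)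
  have char_eq: "\<psi> c = \<omega> c" if "character C \<psi>" "character C \<omega>" "?Q \<psi> = ?Q \<omega>" "c \<in> carrier C" for \<psi> \<omega> c
    by (rule character_determined_by_slice[OF univ tf that])
  note conv = character_convolve[OF tf cqg]
  have z: "0 \<in> projections" by (simp add: projections_def)
  \<comment> \<open>The character outside the sphere.\<close>
  define \<eta> where "\<eta> = \<kappa> 0"
  have \<eta>: "character C \<eta>" unfolding \<eta>_def by (rule char[OF z])
  obtain x0 :: "complex \<times> real" where x0: "x0 \<in> two_sphere"
    by (rule that[of "(0, 1)"]) (simp add: norm_prod_def)
  \<comment> \<open>Right translation by \<open>\<eta>\<close> maps the sphere into itself.\<close>
  have right: "op_trace (?Q (convolve \<Delta> (\<kappa>s x) \<eta>)) = 1" if "x \<in> two_sphere" for x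
  proof (rule injective_projection_family(1)[OF _ _ _ _ that])
    show "inj_on (\<lambda>x. ?Q (convolve \<Delta> (\<kappa>s x) \<eta>)) two_sphere"
    proof (rule inj_onI)
      fix x y assume xy: "x \<in> two_sphere" "y \<in> two_sphere"
        and eq: "?Q (convolve \<Delta> (\<kappa>s x) \<eta>) = ?Q (convolve \<Delta> (\<kappa>s y) \<eta>)"
      show "x = y"
        by (rule s_inj[OF xy], rule convolve_right_cancel[OF tf cqg \<eta> char_s[OF xy(1)] char_s[OF xy(2)]],
          rule char_eq[OF conv[OF char_s[OF xy(1)] \<eta>] conv[OF char_s[OF xy(2)] \<eta>] eq])
    qed
    show "continuous_on two_sphere (\<lambda>x. ?Q (convolve \<Delta> (\<kappa>s x) \<eta>) i j)" for i j
      by (intro Q_cont conv char_s \<eta> continuous_on_convolve[OF tf cqg] cont_s continuous_on_const)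
  qed (use M2_slice_projection[OF \<Phi> conv[OF char_s \<eta>]] in blast)+
  \<comment> \<open>Left translation by a point of the sphere maps the sphere onto itself.\<close>
  have left: "\<exists>x\<in>two_sphere. ?Q (convolve \<Delta> (\<kappa>s x0) (\<kappa>s x)) = M2_entries (bloch y)"
    if "y \<in> two_sphere" for y
  proof (rule injective_projection_family(2)[OF _ _ _ _ that])
    show "inj_on (\<lambda>x. ?Q (convolve \<Delta> (\<kappa>s x0) (\<kappa>s x))) two_sphere"
    proof (rule inj_onI)
      fix x y assume xy: "x \<in> two_sphere" "y \<in> two_sphere"
        and eq: "?Q (convolve \<Delta> (\<kappa>s x0) (\<kappa>s x)) = ?Q (convolve \<Delta> (\<kappa>s x0) (\<kappa>s y))"
      show "x = y"
        by (rule s_inj[OF xy], rule convolve_left_cancel[OF tf cqg char_s[OF x0] char_s[OF xy(1)] char_s[OF xy(2)]],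
          rule char_eq[OF conv[OF char_s[OF x0] char_s[OF xy(1)]] conv[OF char_s[OF x0] char_s[OF xy(2)]] eq])
    qed
    show "continuous_on two_sphere (\<lambda>x. ?Q (convolve \<Delta> (\<kappa>s x0) (\<kappa>s x)) i j)" for i j
      by (intro Q_cont conv char_s x0 continuous_on_convolve[OF tf cqg] cont_s continuous_on_const)
  qed (use M2_slice_projection[OF \<Phi> conv[OF char_s[OF x0] char_s]] in blast)+
  note M = M2_slice_projection[OF \<Phi> conv[OF char_s[OF x0] \<eta>]]
  \<comment> \<open>So the left translates of \<open>\<eta>\<close> and of some point \<open>x\<close> of the sphere coincide.\<close>
  obtain x where x: "x \<in> two_sphere"
    and eq: "?Q (convolve \<Delta> (\<kappa>s x0) (\<kappa>s x)) = ?Q (convolve \<Delta> (\<kappa>s x0) \<eta>)"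
    using left[OF projection_cases(4)[OF M right[OF x0]]] projection_cases(5)[OF M right[OF x0]] by metis
  have "\<kappa>s x c = \<eta> c" if "c \<in> carrier C" for c
    by (rule convolve_left_cancel[OF tf cqg char_s[OF x0] char_s[OF x] \<eta> _ that],
      rule char_eq[OF conv[OF char_s[OF x0] char_s[OF x]] conv[OF char_s[OF x0] \<eta>] eq])
  then have "?Q (\<kappa>s x) = ?Q \<eta>"
    by (rule M2_slice_cong[OF char_s[OF x] \<eta> _ \<Phi>_in])
  then have "bloch x = 0" by (simp add: Q_s[OF x] \<eta>_def Q[OF z] M2_entries_eq_iff)
  then have "bloch x $ 1 $ 1 + bloch x $ 2 $ 2 = 0" by simp
  then show False by (simp add: field_simps)
qed

end
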